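(* Let $n\ge1$. The $W_t(j)$ coefficients for the $\mathfrak{su}(2)$ quantum metric on the irreducible representation of $\mathfrak{su}(2)$ of dimension $n+1$ are given by $$W_t(j)=\frac{(-1)^{t+j}(2t+1)\,t!^2j!^2(n-t)!(n-j)!}{(n+t+1)!(n+j+1)!}\sum_{s=\max(t,j)}^{\min(t+j,n)}\frac{(-1)^s(n+s+1)!}{(s-t)!^2(s-j)!^2(t+j-s)!^2(n-s)!}$$ for $0\le t,j\le n$.
   Context: The $\mathfrak{su}(2)$ quantum metric: $\mathcal{H}$ is the $(n+1)$-dimensional irreducible unitary representation of $\mathfrak{su}(2)$, $\phi:\mathfrak{su}(2)\to\mathcal{L}(\mathcal{H})$ the action, $\mathcal{E}=\operatorname{span}_{\mathbb{C}}(I_{\mathcal{H}},\phi(\mathfrak{su}(2)))$, $\mathcal{E}_t=\mathbb{C}I_{\mathcal{H}}$ for $0\le t<1$ and $\mathcal{E}_t=\mathcal{E}^{\lfloor t\rfloor}$ (span of products of $\lfloor t\rfloor$ elements of $\mathcal{E}$) for $t\ge1$. Its diameter (smallest $r$ with $\mathcal{E}_r=\mathcal{L}(\mathcal{H})$) is $r=n$. On $\mathcal{L}(\mathcal{H})$ use the Hilbert–Schmidt inner product $\operatorname{tr}(E^*F)$; put $\mathcal{V}_0=\mathbb{C}I_{\mathcal{H}}$ and $\mathcal{V}_t=\mathcal{E}_t\cap\mathcal{E}_{t-1}^\perp$ for $1\le t\le n$. $W_t(j)$ coefficients: for $\mathcal{B}_t$ any orthonormal basis of $\mathcal{V}_t$,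 let $\Phi_t(X)=\sum_{E\in\mathcal{B}_t}EXE^*$ and let $\Pi_t(X)=\sum_{E\in\mathcal{B}_t}\operatorname{tr}(E^*X)E$ (the orthogonal projection onto $\mathcal{V}_t$), as linear maps on the self-adjoint operators. The coefficients $W_t(j)\in\mathbb{R}$ are the unique numbers with $\Phi_t=\sum_{j=0}^{r}W_t(j)\Pi_j$ for $0\le t\le r$; equivalently $\Phi_t(X)=W_t(j)X$ for $X\in\mathcal{V}_j$ (such numbers exist for this metric). *)

theory Defs
  imports "HOL-Analysis.Analysis"
begin

text \<open>
  The Hilbert space is \<open>complex ^ 'd\<close> with its standard Hermitian inner product, and operators
  on it are matrices \<open>complex ^ 'd ^ 'd\<close>. The type class instances make this only a real vector
  space, so complex scaling of matrices is introduced separately.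
\<close>

definition cscale :: "complex \<Rightarrow> complex ^ 'm ^ 'd \<Rightarrow> complex ^ 'm ^ 'd" where
  "cscale c A = (\<chi> i j. c * A $ i $ j)"

interpretation cmat: vector_space "cscale :: complex \<Rightarrow> complex ^ 'm ^ 'd \<Rightarrow> complex ^ 'm ^ 'd"
  by unfold_locales (simp_all add: cscale_def vec_eq_iff algebra_simps)

definition adj :: "complex ^ 'm ^ 'd \<Rightarrow> complex ^ 'd ^ 'm" where
  "adj A = (\<chi> i j. cnj (A $ j $ i))"

definition hs_inner :: "complex ^ 'd ^ 'd \<Rightarrow> complex ^ 'd ^ 'd \<Rightarrow> complex" where
  "hs_inner E F = trace (adj E ** F)"

subsection \<open>Irreducible unitary representations of su(2)\<close>

definition su2 :: "(complex ^ 2 ^ 2) set" where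
  "su2 = {X. adj X = - X \<and> trace X = 0}"

definition commutator :: "complex ^ 'd ^ 'd \<Rightarrow> complex ^ 'd ^ 'd \<Rightarrow> complex ^ 'd ^ 'd" where
  "commutator A B = A ** B - B ** A"

text \<open>
  A representation of the real Lie algebra \<^const>\<open>su2\<close> is unitary if it acts by
  skew-adjoint operators. Values of \<open>\<phi>\<close> outside \<^const>\<open>su2\<close> are irrelevant.
\<close>

definition su2_unitary_rep :: "(complex ^ 2 ^ 2 \<Rightarrow> complex ^ 'd ^ 'd) \<Rightarrow> bool" where
  "su2_unitary_rep \<phi> \<longleftrightarrow>
     (\<forall>X\<in>su2. \<forall>Y\<in>su2. \<phi> (X + Y) = \<phi> X + \<phi> Y) \<and>
     (\<forall>X\<in>su2. \<forall>a::real. \<phi> (a *\<^sub>R X) = a *\<^sub>R \<phi> X) \<and>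
     (\<forall>X\<in>su2. \<forall>Y\<in>su2. \<phi> (commutator X Y) = commutator (\<phi> X) (\<phi> Y)) \<and>
     (\<forall>X\<in>su2. adj (\<phi> X) = - \<phi> X)"

definition su2_irreducible :: "(complex ^ 2 ^ 2 \<Rightarrow> complex ^ 'd ^ 'd) \<Rightarrow> bool" where
  "su2_irreducible \<phi> \<longleftrightarrow>
     (\<forall>S :: (complex ^ 'd) set.
        vec.subspace S \<and> (\<forall>X\<in>su2. \<forall>v\<in>S. \<phi> X *v v \<in> S) \<longrightarrow> S = {0} \<or> S = UNIV)"

subsection \<open>The su(2) quantum metric\<close>

definition su2_errors :: "(complex ^ 2 ^ 2 \<Rightarrow> complex ^ 'd ^ 'd) \<Rightarrow> (complex ^ 'd ^ 'd) set" where
  "su2_errors \<phi> = cmat.span (insert (mat 1) (\<phi> ` su2))"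

definition mat_products :: "(complex ^ 'd ^ 'd) set \<Rightarrow> nat \<Rightarrow> (complex ^ 'd ^ 'd) set" where
  "mat_products S k = {foldr (**) As (mat 1) | As. length As = k \<and> set As \<subseteq> S}"

definition su2_metric ::
  "(complex ^ 2 ^ 2 \<Rightarrow> complex ^ 'd ^ 'd) \<Rightarrow> real \<Rightarrow> (complex ^ 'd ^ 'd) set" where
  "su2_metric \<phi> t =
     (if t < 1 then cmat.span {mat 1}
      else cmat.span (mat_products (su2_errors \<phi>) (nat \<lfloor>t\<rfloor>)))"

subsection \<open>Diameter and coefficients of a quantum metric\<close>

text \<open>
  A metric \<open>\<E>\<close> is used here only through its values at integers; the smallest \<open>r\<close>
  with \<open>\<E> r\<close> the whole operator space is an integer because \<^const>\<open>su2_metric\<close> depends on \<open>t \<ge> 0\<close>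
  only through its floor.
\<close>

definition diameter_qm :: "(real \<Rightarrow> (complex ^ 'd ^ 'd) set) \<Rightarrow> nat" where
  "diameter_qm \<E> = (LEAST r. \<E> (real r) = UNIV)"

definition V_space :: "(real \<Rightarrow> (complex ^ 'd ^ 'd) set) \<Rightarrow> nat \<Rightarrow> (complex ^ 'd ^ 'd) set" where
  "V_space \<E> t =
     (if t = 0 then cmat.span {mat 1}
      else {F \<in> \<E> (real t). \<forall>G \<in> \<E> (real t - 1). hs_inner G F = 0})"

definition hs_orthonormal_basis :: "(complex ^ 'd ^ 'd) set \<Rightarrow> (complex ^ 'd ^ 'd) set \<Rightarrow> bool" where
  "hs_orthonormal_basis B V \<longleftrightarrow>
     finite B \<and> (\<forall>E\<in>B. \<forall>F\<in>B. hs_inner E F = (if E = F then 1 else 0)) \<and> cmat.span B = V"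

definition Phi_map :: "(complex ^ 'd ^ 'd) set \<Rightarrow> complex ^ 'd ^ 'd \<Rightarrow> complex ^ 'd ^ 'd" where
  "Phi_map B X = (\<Sum>E\<in>B. E ** X ** adj E)"

definition Pi_map :: "(complex ^ 'd ^ 'd) set \<Rightarrow> complex ^ 'd ^ 'd \<Rightarrow> complex ^ 'd ^ 'd" where
  "Pi_map B X = (\<Sum>E\<in>B. cscale (trace (adj E ** X)) E)"

text \<open>
  \<open>W\<close> is a family of coefficients of \<open>\<E>\<close>: writing \<open>r\<close> for the diameter,
  \<open>\<Phi>\<^sub>t = (\<Sum>j\<le>r. W t j \<Pi>\<^sub>j)\<close> on self-adjoint operators for all \<open>t \<le> r\<close>, whatever orthonormal
  bases \<open>B t\<close> of the spaces \<^term>\<open>V_space \<E> t\<close> are used. Nothing is said about \<open>W t j\<close> when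
  \<open>t > r\<close> or \<open>j > r\<close>.
\<close>

definition W_coefficients ::
  "(real \<Rightarrow> (complex ^ 'd ^ 'd) set) \<Rightarrow> (nat \<Rightarrow> nat \<Rightarrow> real) \<Rightarrow> bool" where
  "W_coefficients \<E> W \<longleftrightarrow>
     (\<forall>B. (\<forall>t \<le> diameter_qm \<E>. hs_orthonormal_basis (B t) (V_space \<E> t)) \<longrightarrow>
        (\<forall>t \<le> diameter_qm \<E>. \<forall>X. adj X = X \<longrightarrow>
           Phi_map (B t) X = (\<Sum>j\<le>diameter_qm \<E>. W t j *\<^sub>R Pi_map (B j) X)))"

end

theory Submission
  imports Defs "HOL-Computational_Algebra.Fundamental_Theorem_Algebra"
begin

text \<open>
  Under the adjoint action the operators on the irreducible representation split without multiplicities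
  into the components \<open>V\<^sub>j\<close> generated by \<open>J\<^sub>+\<^sup>j\<close>, \<open>j \<le> n\<close>, and \<open>\<Phi>\<^sub>t\<close> is equivariant; so by
  Schur's lemma it acts on \<open>V\<^sub>j\<close> as a scalar \<open>(2 t + 1) w(t, j)\<close>. Three properties determine \<open>w\<close>.
  It is Hermitian, by cyclicity of the trace in \<open>\<Sum> tr(F\<^sup>* E F E\<^sup>*)\<close>. Realignment, which exchanges \<open>\<Phi>\<^sub>t\<close> and
  \<open>\<Pi>\<^sub>t\<close>, shows that \<open>X \<mapsto> \<Sum>\<^sub>i J\<^sub>i \<Phi>\<^sub>t(X) J\<^sub>i\<close> is a combination of \<open>\<Phi>\<^sub>0, \<dots>, \<Phi>\<^sub>t\<^sub>+\<^sub>1\<close>, so that \<open>w(t, j)\<close>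
  is a polynomial of degree at most \<open>t\<close> in the Casimir eigenvalue \<open>j (j + 1)\<close>. Finally
  \<open>\<Sum>\<^sub>t \<Phi>\<^sub>t(X) = tr(X) I\<close>. This yields \<open>w\<close> as a terminating balanced \<open>4F3\<close> series, which a case of
  Whipple's transformation turns into Racah's single sum.
\<close>

section \<open>Racah coefficients\<close>

text \<open>Up to sign, w(t, j) is the 6j symbol with four entries n/2 and the two entries t and j,
  but no Clebsch-Gordan coefficient is computed. The degree bound arises as follows. The map Y ->
  sum J_i Pi_t(J_i Y) is equivariant with values in E_(t+1), hence a combination of Pi_0, ...,
  Pi_(t+1); its realignment is X -> sum J_i Phi_t(X) J_i. As X -> sum J_i X J_i acts on V_j by an
  affine function of j (j + 1), multiplying w(t, .) by j (j + 1) stays in the span of w(0, .), ...,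
  w(t+1, .). The argument does not show that the top coefficient is nonzero. Therefore polynomials
  are expanded in the rows of w, and this is inverted by the independence of the Newton polynomials
  on the levels 0, ..., n.

  The \<open>4F3\<close> series and Racah's sum do not agree term by term, so both are extended to
  polynomials in a real t. Invariance under t -> -1 - t is evident for the first, a polynomial in t
  (t + 1). The second is a coefficient of a product of two \<open>2F1\<close> series, and its
  invariance is Euler's transformation, whose prefactors cancel.\<close>

definition polynomial_le :: "nat \<Rightarrow> (real \<Rightarrow> real) \<Rightarrow> bool" where
  "polynomial_le d f \<longleftrightarrow> (\<exists>p. degree p \<le> d \<and> f = poly p)"

lemma polynomial_le_const: "polynomial_le d (\<lambda>x. c)"
  unfolding polynomial_le_def by (intro exI[of _ "[:c:]"]) auto

lemma polynomial_le_linear: "polynomial_le (Suc 0) (\<lambda>x. a * x + b)"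
  unfolding polynomial_le_def by (intro exI[of _ "[:b, a:]"]) (auto simp: algebra_simps)

lemma polynomial_le_mono: "polynomial_le d f \<Longrightarrow> d \<le> e \<Longrightarrow> polynomial_le e f"
  unfolding polynomial_le_def using order_trans by blast

lemma polynomial_le_mult:
  assumes "polynomial_le d f" "polynomial_le e g"
  shows "polynomial_le (d + e) (\<lambda>x. f x * g x)"
proof -
  obtain p q where "degree p \<le> d" "f = poly p" "degree q \<le> e" "g = poly q"
    using assms unfolding polynomial_le_def by auto
  then show ?thesis
    unfolding polynomial_le_def
    by (intro exI[of _ "p * q"]) (auto intro: order_trans[OF degree_mult_le])
qed

lemma polynomial_le_cmult: "polynomial_le d f \<Longrightarrow> polynomial_le d (\<lambda>x. c * f x)"
  using polynomial_le_mult[OF polynomial_le_const[of 0 c]] by simp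

lemma polynomial_le_sum:
  assumes "\<And>i. i \<in> A \<Longrightarrow> polynomial_le d (f i)"
  shows "polynomial_le d (\<lambda>x. \<Sum>i\<in>A. f i x)"
proof -
  obtain p where p: "\<And>i. i \<in> A \<Longrightarrow> degree (p i) \<le> d \<and> f i = poly (p i)"
    using assms unfolding polynomial_le_def by metis
  have "degree (\<Sum>i\<in>A. p i) \<le> d"
    by (cases "finite A") (use p in \<open>auto intro: degree_sum_le\<close>)
  moreover have "(\<lambda>x. \<Sum>i\<in>A. f i x) = poly (\<Sum>i\<in>A. p i)"
    using p by (auto simp: poly_sum intro!: ext sum.cong)
  ultimately show ?thesis
    unfolding polynomial_le_def by blast
qed

lemma polynomial_le_prod:
  assumes "finite A" "\<And>i. i \<in> A \<Longrightarrow> polynomial_le d (f i)"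
  shows "polynomial_le (d * card A) (\<lambda>x. \<Prod>i\<in>A. f i x)"
  using assms
proof (induction A rule: finite_induct)
  case empty
  then show ?case using polynomial_le_const[of 0 1] by simp
next
  case (insert a A)
  then have "polynomial_le (d + d * card A) (\<lambda>x. f a x * (\<Prod>i\<in>A. f i x))"
    by (intro polynomial_le_mult) auto
  with insert show ?case by simp
qed

lemma polynomial_le_unique:
  assumes "polynomial_le d f" "polynomial_le d g" "\<And>x. x \<in> A \<Longrightarrow> f x = g x" "d < card A"
  shows "f = g"
proof -
  obtain p q where "degree p \<le> d" "f = poly p" "degree q \<le> d" "g = poly q"
    using assms unfolding polynomial_le_def by auto
  with assms show ?thesis
    using poly_eqI_degree[of A p q] by auto
qed

lemma polynomial_le_gbinomial: "polynomial_le k (\<lambda>x. (a * x + b) gchoose k)"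
proof -
  have "polynomial_le (Suc 0 * card {0..<k}) (\<lambda>x. \<Prod>i\<in>{0..<k}. a * x + (b - real i))"
    by (intro polynomial_le_prod polynomial_le_linear) auto
  from polynomial_le_cmult[OF this, of "inverse (fact k)"] show ?thesis
    by (simp add: gbinomial_prod_rev field_simps)
qed

text \<open>
  The Newton polynomials in the Casimir eigenvalue \<open>x (x + 1)\<close>. They vanish at all levels below \<open>k\<close>,
  which makes the expansions below triangular.
\<close>

definition casimir_poly :: "nat \<Rightarrow> real \<Rightarrow> real" where
  "casimir_poly k x = (\<Prod>i<k. x * (x + 1) - real i * (real i + 1))"

lemma casimir_poly_0 [simp]: "casimir_poly 0 x = 1"
  by (simp add: casimir_poly_def)

lemma casimir_poly_reflect: "casimir_poly k (- 1 - x) = casimir_poly k x"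
  by (simp add: casimir_poly_def algebra_simps)

lemma casimir_poly_eq_0: "j < k \<Longrightarrow> casimir_poly k (real j) = 0"
  unfolding casimir_poly_def by (auto simp: prod_zero_iff)

text \<open>The factor with index \<open>i\<close> splits as (j - i)(j + i + 1), so the product is a
  falling factorial times a rising one.\<close>

lemma casimir_poly_fact: "k \<le> j \<Longrightarrow> casimir_poly k (real j) = fact (j + k) / fact (j - k)"
proof (induction k)
  case (Suc k)
  have "casimir_poly (Suc k) (real j) = casimir_poly k (real j) * (real j * (real j + 1) - real k * (real k + 1))"
    by (simp add: casimir_poly_def)
  also have "\<dots> = fact (j + k) / fact (j - k) * ((real j - real k) * (real (j + k) + 1))"
    using Suc by (simp add: algebra_simps)
  also have "fact (j - k) = (real j - real k) * (fact (j - Suc k) :: real)"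
    using Suc.prems by (subst fact_reduce) (auto simp: of_nat_diff)
  also have "fact (j + k) / ((real j - real k) * fact (j - Suc k)) * ((real j - real k) * (real (j + k) + 1))
      = fact (j + k) * (real (j + k) + 1) / fact (j - Suc k)"
    using Suc.prems by simp
  finally show ?case by (simp add: algebra_simps)
qed simp

lemma casimir_poly_pos: "k \<le> j \<Longrightarrow> casimir_poly k (real j) > 0"
  by (simp add: casimir_poly_fact)

lemma polynomial_le_casimir_poly: "polynomial_le (2 * k) (casimir_poly k)"
proof -
  have "polynomial_le ((Suc 0 + Suc 0) * card {..<k}) (\<lambda>x. \<Prod>i\<in>{..<k}. (1 * x + - real i) * (1 * x + (real i + 1)))"
    by (intro polynomial_le_prod polynomial_le_mult polynomial_le_linear) auto
  moreover have "(\<lambda>x. \<Prod>i\<in>{..<k}. (1 * x + - real i) * (1 * x + (real i + 1))) = casimir_poly k"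
    by (auto simp: casimir_poly_def algebra_simps intro!: ext prod.cong)
  ultimately show ?thesis by (simp add: mult_2)
qed

text \<open>The left side is the partial fraction expansion of the right side, the coefficient of
  1/(x + k) being the residue at -k. After clearing denominators both sides have degree at most
  \<open>t\<close> and agree at 0, -1, ..., -t, where a single summand survives. This is a case of
  the Pfaff-Saalschuetz sum, 3F2(-t, t + 1, x; 1, x + 1; 1); it serves at x = n + 1 and at x =
  1.\<close>

lemma casimir_poly_partial_fractions:
  assumes "x > 0"
  shows "(\<Sum>k\<le>t. (-1) ^ k * casimir_poly k (real t) / ((fact k)\<^sup>2 * (x + real k)))
    = (-1) ^ t * (\<Prod>i=1..t. x - real i) / (\<Prod>i\<le>t. x + real i)"
proof -
  define c where "c k = (-1) ^ k * casimir_poly k (real t) / (fact k)\<^sup>2" for k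
  have "(\<lambda>x. \<Sum>k\<le>t. c k * (\<Prod>i\<in>{..t} - {k}. 1 * x + real i)) = (\<lambda>x. (-1) ^ t * (\<Prod>i=1..t. 1 * x + - real i))"
  proof (rule polynomial_le_unique[where d = t and A = "(\<lambda>m. - real m) ` {..t}"])
    show "polynomial_le t (\<lambda>x. \<Sum>k\<le>t. c k * (\<Prod>i\<in>{..t} - {k}. 1 * x + real i))"
    proof (intro polynomial_le_sum polynomial_le_cmult)
      fix k assume "k \<in> {..t}"
      moreover have "polynomial_le (Suc 0 * card ({..t} - {k})) (\<lambda>x. \<Prod>i\<in>{..t} - {k}. 1 * x + real i)"
        by (intro polynomial_le_prod polynomial_le_linear) auto
      ultimately show "polynomial_le t (\<lambda>x. \<Prod>i\<in>{..t} - {k}. 1 * x + real i)" by simp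
    qed
    have "polynomial_le (Suc 0 * card {1..t}) (\<lambda>x. \<Prod>i=1..t. 1 * x + - real i)"
      by (intro polynomial_le_prod polynomial_le_linear) auto
    then show "polynomial_le t (\<lambda>x. (-1) ^ t * (\<Prod>i=1..t. 1 * x + - real i))"
      by (intro polynomial_le_cmult) auto
    have "card ((\<lambda>m. - real m) ` {..t}) = card {..t}"
      by (intro card_image) (auto simp: inj_on_def)
    then show "t < card ((\<lambda>m. - real m) ` {..t})" by simp
  next
    fix x assume "x \<in> (\<lambda>m. - real m) ` {..t}"
    then obtain m where m: "m \<le> t" "x = - real m" by auto
    have "(\<Prod>i\<in>{..t} - {k}. 1 * x + real i) = 0" if "k \<noteq> m" for k
      using that m by (intro prod_zero) auto
    then have "(\<Sum>k\<le>t. c k * (\<Prod>i\<in>{..t} - {k}. 1 * x + real i))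
        = (\<Sum>k\<in>{m}. c k * (\<Prod>i\<in>{..t} - {k}. 1 * x + real i))"
      using m by (intro sum.mono_neutral_right) auto
    also have "\<dots> = c m * ((\<Prod>i<m. real i - real m) * (\<Prod>i=Suc m..t. real i - real m))"
    proof -
      have "{..t} - {m} = {..<m} \<union> {Suc m..t}" using m by auto
      moreover have "{..<m} \<inter> {Suc m..t} = {}" by auto
      ultimately show ?thesis using m by (simp add: prod.union_disjoint)
    qed
    also have "(\<Prod>i<m. real i - real m) = (-1) ^ m * fact m"
    proof -
      have "(\<Prod>i<m. real i - real m) = (\<Prod>i<m. (-1) * real (m - i))"
        by (intro prod.cong) auto
      also have "\<dots> = (-1) ^ m * (\<Prod>i<m. real (m - i))" by (subst prod.distrib) simp
      also have "(\<Prod>i<m. real (m - i)) = fact m"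
        by (simp add: fact_prod_rev atLeast0LessThan)
      finally show ?thesis .
    qed
    also have "(\<Prod>i=Suc m..t. real i - real m) = fact (t - m)"
    proof -
      have "(\<Prod>i=Suc m..t. real i - real m) = (\<Prod>i=1..t-m. real i)"
        using m by (intro prod.reindex_bij_witness[of _ "\<lambda>i. i + m" "\<lambda>i. i - m"]) auto
      then show ?thesis by (simp add: fact_prod)
    qed
    also have "c m * ((-1) ^ m * fact m * fact (t - m)) = fact (t + m) / fact m"
      using m by (simp add: c_def casimir_poly_fact field_simps power2_eq_square flip: power_mult_distrib)
    also have "fact (t + m) / fact m = (\<Prod>i=1..t. real m + real i)"
    proof -
      have "fact (m + t) = fact m * (\<Prod>i=1..t. real m + real i)"
        by (induction t) (auto simp: algebra_simps)
      then show ?thesis by (simp add: add.commute)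
    qed
    also have "\<dots> = (-1) ^ t * (\<Prod>i=1..t. (-1) * (real m + real i))"
      unfolding prod.distrib by (simp flip: mult.assoc power_mult_distrib)
    finally show "(\<Sum>k\<le>t. c k * (\<Prod>i\<in>{..t} - {k}. 1 * x + real i)) = (-1) ^ t * (\<Prod>i=1..t. 1 * x + - real i)"
      using m by (simp add: algebra_simps)
  qed
  from fun_cong[OF this, of x]
  have eq: "(\<Sum>k\<le>t. c k * (\<Prod>i\<in>{..t} - {k}. x + real i)) = (-1) ^ t * (\<Prod>i=1..t. x - real i)"
    by simp
  have nz: "(\<Prod>i\<in>A. x + real i) \<noteq> 0" if "finite A" for A
    using assms that by (auto simp: prod_zero_iff)
  have "(-1) ^ k * casimir_poly k (real t) / ((fact k)\<^sup>2 * (x + real k))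
      = c k * (\<Prod>i\<in>{..t} - {k}. x + real i) / (\<Prod>i\<le>t. x + real i)" if "k \<le> t" for k
  proof -
    have "(\<Prod>i\<le>t. x + real i) = (x + real k) * (\<Prod>i\<in>{..t} - {k}. x + real i)"
      using that by (subst prod.remove[of _ k]) auto
    then show ?thesis
      using nz[of "{..t} - {k}"] by (simp add: c_def)
  qed
  then have "(\<Sum>k\<le>t. (-1) ^ k * casimir_poly k (real t) / ((fact k)\<^sup>2 * (x + real k)))
     = (\<Sum>k\<le>t. c k * (\<Prod>i\<in>{..t} - {k}. x + real i)) / (\<Prod>i\<le>t. x + real i)"
    by (simp add: sum_divide_distrib)
  then show ?thesis by (simp add: eq)
qed

section \<open>Euler's transformation for formal power series\<close>

text \<open>Up to the sign of \<open>X\<close>, this is the hypergeometric series \<open>2F1(-p, -q; 1)\<close>.\<close>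

definition hyper_fps :: "real \<Rightarrow> real \<Rightarrow> real fps" where
  "hyper_fps p q = Abs_fps (\<lambda>i. (-1) ^ i * ((p gchoose i) * (q gchoose i)))"

text \<open>Gauss's hypergeometric equation with parameters -p, -q; 1, rewritten in the variable
  -X.\<close>

definition hyper_ode :: "real \<Rightarrow> real \<Rightarrow> real fps \<Rightarrow> bool" where
  "hyper_ode p q F \<longleftrightarrow>
     fps_X * (1 + fps_X) * fps_deriv (fps_deriv F)
     + (1 + fps_const (1 - p - q) * fps_X) * fps_deriv F + fps_const (p * q) * F = 0"

text \<open>Since the lower parameter is 1, the leading factor of the recurrence is (i + 1)^2 and
  never vanishes: the constant term determines a power series solution.\<close>

lemma hyper_ode_iff:
  "hyper_ode p q F \<longleftrightarrow> (\<forall>i. (real i + 1)\<^sup>2 * fps_nth F (Suc i) = - ((p - real i) * (q - real i) * fps_nth F i))"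
proof -
  have coeff: "fps_nth (fps_X * (1 + fps_X) * fps_deriv (fps_deriv F)
     + (1 + fps_const (1 - p - q) * fps_X) * fps_deriv F + fps_const (p * q) * F) i
    = (real i + 1)\<^sup>2 * fps_nth F (Suc i) + (p - real i) * (q - real i) * fps_nth F i" for i
  proof -
    have expand: "fps_X * (1 + fps_X) * fps_deriv (fps_deriv F)
     + (1 + fps_const (1 - p - q) * fps_X) * fps_deriv F + fps_const (p * q) * F
     = fps_X * fps_deriv (fps_deriv F) + fps_X * (fps_X * fps_deriv (fps_deriv F)) + fps_deriv F
       + fps_const (1 - p - q) * (fps_X * fps_deriv F) + fps_const (p * q) * F"
      by (simp add: algebra_simps)
    show ?thesis
    proof (cases i)
      case (Suc m)
      then show ?thesis
        unfolding expand by (cases m) (auto simp: power2_eq_square algebra_simps)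
    qed (simp add: expand)
  qed
  then show ?thesis
    unfolding hyper_ode_def fps_eq_iff coeff by (simp add: add_eq_0_iff2)
qed

lemma hyper_ode_hyper_fps: "hyper_ode p q (hyper_fps p q)"
proof -
  have step: "(real i + 1) * (a gchoose Suc i) = (a - real i) * (a gchoose i)" for a :: real and i
    using gbinomial_absorb_comp[of a i] gbinomial_absorption[of i a] by (simp add: add.commute)
  show ?thesis
    unfolding hyper_ode_iff
  proof
    fix i
    have "(real i + 1)\<^sup>2 * fps_nth (hyper_fps p q) (Suc i)
      = - ((-1) ^ i * (((real i + 1) * (p gchoose Suc i)) * ((real i + 1) * (q gchoose Suc i))))"
      by (simp add: hyper_fps_def power2_eq_square)
    also have "\<dots> = - ((-1) ^ i * (((p - real i) * (p gchoose i)) * ((q - real i) * (q gchoose i))))"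
      by (simp only: step)
    also have "\<dots> = - ((p - real i) * (q - real i) * fps_nth (hyper_fps p q) i)"
      by (simp add: hyper_fps_def mult_ac)
    finally show "(real i + 1)\<^sup>2 * fps_nth (hyper_fps p q) (Suc i) = - ((p - real i) * (q - real i) * fps_nth (hyper_fps p q) i)" .
  qed
qed

lemma hyper_ode_unique:
  assumes "hyper_ode p q F" "hyper_ode p q G" "fps_nth F 0 = fps_nth G 0"
  shows "F = G"
proof -
  have "fps_nth F i = fps_nth G i" for i
  proof (induction i)
    case (Suc i)
    have "(real i + 1)\<^sup>2 * fps_nth F (Suc i) = (real i + 1)\<^sup>2 * fps_nth G (Suc i)"
      using assms Suc unfolding hyper_ode_iff by simp
    then show ?case by (simp add: add_eq_0_iff_both_eq_0)
  qed (use assms in simp)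
  then show ?thesis by (simp add: fps_eq_iff)
qed

text \<open>Euler's transformation 2F1(a, b; c; z) = (1 - z)^(c - a - b) 2F1(c - a, c - b; c; z) at
  a = -p, b = -q, c = 1, z = -X. Both sides have constant term 1, so it suffices that the right side
  solves the equation of the left side.\<close>

lemma hyper_fps_euler:
  "hyper_fps p q = fps_binomial (1 + p + q) * hyper_fps (- 1 - p) (- 1 - q)"
proof (rule hyper_ode_unique[OF hyper_ode_hyper_fps])
  define s where "s = 1 + p + q"
  define B where "B = fps_binomial s"
  define H where "H = hyper_fps (- 1 - p) (- 1 - q)"
  have B': "(1 + fps_X) * fps_deriv B = fps_const s * B"
    unfolding B_def fps_binomial_deriv by (simp add: fps_divide_unit mult.left_commute[of "1 + fps_X"] inverse_mult_eq_1')
  have B'': "(1 + fps_X) * fps_deriv (fps_deriv B) = fps_const (s - 1) * fps_deriv B"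
  proof -
    have "fps_deriv ((1 + fps_X) * fps_deriv B) = fps_deriv (fps_const s * B)"
      by (simp only: B')
    then show ?thesis by (simp add: algebra_simps flip: fps_const_sub)
  qed
  have H: "fps_X * (1 + fps_X) * fps_deriv (fps_deriv H)
     + (1 + fps_const (1 - (- 1 - p) - (- 1 - q)) * fps_X) * fps_deriv H + fps_const ((- 1 - p) * (- 1 - q)) * H = 0"
    using hyper_ode_hyper_fps[of "- 1 - p" "- 1 - q"] unfolding hyper_ode_def H_def .
  define P Q where "P = fps_const p" and "Q = fps_const q"
  have cst: "fps_const (1 - (- 1 - p) - (- 1 - q)) = 3 + P + Q" "fps_const ((- 1 - p) * (- 1 - q)) = (1 + P) * (1 + Q)"
     "fps_const (1 - p - q) = 1 - P - Q" "fps_const (p * q) = P * Q" "fps_const s = 1 + P + Q"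
     "fps_const (s - 1) = P + Q"
    unfolding P_def Q_def s_def
    by (simp_all add: numeral_fps_const algebra_simps flip: fps_const_1_eq_1 fps_const_add fps_const_sub fps_const_mult)
  \<comment> \<open>The binomial series is known through (1 + X) B' = s B, so the equation for B H
    is checked after multiplication by 1 + X, which is cancelled afterwards. Here \<open>x\<close>,
    \<open>b\<close>, \<open>h\<close> stand for X, B, H, and the digits count derivatives.\<close>
  have ring: "(1 + x) * (x * (1 + x) * (b2 * h + b1 * h1 + (b1 * h1 + b * h2))
      + (1 + (1 - u - v) * x) * (b1 * h + b * h1) + u * v * (b * h)) = 0"
    if "(1 + x) * b1 = (1 + u + v) * b" "(1 + x) * b2 = (u + v) * b1"
      "x * (1 + x) * h2 + (1 + (3 + u + v) * x) * h1 + (1 + u) * (1 + v) * h = 0"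
    for x b b1 b2 h h1 h2 u v :: "real fps"
  proof -
    have "(1 + x) * (x * (1 + x) * (b2 * h + b1 * h1 + (b1 * h1 + b * h2))
      + (1 + (1 - u - v) * x) * (b1 * h + b * h1) + u * v * (b * h))
      = x * h * ((1 + x) * ((1 + x) * b2)) + ((1 + x) * b1) * (2 * x * (1 + x) * h1 + (1 + (1 - u - v) * x) * h)
        + b * (1 + x) * (x * (1 + x) * h2 + (1 + (1 - u - v) * x) * h1 + u * v * h)"
      by (simp add: algebra_simps)
    also have "(1 + x) * ((1 + x) * b2) = (u + v) * ((1 + x) * b1)"
      unfolding that(2) by (simp add: algebra_simps)
    also have "x * h * ((u + v) * ((1 + x) * b1)) + ((1 + x) * b1) * (2 * x * (1 + x) * h1 + (1 + (1 - u - v) * x) * h)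
        + b * (1 + x) * (x * (1 + x) * h2 + (1 + (1 - u - v) * x) * h1 + u * v * h)
      = b * (1 + x) * (x * (1 + x) * h2 + (1 + (3 + u + v) * x) * h1 + (1 + u) * (1 + v) * h)"
      unfolding that(1) by (simp add: algebra_simps)
    finally show ?thesis unfolding that(3) by simp
  qed
  have "(1 + fps_X) * (fps_X * (1 + fps_X) * fps_deriv (fps_deriv (B * H))
     + (1 + fps_const (1 - p - q) * fps_X) * fps_deriv (B * H) + fps_const (p * q) * (B * H)) = 0"
    using ring[OF B'[unfolded cst] B''[unfolded cst] H[unfolded cst]] unfolding cst
    by (simp add: algebra_simps)
  moreover have "(1 + fps_X :: real fps) \<noteq> 0"
    by (auto simp: fps_eq_iff intro!: exI[of _ 0])
  ultimately have "hyper_ode p q (B * H)"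
    unfolding hyper_ode_def by (metis mult_eq_0_iff)
  then show "hyper_ode p q (fps_binomial (1 + p + q) * hyper_fps (- 1 - p) (- 1 - q))"
    by (simp add: B_def H_def s_def)
  show "fps_nth (hyper_fps p q) 0 = fps_nth (fps_binomial (1 + p + q) * hyper_fps (- 1 - p) (- 1 - q)) 0"
    by (simp add: hyper_fps_def)
qed

text \<open>The exponents of the two Euler prefactors, 1 + 2 t and 1 + b + c, add up to
  zero.\<close>

lemma hyper_fps_product_reflect:
  assumes "b + c = - 2 * t - 2"
  shows "hyper_fps t t * hyper_fps b c = hyper_fps (- 1 - t) (- 1 - t) * hyper_fps (- 1 - b) (- 1 - c)"
proof -
  have "(1 + t + t) + (1 + b + c) = 0"
    using assms by simp
  then have binomials: "fps_binomial (1 + t + t) * fps_binomial (1 + b + c) = 1"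
    by (simp only: fps_binomial_0 flip: fps_binomial_add_mult)
  have "hyper_fps t t * hyper_fps b c
      = (fps_binomial (1 + t + t) * hyper_fps (- 1 - t) (- 1 - t)) * (fps_binomial (1 + b + c) * hyper_fps (- 1 - b) (- 1 - c))"
    by (simp only: hyper_fps_euler[of t t, symmetric] hyper_fps_euler[of b c, symmetric])
  also have "\<dots> = (fps_binomial (1 + t + t) * fps_binomial (1 + b + c)) * (hyper_fps (- 1 - t) (- 1 - t) * hyper_fps (- 1 - b) (- 1 - c))"
    by (simp only: mult_ac)
  finally show ?thesis
    by (simp only: binomials mult_1_left)
qed

section \<open>The two sides of Whipple's transformation\<close>

definition whipple_sum :: "nat \<Rightarrow> real \<Rightarrow> real \<Rightarrow> real" where
  "whipple_sum j N t = (\<Sum>r\<le>j. (t gchoose (j - r))\<^sup>2 * ((N - t - 1) gchoose r) * ((- N - t - 1) gchoose r))"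

lemma whipple_sum_conv_fps:
  "whipple_sum j N t = (-1) ^ j * fps_nth (hyper_fps (N - t - 1) (- N - t - 1) * hyper_fps t t) j"
  unfolding whipple_sum_def fps_mult_nth sum_distrib_left atLeast0AtMost
proof (intro sum.cong refl)
  fix r assume "r \<in> {..j}"
  then have "(-1) ^ j * ((-1) ^ r * (-1) ^ (j - r)) = (1 :: real)"
    by (simp flip: power_add)
  moreover have "(-1) ^ j * (fps_nth (hyper_fps (N - t - 1) (- N - t - 1)) r * fps_nth (hyper_fps t t) (j - r))
    = ((-1) ^ j * ((-1) ^ r * (-1) ^ (j - r)))
      * ((t gchoose (j - r))\<^sup>2 * ((N - t - 1) gchoose r) * ((- N - t - 1) gchoose r))"
    by (simp add: hyper_fps_def power2_eq_square)
  ultimately show "(t gchoose (j - r))\<^sup>2 * ((N - t - 1) gchoose r) * ((- N - t - 1) gchoose r)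
    = (-1) ^ j * (fps_nth (hyper_fps (N - t - 1) (- N - t - 1)) r * fps_nth (hyper_fps t t) (j - r))"
    by (simp only: mult_1_left)
qed

lemma hyper_fps_commute: "hyper_fps p q = hyper_fps q p"
  by (simp add: hyper_fps_def mult.commute)

text \<open>With b = N - t - 1 and c = -N - t - 1, replacing t by -1 - t turns b into -1 - c and c
  into -1 - b, which is the situation of \<open>hyper_fps_product_reflect\<close>.\<close>

lemma whipple_sum_reflect: "whipple_sum j N (- 1 - t) = whipple_sum j N t"
proof -
  have "hyper_fps t t * hyper_fps (N - t - 1) (- N - t - 1)
      = hyper_fps (- 1 - t) (- 1 - t) * hyper_fps (N - (- 1 - t) - 1) (- N - (- 1 - t) - 1)"
    using hyper_fps_product_reflect[of "N - t - 1" "- N - t - 1" t]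
      hyper_fps_commute[of "N - (- 1 - t) - 1" "- N - (- 1 - t) - 1"] by (simp add: add.commute)
  then show ?thesis
    by (simp only: whipple_sum_conv_fps mult.commute[of _ "hyper_fps x x" for x])
qed

lemma polynomial_le_whipple_sum: "polynomial_le (2 * j) (whipple_sum j N)"
proof -
  have "polynomial_le (2 * j) (\<lambda>t. ((1 * t + 0) gchoose (j - r)) * ((1 * t + 0) gchoose (j - r))
      * (((- 1 * t + (N - 1)) gchoose r) * ((- 1 * t + (- N - 1)) gchoose r)))" if "r \<le> j" for r
  proof (rule polynomial_le_mono)
    show "polynomial_le (((j - r) + (j - r)) + (r + r)) (\<lambda>t. ((1 * t + 0) gchoose (j - r)) * ((1 * t + 0) gchoose (j - r))
      * (((- 1 * t + (N - 1)) gchoose r) * ((- 1 * t + (- N - 1)) gchoose r)))"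
      by (intro polynomial_le_mult polynomial_le_gbinomial)
  qed (use that in auto)
  then have "polynomial_le (2 * j) (\<lambda>t. \<Sum>r\<le>j. ((1 * t + 0) gchoose (j - r)) * ((1 * t + 0) gchoose (j - r))
      * (((- 1 * t + (N - 1)) gchoose r) * ((- 1 * t + (- N - 1)) gchoose r)))"
    by (intro polynomial_le_sum) auto
  moreover have "- 1 * t + (N - 1) = N - t - 1" "- 1 * t + (- N - 1) = - N - t - 1" for t
    by auto
  ultimately show ?thesis
    by (simp only: whipple_sum_def[abs_def] power2_eq_square mult.assoc mult_1_left add_0_right)
qed

text \<open>The series \<open>racah_coeff n t j\<close> multiplied by (n + j + 1)! / (n - j)!, with
  \<open>N\<close> in place of n + 1. In this form it is visibly a polynomial of degree at most
  \<open>j\<close> in t (t + 1).\<close>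

definition racah_sum :: "nat \<Rightarrow> real \<Rightarrow> real \<Rightarrow> real" where
  "racah_sum j N t = (\<Sum>k\<le>j. (-1) ^ k * casimir_poly k (real j) / (fact k)\<^sup>2
     * (\<Prod>i=Suc k..j. N\<^sup>2 - (real i)\<^sup>2) * casimir_poly k t)"

lemma racah_sum_reflect: "racah_sum j N (- 1 - t) = racah_sum j N t"
  by (simp add: racah_sum_def casimir_poly_reflect)

lemma polynomial_le_racah_sum: "polynomial_le (2 * j) (racah_sum j N)"
proof -
  have "polynomial_le (2 * j) (casimir_poly k)" if "k \<le> j" for k
    using polynomial_le_casimir_poly by (rule polynomial_le_mono) (use that in auto)
  then show ?thesis
    unfolding racah_sum_def[abs_def] by (intro polynomial_le_sum polynomial_le_cmult) auto
qed

text \<open>Summands with k > t vanish, and the remaining ones share the factors with t < i <= j.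
  Together with \<open>whipple_sum_swap\<close>, which has the same factor, this reduces the value
  at an integer t < j to the smaller index \<open>t\<close>.\<close>

lemma racah_sum_swap:
  assumes "t \<le> j"
  shows "racah_sum j N (real t) = (\<Prod>i=Suc t..j. N\<^sup>2 - (real i)\<^sup>2) * racah_sum t N (real j)"
proof -
  have "racah_sum j N (real t) = (\<Sum>k\<le>t. (-1) ^ k * casimir_poly k (real j) / (fact k)\<^sup>2
     * (\<Prod>i=Suc k..j. N\<^sup>2 - (real i)\<^sup>2) * casimir_poly k (real t))"
    unfolding racah_sum_def using assms
    by (intro sum.mono_neutral_right) (auto simp: casimir_poly_eq_0)
  also have "\<dots> = (\<Prod>i=Suc t..j. N\<^sup>2 - (real i)\<^sup>2) * racah_sum t N (real j)"
    unfolding racah_sum_def sum_distrib_left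
  proof (intro sum.cong refl)
    fix k assume "k \<in> {..t}"
    then have "(\<Prod>i=Suc k..j. N\<^sup>2 - (real i)\<^sup>2) = (\<Prod>i=Suc k..t. N\<^sup>2 - (real i)\<^sup>2) * (\<Prod>i=Suc t..j. N\<^sup>2 - (real i)\<^sup>2)"
      using assms by (subst prod.union_disjoint[symmetric]) (auto intro!: prod.cong)
    then show "(-1) ^ k * casimir_poly k (real j) / (fact k)\<^sup>2
        * (\<Prod>i=Suc k..j. N\<^sup>2 - (real i)\<^sup>2) * casimir_poly k (real t)
      = (\<Prod>i=Suc t..j. N\<^sup>2 - (real i)\<^sup>2) * ((-1) ^ k * casimir_poly k (real t) / (fact k)\<^sup>2
        * (\<Prod>i=Suc k..t. N\<^sup>2 - (real i)\<^sup>2) * casimir_poly k (real j))"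
      by simp
  qed
  finally show ?thesis .
qed

lemma gbinomial_nat_fact: "k \<le> m \<Longrightarrow> (real m gchoose k) = fact m / (fact k * fact (m - k))"
  by (simp add: binomial_fact flip: binomial_gbinomial)

text \<open>The binomial coefficient of \<open>t\<close> over j - r vanishes for r < d = j - t.
  After the shift r = d + m, the falling factorials of length d + m split off a common block of
  length d, which produces the product in front.\<close>

lemma whipple_sum_swap:
  assumes "t \<le> j"
  shows "(-1) ^ j * (fact j)\<^sup>2 * whipple_sum j N (real t)
    = (\<Prod>i=Suc t..j. N\<^sup>2 - (real i)\<^sup>2) * ((-1) ^ t * (fact t)\<^sup>2 * whipple_sum t N (real j))"
proof -
  define d where "d = j - t"
  have j: "j = t + d" using assms by (simp add: d_def)
  define F where "F a m = (\<Prod>i=0..<m. a - real i)" for a m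
  have F: "a gchoose m = F a m / fact m" for a m
    by (simp add: F_def gbinomial_prod_rev)
  have F_add: "F a (d + m) = F a d * F (a - real d) m" for a m
  proof -
    have "F a (d + m) = (\<Prod>i=0..<d. a - real i) * (\<Prod>i=d..<d+m. a - real i)"
      unfolding F_def by (simp add: prod.atLeastLessThan_concat)
    also have "(\<Prod>i=d..<d+m. a - real i) = F (a - real d) m"
      unfolding F_def by (intro prod.reindex_bij_witness[of _ "\<lambda>i. i + d" "\<lambda>i. i - d"]) (auto simp: of_nat_diff)
    finally show ?thesis by (simp add: F_def)
  qed
  \<comment> \<open>With u = t + 1 + i, the two factors of index \<open>i\<close> multiply to (N -
    u)(-N - u) = -(N^2 - u^2).\<close>
  have F_d: "F (N - real t - 1) d * F (- N - real t - 1) d = (-1) ^ d * (\<Prod>i=Suc t..j. N\<^sup>2 - (real i)\<^sup>2)"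
  proof -
    have "F (N - real t - 1) d * F (- N - real t - 1) d
       = (\<Prod>i=0..<d. (-1) * (N\<^sup>2 - (real (i + Suc t))\<^sup>2))"
      unfolding F_def prod.distrib[symmetric]
      by (intro prod.cong) (auto simp: power2_eq_square algebra_simps)
    also have "\<dots> = (-1) ^ d * (\<Prod>i=0..<d. N\<^sup>2 - (real (i + Suc t))\<^sup>2)"
      by (subst prod.distrib) simp
    also have "(\<Prod>i=0..<d. N\<^sup>2 - (real (i + Suc t))\<^sup>2) = (\<Prod>i=Suc t..j. N\<^sup>2 - (real i)\<^sup>2)"
      by (intro prod.reindex_bij_witness[of _ "\<lambda>i. i - Suc t" "\<lambda>i. i + Suc t"]) (auto simp: j)
    finally show ?thesis .
  qed
  have "whipple_sum j N (real t) = (\<Sum>r\<in>{d..j}. (real t gchoose (j - r))\<^sup>2 * ((N - real t - 1) gchoose r) * ((- N - real t - 1) gchoose r))"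
    unfolding whipple_sum_def using assms
    by (intro sum.mono_neutral_right) (auto simp: d_def simp flip: binomial_gbinomial)
  also have "\<dots> = (\<Sum>m\<le>t. (real t gchoose (t - m))\<^sup>2 * ((N - real t - 1) gchoose (d + m)) * ((- N - real t - 1) gchoose (d + m)))"
    by (intro sum.reindex_bij_witness[of _ "\<lambda>m. d + m" "\<lambda>r. r - d"]) (auto simp: j)
  finally have "(-1) ^ j * (fact j)\<^sup>2 * whipple_sum j N (real t)
     = (\<Sum>m\<le>t. (-1) ^ j * (fact j)\<^sup>2 * ((real t gchoose (t - m))\<^sup>2 * ((N - real t - 1) gchoose (d + m)) * ((- N - real t - 1) gchoose (d + m))))"
    by (simp add: sum_distrib_left)
  also have "\<dots> = (\<Sum>m\<le>t. (\<Prod>i=Suc t..j. N\<^sup>2 - (real i)\<^sup>2) * ((-1) ^ t * (fact t)\<^sup>2 *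
      ((real j gchoose (t - m))\<^sup>2 * ((N - real j - 1) gchoose m) * ((- N - real j - 1) gchoose m))))"
  proof (intro sum.cong refl)
    fix m assume "m \<in> {..t}"
    then have m: "m \<le> t" by simp
    define G where "G = F (N - real j - 1) m * F (- N - real j - 1) m"
    define R where "R = (\<Prod>i=Suc t..j. N\<^sup>2 - (real i)\<^sup>2)"
    have "F (N - real t - 1) (d + m) * F (- N - real t - 1) (d + m)
       = (F (N - real t - 1) d * F (- N - real t - 1) d) * G"
      by (simp add: F_add j G_def algebra_simps)
    then have FF: "F (N - real t - 1) (d + m) * F (- N - real t - 1) (d + m) = (-1) ^ d * R * G"
      by (simp add: F_d R_def)
    have "(-1) ^ j * (fact j)\<^sup>2 * ((real t gchoose (t - m))\<^sup>2 * ((N - real t - 1) gchoose (d + m)) * ((- N - real t - 1) gchoose (d + m)))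
      = (-1) ^ j * (fact j)\<^sup>2 * (fact t)\<^sup>2 / ((fact (t - m))\<^sup>2 * (fact m)\<^sup>2 * (fact (d + m))\<^sup>2) * (F (N - real t - 1) (d + m) * F (- N - real t - 1) (d + m))"
    proof -
      have e: "real t gchoose (t - m) = fact t / (fact (t - m) * fact m)"
        using m by (subst gbinomial_nat_fact) auto
      show ?thesis unfolding e unfolding F by (simp add: power2_eq_square mult_ac)
    qed
    also have "\<dots> = (-1) ^ t * (fact j)\<^sup>2 * (fact t)\<^sup>2 / ((fact (t - m))\<^sup>2 * (fact m)\<^sup>2 * (fact (d + m))\<^sup>2) * (R * G)"
    proof -
      have "(-1) ^ j * (-1) ^ d = ((-1) ^ t :: real)"
        unfolding j by (simp add: power_add mult.assoc flip: power_mult_distrib)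
      then show ?thesis unfolding FF by (simp add: divide_simps mult_ac)
    qed
    also have "\<dots> = R * ((-1) ^ t * (fact t)\<^sup>2 * ((real j gchoose (t - m))\<^sup>2 * ((N - real j - 1) gchoose m) * ((- N - real j - 1) gchoose m)))"
    proof -
      have e: "real j gchoose (t - m) = fact j / (fact (t - m) * fact (d + m))"
        using m by (subst gbinomial_nat_fact) (auto simp: j)
      show ?thesis unfolding G_def e unfolding F by (simp add: power2_eq_square mult_ac)
    qed
    finally show "(-1) ^ j * (fact j)\<^sup>2 * ((real t gchoose (t - m))\<^sup>2 * ((N - real t - 1) gchoose (d + m)) * ((- N - real t - 1) gchoose (d + m)))
      = (\<Prod>i=Suc t..j. N\<^sup>2 - (real i)\<^sup>2) * ((-1) ^ t * (fact t)\<^sup>2 *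
      ((real j gchoose (t - m))\<^sup>2 * ((N - real j - 1) gchoose m) * ((- N - real j - 1) gchoose m)))"
      by (simp add: R_def)
  qed
  also have "\<dots> = (\<Prod>i=Suc t..j. N\<^sup>2 - (real i)\<^sup>2) * ((-1) ^ t * (fact t)\<^sup>2 * whipple_sum t N (real j))"
    by (simp add: whipple_sum_def sum_distrib_left)
  finally show ?thesis .
qed

text \<open>At t = n the two products in each summand collapse to a constant over n + 1 + k, which
  leaves the partial fraction sum at x = n + 1. This is the interpolation point that the induction
  on \<open>j\<close> does not supply.\<close>

lemma racah_sum_last:
  assumes "j \<le> n"
  shows "racah_sum j (real n + 1) (real n) = (-1) ^ j * (fact n / fact (n - j))\<^sup>2"
proof -
  have key: "(\<Prod>i=Suc k..j. (real n + 1)\<^sup>2 - (real i)\<^sup>2) * casimir_poly k (real n)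
      = fact (n + j + 1) / fact (n - j) / (real n + 1 + real k)" if "k \<le> j" for k
    using that assms
  proof (induction j)
    case 0
    have "fact (n + 1) = fact n * (real n + 1)" "real n + 1 \<noteq> 0" by (simp_all add: algebra_simps)
    with 0 show ?case by simp
  next
    case (Suc j)
    show ?case
    proof (cases "k = Suc j")
      case True
      have "fact (n + Suc j + 1) = (real n + 1 + real (Suc j)) * fact (n + Suc j)" "real n + 1 + real (Suc j) \<noteq> 0"
        by simp_all
      with True Suc.prems show ?thesis
        by (simp add: casimir_poly_fact del: fact_Suc of_nat_Suc add_Suc_right)
    next
      case False
      with Suc.prems have "(\<Prod>i=Suc k..Suc j. (real n + 1)\<^sup>2 - (real i)\<^sup>2) * casimir_poly k (real n)
        = ((real n + 1)\<^sup>2 - (real (Suc j))\<^sup>2) * ((\<Prod>i=Suc k..j. (real n + 1)\<^sup>2 - (real i)\<^sup>2) * casimir_poly k (real n))"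
        by simp
      also have "(\<Prod>i=Suc k..j. (real n + 1)\<^sup>2 - (real i)\<^sup>2) * casimir_poly k (real n)
        = fact (n + j + 1) / fact (n - j) / (real n + 1 + real k)"
        using False Suc by simp
      also have "(real n + 1)\<^sup>2 - (real (Suc j))\<^sup>2 = real (n - j) * real (n + j + 2)"
        using Suc.prems by (simp add: power2_eq_square algebra_simps of_nat_diff)
      also have "fact (n - j) = real (n - j) * fact (n - Suc j)"
        using Suc.prems by (subst fact_reduce) auto
      also have "real (n - j) * real (n + j + 2) * (fact (n + j + 1) / (real (n - j) * fact (n - Suc j)) / (real n + 1 + real k))
        = real (n + j + 2) * fact (n + j + 1) / fact (n - Suc j) / (real n + 1 + real k)"
        using Suc.prems by (simp del: of_nat_add fact_Suc)
      also have "real (n + j + 2) * fact (n + j + 1) = fact (n + Suc j + 1)"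
        by simp
      finally show ?thesis .
    qed
  qed
  have "racah_sum j (real n + 1) (real n)
     = (\<Sum>k\<le>j. (-1) ^ k * casimir_poly k (real j) / (fact k)\<^sup>2 * (fact (n + j + 1) / fact (n - j) / (real n + 1 + real k)))"
    unfolding racah_sum_def by (intro sum.cong) (simp_all only: mult.assoc key atMost_iff)
  also have "\<dots> = fact (n + j + 1) / fact (n - j) * (\<Sum>k\<le>j. (-1) ^ k * casimir_poly k (real j) / ((fact k)\<^sup>2 * ((real n + 1) + real k)))"
    unfolding sum_distrib_left by (intro sum.cong) (auto simp: field_simps)
  also have "\<dots> = fact (n + j + 1) / fact (n - j) * ((-1) ^ j * (\<Prod>i=1..j. real n + 1 - real i) / (\<Prod>i\<le>j. real n + 1 + real i))"
    by (subst casimir_poly_partial_fractions) auto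
  also have "(\<Prod>i=1..j. real n + 1 - real i) = fact n / fact (n - j)"
    using assms
  proof (induction j)
    case (Suc j)
    have "fact (n - j) = real (n - j) * fact (n - Suc j)"
      using Suc.prems by (subst fact_reduce) auto
    with Suc show ?case by (simp add: field_simps of_nat_diff)
  qed simp
  also have "(\<Prod>i\<le>j. real n + 1 + real i) = fact (n + j + 1) / fact n"
  proof (induction j)
    case (Suc j)
    have "fact (n + Suc j + 1) = fact (n + j + 1) * (real n + 1 + real (Suc j))"
      by simp
    with Suc show ?case by (simp del: fact_Suc)
  qed simp
  finally show ?thesis by (simp add: power2_eq_square)
qed

text \<open>
  A case of Whipple's transformation of terminating balanced \<open>4F3\<close> series. Both sides are polynomials in
  \<open>t\<close> of degree \<open>2 j\<close> that are invariant under \<open>t \<mapsto> - 1 - t\<close>, and they agree at \<open>t = 0, \<dots>, j - 1\<close>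
  (by induction, exchanging \<open>t\<close> and \<open>j\<close>) and at \<open>t = n\<close>.
\<close>

lemma racah_sum_eq_whipple_sum:
  assumes "j \<le> n"
  shows "racah_sum j (real n + 1) x = (-1) ^ j * (fact j)\<^sup>2 * whipple_sum j (real n + 1) x"
  using assms
proof (induction j arbitrary: x rule: less_induct)
  case (less j)
  \<comment> \<open>These j + 1 points are nonnegative and their mirror images negative, so there
    are 2 j + 2 points against degree 2 j.\<close>
  define A where "A = real ` insert n {..<j}"
  have agree: "racah_sum j (real n + 1) x = (-1) ^ j * (fact j)\<^sup>2 * whipple_sum j (real n + 1) x" if "x \<in> A" for x
  proof -
    from that have "(\<exists>t<j. x = real t) \<or> x = real n" by (auto simp: A_def)
    then consider t where "x = real t" "t < j" | "x = real n" by blast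
    then show ?thesis
    proof cases
      case 1
      then show ?thesis using less
        by (simp add: racah_sum_swap whipple_sum_swap)
    next
      case 2
      have "whipple_sum j (real n + 1) (real n) = (\<Sum>r\<in>{0}. (real n gchoose (j - r))\<^sup>2 * ((real n + 1 - real n - 1) gchoose r) * ((- (real n + 1) - real n - 1) gchoose r))"
        unfolding whipple_sum_def by (intro sum.mono_neutral_right) (auto simp: gbinomial_0_left)
      also have "\<dots> = (fact n / (fact j * fact (n - j)))\<^sup>2"
        using less.prems by (simp add: gbinomial_nat_fact)
      finally show ?thesis unfolding 2 racah_sum_last[OF less.prems]
        by (simp add: power_divide power_mult_distrib)
    qed
  qed
  have "racah_sum j (real n + 1) = (\<lambda>x. (-1) ^ j * (fact j)\<^sup>2 * whipple_sum j (real n + 1) x)"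
  proof (rule polynomial_le_unique)
    show "racah_sum j (real n + 1) x = (-1) ^ j * (fact j)\<^sup>2 * whipple_sum j (real n + 1) x"
      if "x \<in> A \<union> (\<lambda>x. - 1 - x) ` A" for x
      using that agree by (auto simp: racah_sum_reflect whipple_sum_reflect)
    have "card (A \<union> (\<lambda>x. - 1 - x) ` A) = card A + card ((\<lambda>x. - 1 - x) ` A)"
      by (intro card_Un_disjoint) (auto simp: A_def)
    also have "card ((\<lambda>x. - 1 - x) ` A) = card A"
      by (intro card_image) (auto simp: inj_on_def)
    also have "card A = Suc j"
      using less.prems unfolding A_def by (subst card_image) auto
    finally show "2 * j < card (A \<union> (\<lambda>x. - 1 - x) ` A)" by simp
  qed (intro polynomial_le_racah_sum polynomial_le_cmult polynomial_le_whipple_sum)+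
  then show ?case by (rule fun_cong)
qed

text \<open>
  Two forms of the Racah coefficient: as a balanced \<open>4F3\<close> series, and as Racah's single sum.
\<close>

definition racah_coeff :: "nat \<Rightarrow> nat \<Rightarrow> nat \<Rightarrow> real" where
  "racah_coeff n t j = (\<Sum>k\<le>n. (-1) ^ k * fact (n - k) / ((fact k)\<^sup>2 * fact (n + k + 1))
     * casimir_poly k (real t) * casimir_poly k (real j))"

lemma racah_coeff_commute: "racah_coeff n t j = racah_coeff n j t"
  by (simp add: racah_coeff_def mult_ac)

text \<open>With N = n + 1, each factor N^2 - i^2 equals (n + 1 - i)(n + 1 + i); the product over k
  < i <= j moves the quotient (n - k)! / (n + k + 1)! from level \<open>k\<close> to level
  \<open>j\<close>.\<close>

lemma racah_coeff_conv_racah_sum: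
  assumes "j \<le> n"
  shows "racah_coeff n t j = fact (n - j) / fact (n + j + 1) * racah_sum j (real n + 1) (real t)"
proof -
  have *: "fact (n - k) / fact (n + k + 1) = fact (n - j) / fact (n + j + 1) * (\<Prod>i=Suc k..j. (real n + 1)\<^sup>2 - (real i)\<^sup>2)"
    if "k \<le> j" for k
    using that assms
  proof (induction j)
    case (Suc j)
    show ?case
    proof (cases "k = Suc j")
      case False
      with Suc have "fact (n - k) / fact (n + k + 1) = fact (n - j) / fact (n + j + 1) * (\<Prod>i=Suc k..j. (real n + 1)\<^sup>2 - (real i)\<^sup>2)"
        by simp
      also have "fact (n - j) = real (n - j) * fact (n - Suc j)"
        using Suc.prems by (subst fact_reduce) auto
      also have "real (n - j) * fact (n - Suc j) / fact (n + j + 1)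
        = ((real n + 1)\<^sup>2 - (real (Suc j))\<^sup>2) * (fact (n - Suc j) / fact (n + Suc j + 1))"
      proof -
        have "(real n + 1)\<^sup>2 - (real (Suc j))\<^sup>2 = real (n - j) * real (n + j + 2)"
          using Suc.prems by (simp add: power2_eq_square algebra_simps of_nat_diff)
        moreover have "fact (n + Suc j + 1) = real (n + j + 2) * fact (n + j + 1)"
          by simp
        moreover have "a * b / c = (a * r) * (b / (r * c))" if "r \<noteq> 0" for a b c r :: real
          using that by simp
        ultimately show ?thesis by (simp del: of_nat_add fact_Suc)
      qed
      finally show ?thesis using False Suc.prems by (simp add: mult_ac)
    qed simp
  qed simp
  have "racah_coeff n t j = (\<Sum>k\<le>j. (-1) ^ k * fact (n - k) / ((fact k)\<^sup>2 * fact (n + k + 1))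
     * casimir_poly k (real t) * casimir_poly k (real j))"
    unfolding racah_coeff_def using assms
    by (intro sum.mono_neutral_right) (auto simp: casimir_poly_eq_0)
  also have "\<dots> = (\<Sum>k\<le>j. (-1) ^ k / (fact k)\<^sup>2 * (fact (n - k) / fact (n + k + 1))
     * casimir_poly k (real t) * casimir_poly k (real j))"
    by (intro sum.cong) auto
  also have "\<dots> = fact (n - j) / fact (n + j + 1) * racah_sum j (real n + 1) (real t)"
    unfolding racah_sum_def sum_distrib_left
  proof (intro sum.cong refl)
    fix k assume "k \<in> {..j}"
    then have "k \<le> j" by simp
    from *[OF this] show "(-1) ^ k / (fact k)\<^sup>2 * (fact (n - k) / fact (n + k + 1)) * casimir_poly k (real t) * casimir_poly k (real j)
      = fact (n - j) / fact (n + j + 1) * ((-1) ^ k * casimir_poly k (real j) / (fact k)\<^sup>2 *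
        (\<Prod>i=Suc k..j. (real n + 1)\<^sup>2 - (real i)\<^sup>2) * casimir_poly k (real t))"
      by (simp only: times_divide_eq_left times_divide_eq_right divide_divide_eq_left mult_ac)
  qed
  finally show ?thesis .
qed

text \<open>The claimed value without its factor 2 t + 1, so that the expression is symmetric in
  \<open>t\<close> and \<open>j\<close>.\<close>

definition racah_formula :: "nat \<Rightarrow> nat \<Rightarrow> nat \<Rightarrow> real" where
  "racah_formula n t j = (-1) ^ (t + j) * (fact t)\<^sup>2 * (fact j)\<^sup>2 * fact (n - t) * fact (n - j)
         / (fact (n + t + 1) * fact (n + j + 1))
       * (\<Sum>s = max t j..min (t + j) n.
            (-1) ^ s * fact (n + s + 1)
              / ((fact (s - t))\<^sup>2 * (fact (s - j))\<^sup>2 * (fact (t + j - s))\<^sup>2 * fact (n - s)))"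

lemma racah_formula_commute: "racah_formula n t j = racah_formula n j t"
  unfolding racah_formula_def max.commute[of t j] add.commute[of t j]
  by (simp only: mult_ac)

lemma racah_coeff_eq_formula:
  assumes "t \<le> n" "j \<le> n"
  shows "racah_coeff n t j = racah_formula n t j"
proof -
  \<comment> \<open>By symmetry j <= t may be assumed. Then max t j = t, and the natural number
    subtraction t + r - j does not truncate.\<close>
  have main: "racah_coeff n t j = racah_formula n t j" if "j \<le> t" "t \<le> n" for t j
  proof -
    have "whipple_sum j (real n + 1) (real t)
       = (\<Sum>r\<in>{0..min j (n - t)}. (real t gchoose (j - r))\<^sup>2 * ((real n + 1 - real t - 1) gchoose r) * ((- (real n + 1) - real t - 1) gchoose r))"
    proof -
      have "(real n + 1 - real t - 1) gchoose r = 0" if "r > n - t" for r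
      proof -
        have e: "real n + 1 - real t - 1 = real (n - t)" using \<open>t \<le> n\<close> by (simp add: of_nat_diff)
        show ?thesis unfolding e using that by (simp flip: binomial_gbinomial)
      qed
      then show ?thesis
        unfolding whipple_sum_def by (intro sum.mono_neutral_right) auto
    qed
    also have "\<dots> = (\<Sum>r\<in>{0..min j (n - t)}. (-1) ^ r * (fact t)\<^sup>2 * fact (n - t) / fact (n + t + 1) * (fact (n + t + r + 1)
        / ((fact r)\<^sup>2 * (fact (t + r - j))\<^sup>2 * (fact (j - r))\<^sup>2 * fact (n - t - r))))"
    proof (intro sum.cong refl)
      fix r assume "r \<in> {0..min j (n - t)}"
      then have r: "r \<le> j" "r \<le> n - t" by auto
      have 1: "real t gchoose (j - r) = fact t / (fact (j - r) * fact (t + r - j))"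
        using r \<open>j \<le> t\<close> by (subst gbinomial_nat_fact) auto
      have 2: "(real n + 1 - real t - 1) gchoose r = fact (n - t) / (fact r * fact (n - t - r))"
      proof -
        have "real n + 1 - real t - 1 = real (n - t)" using \<open>t \<le> n\<close> by (simp add: of_nat_diff)
        then show ?thesis using gbinomial_nat_fact[OF r(2)] by (simp only:)
      qed
      \<comment> \<open>The upper index is -(n + t + 2); negating it yields the alternating sign and
        the factorials (n + s + 1)! of Racah's sum.\<close>
      have 3: "(- (real n + 1) - real t - 1) gchoose r = (-1) ^ r * (fact (n + t + r + 1) / (fact r * fact (n + t + 1)))"
      proof -
        have "(- (real n + 1) - real t - 1) gchoose r = (- real (n + t + 2)) gchoose r" by (simp add: algebra_simps)
        also have "\<dots> = (-1) ^ r * (real (n + t + r + 1) gchoose r)"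
          by (subst gbinomial_minus) (simp add: algebra_simps)
        also have "real (n + t + r + 1) gchoose r = fact (n + t + r + 1) / (fact r * fact (n + t + 1))"
          by (subst gbinomial_nat_fact) auto
        finally show ?thesis .
      qed
      show "(real t gchoose (j - r))\<^sup>2 * ((real n + 1 - real t - 1) gchoose r) * ((- (real n + 1) - real t - 1) gchoose r)
        = (-1) ^ r * (fact t)\<^sup>2 * fact (n - t) / fact (n + t + 1) * (fact (n + t + r + 1)
        / ((fact r)\<^sup>2 * (fact (t + r - j))\<^sup>2 * (fact (j - r))\<^sup>2 * fact (n - t - r)))"
        unfolding 1 2 3 power2_eq_square
        by (simp only: times_divide_eq_left times_divide_eq_right divide_divide_eq_left times_divide_times_eq mult_ac)
    qed
    also have "\<dots> = (\<Sum>s\<in>{max t j..min (t + j) n}. (-1) ^ t * (fact t)\<^sup>2 * fact (n - t) / fact (n + t + 1) * ((-1) ^ s * fact (n + s + 1)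
              / ((fact (s - t))\<^sup>2 * (fact (s - j))\<^sup>2 * (fact (t + j - s))\<^sup>2 * fact (n - s))))"
    proof (intro sum.reindex_bij_witness[of _ "\<lambda>s. s - t" "\<lambda>r. r + t"])
      fix r :: nat
      have sign: "(-1) ^ t * (-1) ^ (r + t) = ((-1) ^ r :: real)"
        by (simp add: power_add flip: power_mult_distrib)
      have move: "a * x * y / h * (b * w / z) = (a * b) * x * y / h * (w / z)" for a b x y h w z :: real
        by simp
      have idx: "r + t - t = r" "t + j - (r + t) = j - r" "n + (r + t) + 1 = n + t + r + 1"
        "n - (r + t) = n - t - r" "r + t - j = t + r - j"
        by auto
      show "(-1) ^ t * (fact t :: real)\<^sup>2 * fact (n - t) / fact (n + t + 1) * ((-1) ^ (r + t) * fact (n + (r + t) + 1)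
              / ((fact (r + t - t))\<^sup>2 * (fact (r + t - j))\<^sup>2 * (fact (t + j - (r + t)))\<^sup>2 * fact (n - (r + t))))
        = (-1) ^ r * (fact t)\<^sup>2 * fact (n - t) / fact (n + t + 1) * (fact (n + t + r + 1)
        / ((fact r)\<^sup>2 * (fact (t + r - j))\<^sup>2 * (fact (j - r))\<^sup>2 * fact (n - t - r)))"
        unfolding idx move sign by (rule refl)
    qed (use that in auto)
    also have "\<dots> = (-1) ^ t * (fact t)\<^sup>2 * fact (n - t) / fact (n + t + 1) * (\<Sum>s\<in>{max t j..min (t + j) n}. (-1) ^ s * fact (n + s + 1)
              / ((fact (s - t))\<^sup>2 * (fact (s - j))\<^sup>2 * (fact (t + j - s))\<^sup>2 * fact (n - s)))"
      by (simp add: sum_distrib_left)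
    finally have w: "whipple_sum j (real n + 1) (real t) = (-1) ^ t * (fact t)\<^sup>2 * fact (n - t) / fact (n + t + 1)
      * (\<Sum>s\<in>{max t j..min (t + j) n}. (-1) ^ s * fact (n + s + 1)
              / ((fact (s - t))\<^sup>2 * (fact (s - j))\<^sup>2 * (fact (t + j - s))\<^sup>2 * fact (n - s)))" .
    have jn: "j \<le> n" using that by simp
    show ?thesis
      unfolding racah_coeff_conv_racah_sum[OF jn] racah_sum_eq_whipple_sum[OF jn] w racah_formula_def
      by (simp only: power_add times_divide_eq_left times_divide_eq_right divide_divide_eq_left mult_ac)
  qed
  show ?thesis
    using main[of j t] main[of t j] assms
    by (cases "j \<le> t") (simp_all add: racah_coeff_commute[of n t j] racah_formula_commute[of n t j])
qed

section \<open>Uniqueness of the Racah coefficients\<close>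

text \<open>At level \<open>k\<close> the terms of larger index vanish, those of smaller index
  vanish by induction, and the diagonal value is positive.\<close>

lemma casimir_poly_independent:
  fixes x :: "nat \<Rightarrow> complex"
  assumes "\<And>j. j \<le> n \<Longrightarrow> (\<Sum>k\<le>n. x k * of_real (casimir_poly k (real j))) = 0"
  shows "k \<le> n \<Longrightarrow> x k = 0"
proof (induction k rule: less_induct)
  case (less k)
  have "x i * of_real (casimir_poly i (real k)) = 0" if "i \<noteq> k" "i \<le> n" for i
    using that less by (cases "i < k") (auto simp: casimir_poly_eq_0)
  then have "(\<Sum>i\<le>n. x i * of_real (casimir_poly i (real k))) = (\<Sum>i\<in>{k}. x i * of_real (casimir_poly i (real k)))"
    using less.prems by (intro sum.mono_neutral_right) auto
  with assms[of k] less.prems casimir_poly_pos[of k k] show ?case by simp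
qed

text \<open>The weights 2 t + 1 are the dimensions of the components. This evaluates the
  normalization condition on each Newton polynomial.\<close>

lemma sum_casimir_poly:
  assumes "k \<le> n"
  shows "(\<Sum>t\<le>n. (2 * real t + 1) * casimir_poly k (real t))
    = (real n + 1) * fact (n + k + 1) / (fact (n - k) * (real k + 1))"
  using assms
proof (induction n)
  case (Suc n)
  show ?case
  proof (cases "k = Suc n")
    case True
    have "(\<Sum>t\<le>n. (2 * real t + 1) * casimir_poly k (real t)) = 0"
      using True by (intro sum.neutral) (auto simp: casimir_poly_eq_0)
    then have "(\<Sum>t\<le>Suc n. (2 * real t + 1) * casimir_poly k (real t)) = (2 * real (Suc n) + 1) * fact (Suc n + Suc n)"
      unfolding sum.atMost_Suc True using casimir_poly_fact[of "Suc n" "Suc n"] by (simp del: fact_Suc of_nat_Suc)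
    also have "\<dots> = fact (Suc n + Suc n + 1)"
      by simp
    finally show ?thesis
      using True by (simp del: fact_Suc add_Suc_right)
  next
    case False
    with Suc.prems have k: "k \<le> n" by simp
    have 1: "fact (Suc n - k) = (real n + 1 - real k) * fact (n - k)"
      using k by (simp add: Suc_diff_le of_nat_diff)
    have 2: "fact (Suc n + k + 1) = (real n + real k + 2) * fact (n + k + 1)"
      by simp
    have 3: "fact (Suc n + k) = (fact (n + k + 1) :: real)"
      by simp
    have "(\<Sum>t\<le>Suc n. (2 * real t + 1) * casimir_poly k (real t))
        = (real n + 1) * fact (n + k + 1) / (fact (n - k) * (real k + 1))
          + (2 * real n + 3) * fact (n + k + 1) / ((real n + 1 - real k) * fact (n - k))"
      using Suc.IH[OF k] casimir_poly_fact[OF Suc.prems] unfolding sum.atMost_Suc 1 3 by simp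
    also have "\<dots> = (real (Suc n) + 1) * fact (Suc n + k + 1) / (fact (Suc n - k) * (real k + 1))"
    proof -
      have nz: "real n + 1 - real k \<noteq> 0" "real k + 1 \<noteq> 0" "(fact (n - k) :: real) \<noteq> 0"
        using k by simp_all
      show ?thesis
        unfolding 1 2 using nz
        by (simp add: divide_simps del: fact_Suc) (simp add: algebra_simps del: fact_Suc)
    qed
    finally show ?thesis .
  qed
qed (simp add: casimir_poly_def)

text \<open>Partial fractions at x = 1: for j > 0 the numerator contains the factor 1 - 1.\<close>

lemma casimir_poly_alternating_sum:
  "(\<Sum>k\<le>j. (-1) ^ k * casimir_poly k (real j) / ((fact k)\<^sup>2 * (real k + 1))) = (if j = 0 then 1 else 0)"
proof -
  have "(\<Prod>i=1..j. 1 - real i) = 0" if "j \<noteq> 0"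
    using that by (intro prod_zero) (auto intro!: bexI[of _ 1])
  then show ?thesis
    using casimir_poly_partial_fractions[of 1 j] by (simp add: add.commute)
qed

text \<open>
  Since \<^const>\<open>casimir_poly\<close> is triangular on the levels, the second assumption writes \<open>w\<close> as a lower triangular
  matrix times an upper triangular one. As \<open>w\<close> is Hermitian, this has to be an \<open>LDL\<^sup>*\<close>
  decomposition, and the normalization determines its diagonal.
\<close>

lemma racah_coeff_unique:
  fixes w :: "nat \<Rightarrow> nat \<Rightarrow> complex"
  assumes herm: "\<And>t j. t \<le> n \<Longrightarrow> j \<le> n \<Longrightarrow> cnj (w t j) = w j t"
    and span: "\<And>k. k \<le> n \<Longrightarrow> \<exists>b. \<forall>j\<le>n. of_real (casimir_poly k (real j)) = (\<Sum>i\<le>k. b i * w i j)"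
    and normalized: "\<And>j. j \<le> n \<Longrightarrow> (\<Sum>t\<le>n. of_nat (2 * t + 1) * w t j) = (if j = 0 then of_nat (n + 1) else 0)"
    and tj: "t \<le> n" "j \<le> n"
  shows "w t j = of_real (racah_coeff n t j)"
proof -
  define P where "P k j = complex_of_real (casimir_poly k (real j))" for k j
  have P0: "P k j = 0" if "j < k" for k j
    using that by (simp add: P_def casimir_poly_eq_0)
  have Pnz: "P k k \<noteq> 0" for k
    using casimir_poly_pos[of k k] by (simp add: P_def)
  have cnjP: "cnj (P k j) = P k j" for k j
    by (simp add: P_def)
  \<comment> \<open>The span assumption is solved for the row \<open>w t\<close>, after the earlier
    rows have been replaced by their expansions.\<close>
  have "\<exists>x. (\<forall>k>t. x k = 0) \<and> (\<forall>j\<le>n. w t j = (\<Sum>k\<le>n. x k * P k j))" if "t \<le> n" for t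
    using that
  proof (induction t rule: less_induct)
    case (less t)
    from less have "\<forall>i\<in>{..<t}. \<exists>x. (\<forall>k>i. x k = 0) \<and> (\<forall>j\<le>n. w i j = (\<Sum>k\<le>n. x k * P k j))" by auto
    then obtain X where X: "\<And>i. i < t \<Longrightarrow> (\<forall>k>i. X i k = 0) \<and> (\<forall>j\<le>n. w i j = (\<Sum>k\<le>n. X i k * P k j))"
      by (metis lessThan_iff)
    obtain b where b: "\<And>j. j \<le> n \<Longrightarrow> P t j = (\<Sum>i\<le>t. b i * w i j)"
      using span[OF less.prems] unfolding P_def by auto
    define c where "c k = (\<Sum>i<t. b i * X i k)" for k
    have c0: "c k = 0" if "k \<ge> t" for k
      unfolding c_def using that X by (intro sum.neutral) auto
    have eq: "(\<Sum>k\<le>n. ((if k = t then 1 else 0) - c k) * P k j) = b t * w t j" if "j \<le> n" for j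
    proof -
      have "(\<Sum>i\<le>t. b i * w i j) = (\<Sum>i<t. b i * w i j) + b t * w t j"
        by (simp flip: lessThan_Suc_atMost)
      also have "(\<Sum>i<t. b i * w i j) = (\<Sum>i<t. \<Sum>k\<le>n. b i * X i k * P k j)"
        using X that by (intro sum.cong) (auto simp: sum_distrib_left mult.assoc)
      also have "\<dots> = (\<Sum>k\<le>n. c k * P k j)"
        by (subst sum.swap) (simp add: c_def sum_distrib_right)
      finally have "P t j = (\<Sum>k\<le>n. c k * P k j) + b t * w t j"
        using b[OF that] by simp
      moreover have "(\<Sum>k\<le>n. (if k = t then 1 else 0) * P k j) = P t j"
        using less.prems by (subst sum.remove[of _ t]) auto
      ultimately show ?thesis by (simp add: left_diff_distrib sum_subtractf)
    qed
    \<comment> \<open>Otherwise the Newton polynomial of index \<open>t\<close> would be a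
      combination of those of smaller index on the levels 0, ..., n.\<close>
    have "b t \<noteq> 0"
    proof
      assume "b t = 0"
      with eq casimir_poly_independent[of n "\<lambda>k. (if k = t then 1 else 0) - c k" t] less.prems
      have "1 - c t = 0" by (simp add: P_def)
      with c0[of t] show False by simp
    qed
    show ?case
    proof (intro exI[of _ "\<lambda>k. ((if k = t then 1 else 0) - c k) / b t"] conjI allI impI)
      fix j assume "j \<le> n"
      have "(\<Sum>k\<le>n. ((if k = t then 1 else 0) - c k) / b t * P k j) = (\<Sum>k\<le>n. ((if k = t then 1 else 0) - c k) * P k j) / b t"
        by (simp add: sum_divide_distrib)
      with \<open>b t \<noteq> 0\<close> show "w t j = (\<Sum>k\<le>n. ((if k = t then 1 else 0) - c k) / b t * P k j)"
        by (simp add: eq[OF \<open>j \<le> n\<close>])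
    qed (use c0 in auto)
  qed
  then obtain a where a0: "\<And>t k. t \<le> n \<Longrightarrow> t < k \<Longrightarrow> a t k = 0"
    and a: "\<And>t j. t \<le> n \<Longrightarrow> j \<le> n \<Longrightarrow> w t j = (\<Sum>k\<le>n. a t k * P k j)"
    by metis
  \<comment> \<open>The diagonal of the decomposition: the claim is that column \<open>m\<close> of
    \<open>a\<close> is proportional to row \<open>m\<close> of \<open>P\<close>.\<close>
  define d where "d m = a m m / P m m" for m
  have d: "cnj (d m) = d m \<and> (\<forall>t\<le>n. a t m = d m * P m t)" if "m \<le> n" for m
    using that
  proof (induction m rule: less_induct)
    case (less m)
    \<comment> \<open>Comparing w(t, m) with the conjugate of w(m, t): by induction the
      contributions of k < m agree and cancel. The case t = m shows that \<open>a m m\<close> is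
      real.\<close>
    have key: "a t m * P m m = cnj (a m m) * P m t" if t: "t \<le> n" for t
    proof -
      define S where "S = (\<Sum>k<m. d k * P k t * P k m)"
      have split: "(\<Sum>k\<le>n. f k) = (\<Sum>k<m. f k) + f m" if "\<And>k. k > m \<Longrightarrow> f k = 0" for f :: "nat \<Rightarrow> complex"
      proof -
        have "(\<Sum>k\<le>n. f k) = (\<Sum>k\<le>m. f k)"
          using that less.prems by (intro sum.mono_neutral_right) auto
        then show ?thesis by (simp flip: lessThan_Suc_atMost)
      qed
      have "w t m = (\<Sum>k<m. a t k * P k m) + a t m * P m m"
        unfolding a[OF t less.prems] by (rule split) (simp add: P0)
      also have "(\<Sum>k<m. a t k * P k m) = S"
        unfolding S_def using less t by (intro sum.cong) auto
      finally have 1: "w t m = S + a t m * P m m" .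
      have "w m t = (\<Sum>k<m. a m k * P k t) + a m m * P m t"
        unfolding a[OF less.prems t] by (rule split) (simp add: a0 less.prems)
      also have "(\<Sum>k<m. a m k * P k t) = S"
        unfolding S_def using less by (intro sum.cong) auto
      finally have "cnj (w m t) = cnj S + cnj (a m m) * P m t" by (simp add: cnjP)
      moreover have "cnj S = S"
        unfolding S_def cnj_sum using less by (intro sum.cong) (auto simp: cnjP)
      ultimately show ?thesis
        using 1 herm[OF less.prems t] by simp
    qed
    from key[OF less.prems] Pnz[of m] have real: "cnj (a m m) = a m m" by simp
    show ?case
      using key Pnz[of m] unfolding real by (auto simp: d_def cnjP real field_simps)
  qed
  have w: "w t j = (\<Sum>k\<le>n. d k * P k t * P k j)" if "t \<le> n" "j \<le> n" for t j
    using a[OF that] d that by simp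
  define e where "e k = (real n + 1) * fact (n + k + 1) / (fact (n - k) * (real k + 1))" for k
  have sum_d: "(\<Sum>k\<le>n. d k * of_real (e k) * P k j) = (if j = 0 then of_nat (n + 1) else 0)" if "j \<le> n" for j
  proof -
    have "(\<Sum>t\<le>n. of_nat (2 * t + 1) * w t j) = (\<Sum>t\<le>n. \<Sum>k\<le>n. d k * P k j * of_real ((2 * real t + 1) * casimir_poly k (real t)))"
      by (intro sum.cong) (auto simp: w that sum_distrib_left P_def algebra_simps)
    also have "\<dots> = (\<Sum>k\<le>n. d k * P k j * of_real (\<Sum>t\<le>n. (2 * real t + 1) * casimir_poly k (real t)))"
      by (subst sum.swap) (simp add: sum_distrib_left)
    also have "\<dots> = (\<Sum>k\<le>n. d k * of_real (e k) * P k j)"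
      by (intro sum.cong) (auto simp: sum_casimir_poly e_def)
    finally show ?thesis using normalized[OF that] by simp
  qed
  \<comment> \<open>The coefficients in \<open>racah_coeff\<close>. They satisfy the same linear
    system as \<open>d\<close>, so independence identifies the two.\<close>
  define r where "r k = (-1) ^ k * fact (n - k) / ((fact k)\<^sup>2 * fact (n + k + 1) :: real)" for k :: nat
  have sum_r: "(\<Sum>k\<le>n. of_real (r k) * of_real (e k) * P k j) = (if j = 0 then of_nat (n + 1) else 0)" if "j \<le> n" for j
  proof -
    have re: "r k * e k = (real n + 1) * ((-1) ^ k / ((fact k)\<^sup>2 * (real k + 1)))" for k
    proof -
      have "(f * F / (g * h)) * (m * h / (F * i)) = m * (f / (g * i))" if "h \<noteq> 0" "F \<noteq> 0" for f F g h m i :: real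
        using that by simp
      then show ?thesis unfolding r_def e_def by (metis fact_nonzero)
    qed
    have "(\<Sum>k\<le>n. r k * e k * casimir_poly k (real j)) = (\<Sum>k\<le>j. r k * e k * casimir_poly k (real j))"
      using that by (intro sum.mono_neutral_right) (auto simp: casimir_poly_eq_0)
    also have "\<dots> = (real n + 1) * (\<Sum>k\<le>j. (-1) ^ k * casimir_poly k (real j) / ((fact k)\<^sup>2 * (real k + 1)))"
      unfolding re sum_distrib_left by (intro sum.cong) auto
    also have "\<dots> = (if j = 0 then real n + 1 else 0)"
      by (simp add: casimir_poly_alternating_sum)
    finally have "complex_of_real (\<Sum>k\<le>n. r k * e k * casimir_poly k (real j)) = of_real (if j = 0 then real n + 1 else 0)"
      by (simp only:)
    then show ?thesis by (auto simp: P_def split: if_splits)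
  qed
  have "d k = of_real (r k)" if "k \<le> n" for k
  proof -
    have "(d k - of_real (r k)) * of_real (e k) = 0"
    proof (rule casimir_poly_independent[OF _ that])
      fix j assume "j \<le> n"
      with sum_d[of j] sum_r[of j]
      show "(\<Sum>k\<le>n. (d k - of_real (r k)) * of_real (e k) * of_real (casimir_poly k (real j))) = 0"
        by (simp add: left_diff_distrib sum_subtractf flip: P_def)
    qed
    moreover have "e k \<noteq> 0"
      by (simp add: e_def del: fact_Suc add_Suc_right)
    ultimately show ?thesis by simp
  qed
  moreover have "racah_coeff n t j = (\<Sum>k\<le>n. r k * casimir_poly k (real t) * casimir_poly k (real j))"
    by (simp only: racah_coeff_def r_def)
  ultimately show ?thesis
    by (simp add: w tj P_def)
qed

section \<open>Complex matrices\<close>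

lemma cscale_nth [simp]: "cscale c A $ i $ j = c * A $ i $ j"
  by (simp add: cscale_def)

lemma matrix_mult_nth: "(A ** B) $ i $ j = (\<Sum>k\<in>UNIV. A $ i $ k * B $ k $ j)"
  by (simp add: matrix_matrix_mult_def)

lemma matrix_mult_add_left: "(A + B) ** C = A ** C + B ** C"
  and matrix_mult_diff_right: "C ** (A - B) = C ** A - C ** B"
  and matrix_mult_diff_left: "(A - B) ** C = A ** C - B ** C"
  and matrix_mult_minus_right: "C ** (- A) = - (C ** A)"
  and matrix_mult_minus_left: "(- A) ** C = - (A ** C)"
  for A B C :: "complex ^ 'd ^ 'd"
  by (simp_all add: vec_eq_iff matrix_mult_nth algebra_simps sum.distrib sum_subtractf sum_negf)

lemma matrix_mult_zero [simp]: "A ** 0 = 0" "0 ** A = 0"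
  for A :: "complex ^ 'd ^ 'd"
  by (simp_all add: vec_eq_iff matrix_mult_nth)

lemma matrix_mult_cscale_left [simp]: "cscale c A ** B = cscale c (A ** B)"
  and matrix_mult_cscale_right [simp]: "A ** cscale c B = cscale c (A ** B)"
  for A B :: "complex ^ 'd ^ 'd"
  by (simp_all add: vec_eq_iff matrix_mult_nth sum_distrib_left mult_ac)

lemmas matrix_ring_simps = matrix_add_ldistrib matrix_mult_add_left matrix_mult_diff_right
  matrix_mult_diff_left matrix_mult_minus_right matrix_mult_minus_left matrix_mul_assoc[symmetric]

lemma scaleR_conv_cscale: "r *\<^sub>R A = cscale (of_real r) A"
  by (simp add: vec_eq_iff complex_eq_iff)

lemma uminus_conv_cscale: "- A = cscale (- 1) A"
  by (simp add: vec_eq_iff)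

lemma cscale_mult_vec: "cscale c A *v x = c *s (A *v x)"
  by (simp add: vec_eq_iff matrix_vector_mult_def sum_distrib_left mult_ac)

lemma trace_cscale: "trace (cscale c A) = c * trace A"
  by (simp add: trace_def sum_distrib_left)

lemma adj_nth [simp]: "adj A $ i $ j = cnj (A $ j $ i)"
  by (simp add: adj_def)

lemma adj_simps [simp]:
  "adj (A + B) = adj A + adj B" "adj (A - B) = adj A - adj B" "adj (- A) = - adj A"
  "adj (cscale c A) = cscale (cnj c) (adj A)" "adj (adj A) = A" "adj 0 = 0"
  by (simp_all add: vec_eq_iff)

lemma adj_one [simp]: "adj (mat 1) = mat 1"
  by (auto simp: vec_eq_iff mat_def)

lemma adj_mult: "adj (A ** B) = adj B ** adj A"
  for A B :: "complex ^ 'd ^ 'd"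
  by (simp add: vec_eq_iff matrix_mult_nth mult.commute)

definition mpow :: "complex ^ 'd ^ 'd \<Rightarrow> nat \<Rightarrow> complex ^ 'd ^ 'd" where
  "mpow A k = ((**) A ^^ k) (mat 1)"

lemma mpow_simps [simp]: "mpow A 0 = mat 1" "mpow A (Suc k) = A ** mpow A k"
  by (simp_all add: mpow_def)

lemma mpow_commute: "mpow A k ** A = A ** mpow A k"
  by (induction k) (simp_all add: matrix_mul_assoc[symmetric])

lemma mpow_mult_vec: "mpow A k *v v = ((*v) A ^^ k) v"
  by (induction k) (simp_all add: matrix_vector_mul_assoc[symmetric])

lemma adj_mpow: "adj (mpow A k) = mpow (adj A) k"
  by (induction k) (simp_all add: adj_mult mpow_commute)

lemma trace_adj: "trace (adj A) = cnj (trace A)"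
  by (simp add: trace_def)

abbreviation cmat_linear :: "(complex ^ 'd ^ 'd \<Rightarrow> complex ^ 'd ^ 'd) \<Rightarrow> bool" where
  "cmat_linear \<equiv> Vector_Spaces.linear cscale cscale"

lemma cmat_linearI:
  assumes "\<And>X Y. f (X + Y) = f X + f Y" "\<And>c X. f (cscale c X) = cscale c (f X)"
  shows "cmat_linear f"
  using assms by unfold_locales

lemma cmat_linear_add: "cmat_linear f \<Longrightarrow> f (X + Y) = f X + f Y"
  and cmat_linear_diff: "cmat_linear f \<Longrightarrow> f (X - Y) = f X - f Y"
  and cmat_linear_scale: "cmat_linear f \<Longrightarrow> f (cscale c X) = cscale c (f X)"
  and cmat_linear_zero: "cmat_linear f \<Longrightarrow> f 0 = 0"
  and cmat_linear_sum: "cmat_linear f \<Longrightarrow> f (\<Sum>i\<in>I. g i) = (\<Sum>i\<in>I. f (g i))"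
proof -
  assume "cmat_linear f"
  then interpret Vector_Spaces.linear cscale cscale f .
  show "f (X + Y) = f X + f Y" "f (X - Y) = f X - f Y" "f (cscale c X) = cscale c (f X)" "f 0 = 0"
    "f (\<Sum>i\<in>I. g i) = (\<Sum>i\<in>I. f (g i))"
    by (simp_all add: add diff scale zero sum)
qed

lemma cmat_linear_eq_on_span:
  assumes "cmat_linear f" "cmat_linear g" "\<And>X. X \<in> B \<Longrightarrow> f X = g X" "X \<in> cmat.span B"
  shows "f X = g X"
  using assms(4)
proof (induction rule: cmat.span_induct_alt)
  case base
  then show ?case using assms(1,2) by (simp add: cmat_linear_zero)
next
  case (step c X Y)
  then show ?case using assms by (simp add: cmat_linear_add cmat_linear_scale)
qed

lemma cmat_linear_compose: "cmat_linear f \<Longrightarrow> cmat_linear g \<Longrightarrow> cmat_linear (\<lambda>X. f (g X))"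
  by (intro cmat_linearI) (simp_all add: cmat_linear_add cmat_linear_scale)

definition matrix_unit :: "'d \<Rightarrow> 'd \<Rightarrow> complex ^ 'd ^ 'd" where
  "matrix_unit a b = (\<chi> i j. if i = a \<and> j = b then 1 else 0)"

lemma matrix_unit_nth [simp]: "matrix_unit a b $ i $ j = (if i = a \<and> j = b then 1 else 0)"
  by (simp add: matrix_unit_def)

lemma matrix_unit_expand: "A = (\<Sum>a\<in>UNIV. \<Sum>b\<in>UNIV. cscale (A $ a $ b) (matrix_unit a b))"
proof -
  have "(\<Sum>a\<in>UNIV. \<Sum>b\<in>UNIV. A $ a $ b * (if i = a \<and> j = b then 1 else 0)) = A $ i $ j" for i j
  proof -
    have "(\<Sum>a\<in>UNIV. \<Sum>b\<in>UNIV. A $ a $ b * (if i = a \<and> j = b then 1 else 0))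
        = (\<Sum>a\<in>UNIV. if i = a then \<Sum>b\<in>UNIV. if j = b then A $ a $ b else 0 else 0)"
      by (intro sum.cong refl) (simp add: if_distrib cong: if_cong)
    also have "\<dots> = A $ i $ j" by simp
    finally show ?thesis .
  qed
  then show ?thesis by (simp add: vec_eq_iff)
qed

lemma span_matrix_units: "cmat.span ((\<lambda>(a, b). matrix_unit a b) ` UNIV) = UNIV"
proof -
  have "A \<in> cmat.span ((\<lambda>(a, b). matrix_unit a b) ` UNIV)" for A
    by (subst matrix_unit_expand[of A]) (intro cmat.span_sum cmat.span_scale cmat.span_base, auto)
  then show ?thesis by auto
qed

text \<open>An element outside the span would give an independent set larger than the spanning set
  of matrix units.\<close>

lemma independent_cmat_spans:
  fixes S :: "(complex ^ 'd ^ 'd) set"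
  assumes "cmat.independent S" "card S = CARD('d) * CARD('d)"
  shows "cmat.span S = UNIV"
proof (rule ccontr)
  let ?T = "(\<lambda>(a, b). matrix_unit a b) ` (UNIV :: ('d \<times> 'd) set)"
  have bound: "finite R \<and> card R \<le> CARD('d) * CARD('d)" if "cmat.independent R" for R :: "(complex ^ 'd ^ 'd) set"
  proof -
    have "finite R \<and> card R \<le> card ?T"
      by (rule cmat.independent_span_bound[OF _ that]) (simp_all add: span_matrix_units)
    moreover have "card ?T \<le> CARD('d \<times> 'd)"
      by (rule card_image_le) simp
    ultimately show ?thesis by (simp add: card_prod)
  qed
  assume "cmat.span S \<noteq> UNIV"
  then obtain x where x: "x \<notin> cmat.span S" by auto
  then have "cmat.independent (insert x S)"
    using assms(1) by (simp add: cmat.independent_insert)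
  moreover have "x \<notin> S"
    using x cmat.span_base by blast
  ultimately show False
    using bound[of "insert x S"] bound[OF assms(1)] assms(2) by simp
qed

subsection \<open>The Hilbert--Schmidt inner product\<close>

lemma hs_inner_add_right: "hs_inner X (Y + Z) = hs_inner X Y + hs_inner X Z"
  and hs_inner_diff_right: "hs_inner X (Y - Z) = hs_inner X Y - hs_inner X Z"
  and hs_inner_add_left: "hs_inner (Y + Z) X = hs_inner Y X + hs_inner Z X"
  and hs_inner_diff_left: "hs_inner (Y - Z) X = hs_inner Y X - hs_inner Z X"
  and hs_inner_cscale_right: "hs_inner X (cscale c Y) = c * hs_inner X Y"
  and hs_inner_cscale_left: "hs_inner (cscale c X) Y = cnj c * hs_inner X Y"
  and hs_inner_zero_right: "hs_inner X 0 = 0"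
  and hs_inner_zero_left: "hs_inner 0 X = 0"
  by (simp_all add: hs_inner_def matrix_ring_simps trace_add trace_sub trace_cscale)
    (simp_all add: trace_def)

lemmas hs_inner_simps [simp] = hs_inner_add_right hs_inner_diff_right hs_inner_add_left
  hs_inner_diff_left hs_inner_cscale_right hs_inner_cscale_left hs_inner_zero_right hs_inner_zero_left

lemma hs_inner_sum_right: "hs_inner X (\<Sum>i\<in>I. f i) = (\<Sum>i\<in>I. hs_inner X (f i))"
  by (induction I rule: infinite_finite_induct) auto

lemma hs_inner_commute: "hs_inner Y X = cnj (hs_inner X Y)"
  by (simp add: hs_inner_def adj_mult flip: trace_adj)

lemma hs_inner_mult_right: "hs_inner X (A ** Y) = hs_inner (adj A ** X) Y"
  by (simp add: hs_inner_def adj_mult matrix_mul_assoc)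

lemma hs_inner_mult_right': "hs_inner X (Y ** A) = hs_inner (X ** adj A) Y"
  unfolding hs_inner_def adj_mult adj_simps
  by (metis matrix_mul_assoc trace_mul_sym)

lemma hs_inner_self: "hs_inner X X = of_real (\<Sum>i\<in>UNIV. \<Sum>j\<in>UNIV. (cmod (X $ j $ i))\<^sup>2)"
  by (simp add: hs_inner_def trace_def matrix_mult_nth mult.commute[of "cnj _"] complex_norm_square del: of_real_power)

lemma hs_inner_self_eq_0: "hs_inner X X = 0 \<longleftrightarrow> X = 0"
proof
  assume "hs_inner X X = 0"
  then have "(\<Sum>i\<in>UNIV. \<Sum>j\<in>UNIV. (cmod (X $ j $ i))\<^sup>2) = 0"
    by (simp only: hs_inner_self of_real_eq_0_iff)
  then show "X = 0"
    by (subst (asm) sum_nonneg_eq_0_iff) (auto simp: sum_nonneg sum_nonneg_eq_0_iff vec_eq_iff)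
qed simp

lemma hs_inner_self_real: "\<exists>r\<ge>0. hs_inner X X = of_real r"
  by (intro exI[of _ "\<Sum>i\<in>UNIV. \<Sum>j\<in>UNIV. (cmod (X $ j $ i))\<^sup>2"] conjI hs_inner_self sum_nonneg) auto

lemma hs_inner_span_eq_0:
  assumes "\<And>E. E \<in> B \<Longrightarrow> hs_inner E X = 0" "Y \<in> cmat.span B"
  shows "hs_inner Y X = 0"
  using assms(2) by (induction rule: cmat.span_induct_alt) (auto simp: assms(1))

text \<open>Cyclicity of the trace exchanges the roles of E and F; this is the source of the
  Hermitian symmetry of w.\<close>

lemma hs_inner_sandwich: "hs_inner (E ** F ** adj E) F = hs_inner E (F ** E ** adj F)"
proof -
  have "trace ((E ** adj F) ** (adj E ** F)) = trace ((adj E ** F) ** (E ** adj F))"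
    by (rule trace_mul_sym)
  then show ?thesis by (simp add: hs_inner_def adj_mult matrix_mul_assoc)
qed

subsection \<open>Commutators\<close>

lemma commutator_linear: "cmat_linear (commutator A)"
  by (rule cmat_linearI) (simp_all add: commutator_def matrix_ring_simps cmat.scale_right_diff_distrib)

lemma commutator_mult: "commutator A (B ** C) = commutator A B ** C + B ** commutator A C"
  by (simp add: commutator_def matrix_ring_simps)

lemma commutator_jacobi: "commutator A (commutator B X) = commutator (commutator A B) X + commutator B (commutator A X)"
  by (simp add: commutator_def matrix_ring_simps)

lemma hs_inner_commutator: "hs_inner X (commutator A Y) = hs_inner (commutator (adj A) X) Y"
  by (simp only: commutator_def hs_inner_diff_right hs_inner_diff_left
    hs_inner_mult_right[of X A Y] hs_inner_mult_right'[of X Y A])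

lemma commutator_simps:
  "commutator A (X + Y) = commutator A X + commutator A Y"
  "commutator A (X - Y) = commutator A X - commutator A Y"
  "commutator A (cscale c X) = cscale c (commutator A X)"
  "commutator A 0 = 0"
  "commutator (cscale c A) X = cscale c (commutator A X)"
  "commutator (A + B) X = commutator A X + commutator B X"
  "commutator (- A) X = - commutator A X"
  by (simp_all add: commutator_def matrix_ring_simps cmat.scale_right_diff_distrib)

lemma commutator_one [simp]: "commutator A (mat 1) = 0"
  by (simp add: commutator_def)

lemma commutator_self [simp]: "commutator A A = 0"
  by (simp add: commutator_def)

subsection \<open>Eigenvectors\<close>

lemma matrix_vector_mult_cscale [simp]: "A *v (c *s x) = c *s (A *v x)"
  for A :: "complex ^ 'd ^ 'd"
  by (simp add: vec_eq_iff matrix_vector_mult_def sum_distrib_left mult_ac)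

definition poly_apply :: "complex poly \<Rightarrow> complex ^ 'd ^ 'd \<Rightarrow> complex ^ 'd \<Rightarrow> complex ^ 'd" where
  "poly_apply p A v = (\<Sum>i\<le>degree p. coeff p i *s (((*v) A ^^ i) v))"

lemma poly_apply_altdef:
  assumes "degree p \<le> m"
  shows "poly_apply p A v = (\<Sum>i\<le>m. coeff p i *s (((*v) A ^^ i) v))"
  unfolding poly_apply_def using assms
  by (intro sum.mono_neutral_left) (auto simp: coeff_eq_0)

lemma poly_apply_linear_factor:
  "poly_apply ([:- z, 1:] * q) A v = poly_apply q A (A *v v - z *s v)"
proof -
  let ?m = "degree q"
  have iter: "((*v) A ^^ i) (A *v v - z *s v) = ((*v) A ^^ Suc i) v - z *s (((*v) A ^^ i) v)" for i
    by (induction i) (simp_all add: matrix_vector_mult_diff_distrib)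
  have "poly_apply ([:- z, 1:] * q) A v
      = (\<Sum>i\<le>Suc ?m. coeff ([:- z, 1:] * q) i *s (((*v) A ^^ i) v))"
    by (rule poly_apply_altdef) (use degree_mult_le[of "[:- z, 1:]" q] in \<open>simp del: mult_pCons_left\<close>)
  also have "\<dots> = (\<Sum>i\<le>Suc ?m. coeff (pCons 0 q) i *s (((*v) A ^^ i) v)) - (\<Sum>i\<le>Suc ?m. (z * coeff q i) *s (((*v) A ^^ i) v))"
    by (simp add: vector_sub_rdistrib sum_subtractf del: sum.atMost_Suc)
  also have "(\<Sum>i\<le>Suc ?m. coeff (pCons 0 q) i *s (((*v) A ^^ i) v)) = (\<Sum>i\<le>?m. coeff q i *s (((*v) A ^^ Suc i) v))"
    by (subst sum.atMost_Suc_shift) simp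
  also have "(\<Sum>i\<le>Suc ?m. (z * coeff q i) *s (((*v) A ^^ i) v)) = (\<Sum>i\<le>?m. (z * coeff q i) *s (((*v) A ^^ i) v))"
    by (simp add: coeff_eq_0)
  also have "(\<Sum>i\<le>?m. coeff q i *s (((*v) A ^^ Suc i) v)) - \<dots> = poly_apply q A (A *v v - z *s v)"
    unfolding poly_apply_def iter sum_subtractf[symmetric]
    by (intro sum.cong) (simp_all add: vec.scale_right_diff_distrib mult.commute)
  finally show ?thesis .
qed

text \<open>Split off a root \<open>z\<close> of \<open>p\<close>: either \<open>v\<close> is an
  eigenvector for \<open>z\<close>, or (A - z) v is a nonzero vector of \<open>S\<close> annihilated
  by the cofactor.\<close>

lemma eigenvector_if_annihilated:
  fixes A :: "complex ^ 'd ^ 'd"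
  assumes "vec.subspace S" "\<And>v. v \<in> S \<Longrightarrow> A *v v \<in> S" "v \<in> S" "v \<noteq> 0" "p \<noteq> 0" "poly_apply p A v = 0"
  shows "\<exists>w\<in>S. w \<noteq> 0 \<and> (\<exists>z. A *v w = z *s w)"
  using assms(3-)
proof (induction "degree p" arbitrary: p v)
  case 0
  then obtain c where "p = [:c:]" using degree_eq_zeroE by metis
  with 0 show ?case by (auto simp: poly_apply_def)
next
  case (Suc m)
  then have "\<not> constant (poly p)"
    by (simp add: constant_degree)
  then obtain z where "poly p z = 0"
    using fundamental_theorem_of_algebra by blast
  then obtain q where p: "p = [:- z, 1:] * q"
    by (metis poly_eq_0_iff_dvd dvdE)
  with Suc.prems have "q \<noteq> 0" by auto
  with p Suc.hyps(2) have deg: "m = degree q"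
    by (subst (asm) p, subst (asm) degree_mult_eq) auto
  let ?w = "A *v v - z *s v"
  show ?case
  proof (cases "?w = 0")
    case True
    with Suc.prems show ?thesis by auto
  next
    case False
    have "?w \<in> S"
      using Suc.prems assms(1,2) by (simp add: vec.subspace_diff vec.subspace_scale)
    moreover have "poly_apply q A ?w = 0"
      using Suc.prems p by (simp only: poly_apply_linear_factor)
    ultimately show ?thesis
      using Suc.hyps(1)[OF deg _ False \<open>q \<noteq> 0\<close>] by blast
  qed
qed

lemma vec_independent_card:
  fixes S :: "(complex ^ 'd) set"
  assumes "vec.independent S"
  shows "finite S \<and> card S \<le> CARD('d)"
  using vec.independent_span_bound[OF finite_cart_basis assms] by (simp add: card_cart_basis)

lemma exists_eigenvector:
  fixes A :: "complex ^ 'd ^ 'd"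
  assumes "vec.subspace S" "\<And>v. v \<in> S \<Longrightarrow> A *v v \<in> S" "S \<noteq> {0}"
  shows "\<exists>w\<in>S. w \<noteq> 0 \<and> (\<exists>z. A *v w = z *s w)"
proof -
  obtain v where v: "v \<in> S" "v \<noteq> 0"
    using assms(1,3) vec.subspace_0 by blast
  let ?f = "\<lambda>i. ((*v) A ^^ i) v" and ?N = "CARD('d)"
  \<comment> \<open>There are N + 1 iterates in dimension N: either they are distinct and hence
    dependent, or two coincide and x^j - x^i annihilates \<open>v\<close>.\<close>
  have "\<exists>p. p \<noteq> 0 \<and> poly_apply p A v = 0"
  proof (cases "inj_on ?f {..?N}")
    case True
    then have "card (?f ` {..?N}) = Suc ?N" by (simp add: card_image)
    then have "vec.dependent (?f ` {..?N})"
      using vec_independent_card by fastforce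
    then obtain u x where u: "x \<in> {..?N}" "u (?f x) \<noteq> 0" "(\<Sum>w\<in>?f ` {..?N}. u w *s w) = 0"
      by (auto simp: vec.dependent_finite)
    define p where "p = (\<Sum>i\<le>?N. monom (u (?f i)) i)"
    have coeff: "coeff p i = (if i \<le> ?N then u (?f i) else 0)" for i
      by (simp add: p_def coeff_sum)
    have "poly_apply p A v = (\<Sum>i\<le>?N. coeff p i *s ?f i)"
      by (rule poly_apply_altdef) (auto intro!: degree_le simp: coeff)
    also have "\<dots> = (\<Sum>w\<in>?f ` {..?N}. u w *s w)"
      using True by (subst sum.reindex) (auto simp: coeff)
    finally have "poly_apply p A v = 0" using u by simp
    moreover have "coeff p x \<noteq> 0" using u by (simp add: coeff)
    ultimately show ?thesis by (intro exI[of _ p]) auto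
  next
    case False
    then obtain i j where ij: "i < j" "?f i = ?f j"
      by (auto simp: inj_on_def) (metis linorder_neqE_nat)
    define p where "p = monom 1 j - monom (1 :: complex) i"
    have coeff: "coeff p k = (if k = j then 1 else if k = i then - 1 else 0)" for k
      using ij by (auto simp: p_def)
    have "poly_apply p A v = (\<Sum>k\<le>j. coeff p k *s ?f k)"
      using ij by (intro poly_apply_altdef degree_le) (auto simp: coeff)
    also have "\<dots> = (\<Sum>k\<in>{i, j}. coeff p k *s ?f k)"
      using ij by (intro sum.mono_neutral_right) (auto simp: coeff)
    also have "\<dots> = 0" using ij by (simp add: coeff)
    finally have "poly_apply p A v = 0" .
    moreover have "coeff p j \<noteq> 0" by (simp add: coeff)
    ultimately show ?thesis by (intro exI[of _ p]) auto
  qed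
  then show ?thesis
    using eigenvector_if_annihilated[OF assms(1,2) v] by blast
qed

section \<open>Irreducible representations of su(2)\<close>

subsection \<open>Actions of the complexified Lie algebra\<close>

text \<open>\<open>Z\<close>, \<open>P\<close>, \<open>M\<close> are the weight, raising and
  lowering operators. The vector space is left abstract because the locale is used twice: for
  vectors, and for matrices under commutators.\<close>

locale sl2_action = vector_space scale
  for scale :: "complex \<Rightarrow> 'v::ab_group_add \<Rightarrow> 'v" (infixr "\<cdot>" 75) +
  fixes Z P M :: "'v \<Rightarrow> 'v"
  assumes linear: "Vector_Spaces.linear scale scale Z" "Vector_Spaces.linear scale scale P"
      "Vector_Spaces.linear scale scale M"
    and ZP: "Z (P x) = P (Z x) + P x"
    and ZM: "Z (M x) = M (Z x) - M x"
    and PM: "P (M x) = M (P x) + 2 \<cdot> Z x"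
begin

sublocale Z: Vector_Spaces.linear scale scale Z by (rule linear)
sublocale P: Vector_Spaces.linear scale scale P by (rule linear)
sublocale M: Vector_Spaces.linear scale scale M by (rule linear)

lemma weight_lowering:
  assumes "Z v = l \<cdot> v"
  shows "Z ((M ^^ k) v) = (l - of_nat k) \<cdot> (M ^^ k) v"
proof (induction k)
  case (Suc k)
  have "Z ((M ^^ Suc k) v) = M ((l - of_nat k) \<cdot> (M ^^ k) v) - M ((M ^^ k) v)"
    by (simp add: ZM Suc.IH)
  also have "\<dots> = (l - of_nat (Suc k)) \<cdot> (M ^^ Suc k) v"
    by (simp add: M.scale M.diff scale_left_diff_distrib scale_left_distrib algebra_simps)
  finally show ?case .
qed (simp add: assms)

text \<open>Commuting \<open>P\<close> past each \<open>M\<close> adds 2 (l - i) for i = 0, ..., k,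
  and these terms sum to (k + 1)(2 l - k).\<close>

lemma raising_lowering:
  assumes "Z v = l \<cdot> v" "P v = 0"
  shows "P ((M ^^ Suc k) v) = (of_nat (Suc k) * (2 * l - of_nat k)) \<cdot> (M ^^ k) v"
proof (induction k)
  case 0
  then show ?case using assms by (simp add: PM M.zero)
next
  case (Suc k)
  have "P ((M ^^ Suc (Suc k)) v) = M (P ((M ^^ Suc k) v)) + 2 \<cdot> Z ((M ^^ Suc k) v)"
    by (simp add: PM)
  also have "\<dots> = (of_nat (Suc k) * (2 * l - of_nat k)) \<cdot> (M ^^ Suc k) v + (2 * (l - of_nat (Suc k))) \<cdot> (M ^^ Suc k) v"
    by (simp add: Suc.IH M.scale weight_lowering[OF assms(1)] del: funpow.simps of_nat_Suc) simp
  also have "\<dots> = (of_nat (Suc (Suc k)) * (2 * l - of_nat (Suc k))) \<cdot> (M ^^ Suc k) v"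
    unfolding scale_left_distrib[symmetric] by (simp add: algebra_simps)
  finally show ?case .
qed

text \<open>The Casimir J_1^2 + J_2^2 + J_3^2, ordered so that the last term vanishes on highest
  weight vectors, where l (l + 1) can be read off.\<close>

definition casimir :: "'v \<Rightarrow> 'v" where
  "casimir x = Z (Z x) + Z x + M (P x)"

lemma casimir_M: "casimir (M x) = M (casimir x)"
proof -
  have "2 \<cdot> Z x = Z x + Z x" for x
    using scale_left_distrib[of 1 1 "Z x"] by simp
  then show ?thesis
    by (simp add: casimir_def ZM PM M.add M.diff Z.diff algebra_simps)
qed

lemma casimir_P: "casimir (P x) = P (casimir x)"
proof -
  have two: "2 \<cdot> y = y + y" for y
    using scale_left_distrib[of 1 1 y] by simp
  have "M (P (P x)) = P (M (P x)) - 2 \<cdot> Z (P x)"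
    by (simp add: PM)
  then show ?thesis
    by (simp add: casimir_def ZP P.add Z.add two algebra_simps)
qed

lemma casimir_Z: "casimir (Z x) = Z (casimir x)"
  by (simp add: casimir_def ZP ZM M.add Z.add algebra_simps)

lemma casimir_linear: "Vector_Spaces.linear scale scale casimir"
  by unfold_locales (simp_all add: casimir_def Z.add P.add M.add Z.scale P.scale M.scale scale_right_distrib algebra_simps)

lemma casimir_highest:
  assumes "Z v = l \<cdot> v" "P v = 0"
  shows "casimir v = (l * (l + 1)) \<cdot> v"
  by (simp add: casimir_def assms Z.scale M.zero scale_left_distrib algebra_simps)

lemma casimir_lowering:
  assumes "Z v = l \<cdot> v" "P v = 0"
  shows "casimir ((M ^^ k) v) = (l * (l + 1)) \<cdot> (M ^^ k) v"
  by (induction k) (simp_all add: casimir_highest[OF assms] casimir_M M.scale)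

end

subsection \<open>Irreducible representations\<close>

locale spin_rep =
  fixes Jz Jp Jm :: "complex ^ 'd ^ 'd" and n :: nat
  assumes zp: "commutator Jz Jp = Jp"
    and zm: "commutator Jz Jm = - Jm"
    and pm: "commutator Jp Jm = cscale 2 Jz"
    and adj_z: "adj Jz = Jz"
    and adj_p: "adj Jp = Jm"
    and adj_m: "adj Jm = Jp"
    and irreducible: "\<And>S. vec.subspace S \<Longrightarrow> (\<And>v. v \<in> S \<Longrightarrow> Jz *v v \<in> S \<and> Jp *v v \<in> S \<and> Jm *v v \<in> S)
      \<Longrightarrow> S = {0} \<or> S = UNIV"
    and card: "CARD('d) = n + 1"
begin

lemma matrix_relations:
  "Jz ** Jp = Jp ** Jz + Jp" "Jz ** Jm = Jm ** Jz - Jm" "Jp ** Jm = Jm ** Jp + cscale 2 Jz"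
  using zp zm pm by (simp_all add: commutator_def algebra_simps)

sublocale vecs: sl2_action "(*s)" "(*v) Jz" "(*v) Jp" "(*v) Jm"
  by unfold_locales
    (simp_all add: matrix_vector_mul_assoc matrix_relations matrix_vector_mult_add_rdistrib
      matrix_vector_mult_diff_rdistrib cscale_mult_vec matrix_vector_right_distrib)

sublocale mats: sl2_action cscale "commutator Jz" "commutator Jp" "commutator Jm"
proof unfold_locales
  fix x
  show "commutator Jz (commutator Jp x) = commutator Jp (commutator Jz x) + commutator Jp x"
    "commutator Jz (commutator Jm x) = commutator Jm (commutator Jz x) - commutator Jm x"
    "commutator Jp (commutator Jm x) = commutator Jm (commutator Jp x) + cscale 2 (commutator Jz x)"
    using commutator_jacobi[of Jz Jp x] commutator_jacobi[of Jz Jm x] commutator_jacobi[of Jp Jm x]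
    by (simp_all add: zp zm pm commutator_simps)
qed (simp_all add: commutator_simps)

text \<open>
  If \<^term>\<open>Jp\<close> were invertible, then \<open>Jp\<^sup>-\<^sup>1 Jz Jp = Jz + 1\<close>, which contradicts the invariance of the trace.
\<close>

lemma exists_highest_vector: "\<exists>v l. v \<noteq> 0 \<and> Jp *v v = 0 \<and> Jz *v v = l *s v"
proof -
  define S where "S = {v. Jp *v v = 0}"
  have "\<not> invertible Jp"
  proof
    assume "invertible Jp"
    then obtain B where B: "Jp ** B = mat 1" "B ** Jp = mat 1"
      unfolding invertible_def by auto
    have "trace (B ** (Jz ** Jp)) = trace (B ** Jp ** Jz) + trace (B ** Jp)"
      by (simp add: matrix_relations matrix_ring_simps trace_add)
    moreover have "trace (B ** (Jz ** Jp)) = trace (Jz ** (Jp ** B))"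
      by (subst trace_mul_sym) (simp add: matrix_mul_assoc)
    ultimately have "trace (mat 1 :: complex ^ 'd ^ 'd) = 0"
      by (simp add: B)
    then show False by (simp add: trace_I)
  qed
  then have "\<not> inj ((*v) Jp)"
    by (simp add: invertible_left_inverse matrix_left_invertible_injective)
  then obtain x y where "x \<noteq> y" "Jp *v x = Jp *v y"
    unfolding inj_def by blast
  then have "x - y \<in> S" "x - y \<noteq> 0"
    by (simp_all add: S_def matrix_vector_mult_diff_distrib)
  then have "S \<noteq> {0}" by blast
  moreover have "vec.subspace S"
    unfolding S_def vec.subspace_def by (auto simp: matrix_vector_right_distrib)
  moreover have "Jz *v v \<in> S" if "v \<in> S" for v
    using that vecs.ZP[of v] by (simp add: S_def)
  ultimately obtain w where "w \<in> S" "w \<noteq> 0" "\<exists>z. Jz *v w = z *s w"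
    using exists_eigenvector[of S Jz] by blast
  then show ?thesis by (auto simp: S_def)
qed

definition hw :: "complex ^ 'd" where
  "hw = (SOME v. v \<noteq> 0 \<and> Jp *v v = 0 \<and> (\<exists>l. Jz *v v = l *s v))"

definition hw_weight :: complex where
  "hw_weight = (SOME l. Jz *v hw = l *s hw)"

lemma hw: "hw \<noteq> 0" "Jp *v hw = 0" "Jz *v hw = hw_weight *s hw"
proof -
  have *: "hw \<noteq> 0 \<and> Jp *v hw = 0 \<and> (\<exists>l. Jz *v hw = l *s hw)"
    unfolding hw_def by (rule someI_ex) (use exists_highest_vector in blast)
  then show "hw \<noteq> 0" "Jp *v hw = 0" by simp_all
  from * have "\<exists>l. Jz *v hw = l *s hw" by simp
  then show "Jz *v hw = hw_weight *s hw"
    unfolding hw_weight_def by (rule someI_ex)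
qed

text \<open>If Jm^n were zero, the vectors obtained from \<open>hw\<close> by fewer than
  \<open>n\<close> lowerings would span a nonzero invariant subspace of dimension at most n < n + 1.
  By taking adjoints, Jp^j is nonzero for j <= n, so every component up to \<open>n\<close>
  occurs.\<close>

lemma mpow_Jm_nonzero: "mpow Jm n \<noteq> 0"
proof
  assume "mpow Jm n = 0"
  define v where "v k = ((*v) Jm ^^ k) hw" for k
  have vn: "v n = 0"
    unfolding v_def by (simp add: \<open>mpow Jm n = 0\<close> flip: mpow_mult_vec)
  let ?S = "vec.span (v ` {..<n})"
  have stable: "A *v x \<in> ?S" if A: "\<And>k. k < n \<Longrightarrow> A *v v k \<in> ?S" and x: "x \<in> ?S" for A x
    using x
  proof (induction rule: vec.span_induct_alt)
    case (step c y z)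
    then show ?case
      using A by (auto simp: matrix_vector_right_distrib intro!: vec.span_add vec.span_scale)
  qed (simp add: vec.span_zero)
  have v_in: "v k \<in> ?S" if "k \<le> n" for k
    using that vn by (cases "k = n") (auto simp: vec.span_zero intro: vec.span_base)
  have "?S = {0} \<or> ?S = UNIV"
  proof (rule irreducible)
    fix x assume x: "x \<in> ?S"
    have "Jz *v v k \<in> ?S" if "k < n" for k
    proof -
      have "Jz *v v k = (hw_weight - of_nat k) *s v k"
        unfolding v_def by (rule vecs.weight_lowering[OF hw(3)])
      then show ?thesis
        using v_in[of k] that by (simp only: vec.span_scale less_imp_le)
    qed
    moreover have "Jp *v v k \<in> ?S" if "k < n" for k
    proof (cases k)
      case 0
      then show ?thesis by (simp add: v_def hw vec.span_zero)
    next
      case (Suc m)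
      have "Jp *v v k = (of_nat (Suc m) * (2 * hw_weight - of_nat m)) *s v m"
        unfolding v_def Suc by (rule vecs.raising_lowering[OF hw(3,2)])
      then show ?thesis
        using v_in[of m] that Suc by (simp only: vec.span_scale)
    qed
    moreover have "Jm *v v k \<in> ?S" if "k < n" for k
      using v_in[of "Suc k"] that by (simp add: v_def)
    ultimately show "Jz *v x \<in> ?S \<and> Jp *v x \<in> ?S \<and> Jm *v x \<in> ?S"
      using stable x by blast
  qed simp
  moreover have "hw \<in> ?S" using v_in[of 0] by (simp add: v_def)
  ultimately have "?S = UNIV" using hw(1) by auto
  then have "vec.dim (UNIV :: (complex ^ 'd) set) \<le> card (v ` {..<n})"
    by (intro vec.dim_le_card) auto
  also have "\<dots> \<le> n"
    using card_image_le[of "{..<n}" v] by simp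
  finally show False
    unfolding vec_dim_card card by simp
qed

lemma mpow_Jp_nonzero:
  assumes "j \<le> n"
  shows "mpow Jp j \<noteq> 0"
proof
  assume 0: "mpow Jp j = 0"
  have "mpow Jp (j + i) = 0" for i
    by (induction i) (simp_all add: 0)
  from this[of "n - j"] have "mpow Jp n = 0" using assms by simp
  then show False
    using mpow_Jm_nonzero adj_mpow[of Jp n] by (simp add: adj_p)
qed

definition casimir_const :: complex where
  "casimir_const = hw_weight * (hw_weight + 1)"

text \<open>The eigenspace of the Casimir for the eigenvalue of \<open>hw\<close> is invariant and
  nonzero.\<close>

lemma casimir_scalar: "Jz ** Jz + Jz + Jm ** Jp = cscale casimir_const (mat 1)"
proof -
  interpret C: Vector_Spaces.linear "(*s)" "(*s)" vecs.casimir by (rule vecs.casimir_linear)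
  let ?S = "{v. vecs.casimir v = casimir_const *s v}"
  have "?S = {0} \<or> ?S = UNIV"
    by (rule irreducible)
      (auto simp: vec.subspace_def C.zero C.add C.scale vec.scale_right_distrib mult.commute
        vecs.casimir_M vecs.casimir_P vecs.casimir_Z)
  moreover have "hw \<in> ?S"
    using vecs.casimir_highest[OF hw(3,2)] by (simp add: casimir_const_def)
  ultimately have "?S = UNIV" using hw(1) by auto
  then have "(Jz ** Jz + Jz + Jm ** Jp) *v v = cscale casimir_const (mat 1) *v v" for v
    by (auto simp: vecs.casimir_def matrix_vector_mul_assoc matrix_vector_mult_add_rdistrib cscale_mult_vec)
  then show ?thesis
    by (simp add: matrix_eq)
qed

end

subsection \<open>Realignment of superoperators\<close>

text \<open>
  \<open>choi S X = (\<Sum>a b. S e\<^sub>a\<^sub>b X e\<^sub>b\<^sub>a)\<close> for the matrix units \<open>e\<^sub>a\<^sub>b\<close>. This sends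
  \<open>Y \<mapsto> tr(B\<^sup>* Y) A\<close> to \<open>X \<mapsto> A X B\<^sup>*\<close>, and hence \<^const>\<open>Pi_map\<close> to \<^const>\<open>Phi_map\<close>.
\<close>

definition choi :: "(complex ^ 'd ^ 'd \<Rightarrow> complex ^ 'd ^ 'd) \<Rightarrow> complex ^ 'd ^ 'd \<Rightarrow> complex ^ 'd ^ 'd" where
  "choi S X = (\<chi> p q. \<Sum>b\<in>UNIV. \<Sum>c\<in>UNIV. S (matrix_unit q b) $ p $ c * X $ c $ b)"

lemma choi_nth: "choi S X $ p $ q = (\<Sum>b\<in>UNIV. \<Sum>c\<in>UNIV. S (matrix_unit q b) $ p $ c * X $ c $ b)"
  by (simp add: choi_def)

lemma choi_linear: "cmat_linear (choi S)"
  by (rule cmat_linearI)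
    (simp_all add: vec_eq_iff choi_nth algebra_simps sum.distrib sum_distrib_left)

lemma choi_add: "choi (\<lambda>Y. S Y + T Y) X = choi S X + choi T X"
  and choi_diff: "choi (\<lambda>Y. S Y - T Y) X = choi S X - choi T X"
  and choi_cscale: "choi (\<lambda>Y. cscale c (S Y)) X = cscale c (choi S X)"
  by (simp_all add: vec_eq_iff choi_nth algebra_simps sum.distrib sum_subtractf sum_distrib_left)

lemma choi_zero: "choi (\<lambda>Y. 0) X = 0"
  by (simp add: vec_eq_iff choi_nth)

lemma choi_sum: "choi (\<lambda>Y. \<Sum>i\<in>I. S i Y) X = (\<Sum>i\<in>I. choi (S i) X)"
  by (induction I rule: infinite_finite_induct) (simp_all add: choi_add choi_zero)

text \<open>The identity is the sum of all Pi_t, so this is the source of sum Phi_t(X) = tr(X)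
  I.\<close>

lemma choi_id: "choi (\<lambda>Y. Y) X = cscale (trace X) (mat 1)"
proof -
  have "choi (\<lambda>Y. Y) X $ p $ q = cscale (trace X) (mat 1) $ p $ q" for p q
    by (cases "p = q")
      (simp_all add: choi_nth trace_def mat_def if_distrib[of "\<lambda>x. x * _"] cong: if_cong)
  then show ?thesis by (simp add: vec_eq_iff)
qed

text \<open>Up to the factor 1/(n + 1), the realigned map is the projection onto the scalars; this
  gives Phi_0.\<close>

lemma choi_trace: "choi (\<lambda>Y. cscale (trace Y) (mat 1)) X = X"
proof -
  have tr: "trace (matrix_unit q b) = (if q = b then 1 else 0)" for q b :: 'a
    by (auto simp: trace_def intro!: sum.neutral)
  have "choi (\<lambda>Y. cscale (trace Y) (mat 1)) X $ p $ q = (\<Sum>b\<in>UNIV. if q = b then X $ p $ b else 0)" for p q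
    unfolding choi_nth
  proof (intro sum.cong refl)
    fix b
    show "(\<Sum>c\<in>UNIV. cscale (trace (matrix_unit q b)) (mat 1) $ p $ c * X $ c $ b) = (if q = b then X $ p $ b else 0)"
      by (cases "q = b") (simp_all add: tr mat_def if_distrib[of "\<lambda>x. x * _"] cong: if_cong)
  qed
  then show ?thesis by (simp add: vec_eq_iff)
qed

lemma matrix_mult_unit: "A ** matrix_unit q b = (\<Sum>r\<in>UNIV. cscale (A $ r $ q) (matrix_unit r b))"
proof -
  have "(\<Sum>k\<in>UNIV. A $ i $ k * (if k = q \<and> j = b then 1 else 0)) = A $ i $ q * (if j = b then 1 else 0)" for i j
    by (simp add: if_distrib cong: if_cong)
  moreover have "(\<Sum>r\<in>UNIV. A $ r $ q * (if i = r \<and> j = b then 1 else 0)) = A $ i $ q * (if j = b then 1 else 0)" for i j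
    by (simp add: if_distrib cong: if_cong)
  ultimately show ?thesis
    by (simp add: vec_eq_iff matrix_mult_nth)
qed

lemma matrix_unit_mult: "matrix_unit q b ** A = (\<Sum>r\<in>UNIV. cscale (A $ b $ r) (matrix_unit q r))"
proof -
  have "(\<Sum>k\<in>UNIV. (if i = q \<and> k = b then 1 else 0) * A $ k $ j) = A $ b $ j * (if i = q then 1 else 0)" for i j
    by (simp add: if_distrib[of "\<lambda>x. x * _"] cong: if_cong)
  moreover have "(\<Sum>r\<in>UNIV. A $ b $ r * (if i = q \<and> j = r then 1 else 0)) = A $ b $ j * (if i = q then 1 else 0)" for i j
    by (simp add: if_distrib cong: if_cong)
  ultimately show ?thesis
    by (simp add: vec_eq_iff matrix_mult_nth)
qed

text \<open>This and the next three lemmas say where multiplications go under realignment. In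
  particular Y -> A S(B Y) becomes X -> A S'(X) B, where S' is the realigned S; this is what creates
  the sandwich by generators.\<close>

lemma choi_mult_left: "choi (\<lambda>Y. A ** S Y) X = A ** choi S X"
proof -
  have "(\<Sum>b\<in>UNIV. \<Sum>c\<in>UNIV. (\<Sum>k\<in>UNIV. A $ p $ k * S (matrix_unit q b) $ k $ c) * X $ c $ b)
      = (\<Sum>k\<in>UNIV. A $ p $ k * (\<Sum>b\<in>UNIV. \<Sum>c\<in>UNIV. S (matrix_unit q b) $ k $ c * X $ c $ b))" for p q
  proof -
    have "(\<Sum>b\<in>UNIV. \<Sum>c\<in>UNIV. (\<Sum>k\<in>UNIV. A $ p $ k * S (matrix_unit q b) $ k $ c) * X $ c $ b)
      = (\<Sum>b\<in>UNIV. \<Sum>k\<in>UNIV. \<Sum>c\<in>UNIV. A $ p $ k * S (matrix_unit q b) $ k $ c * X $ c $ b)"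
      unfolding sum_distrib_right by (intro sum.cong refl sum.swap)
    also have "\<dots> = (\<Sum>k\<in>UNIV. \<Sum>b\<in>UNIV. \<Sum>c\<in>UNIV. A $ p $ k * S (matrix_unit q b) $ k $ c * X $ c $ b)"
      by (rule sum.swap)
    also have "\<dots> = (\<Sum>k\<in>UNIV. A $ p $ k * (\<Sum>b\<in>UNIV. \<Sum>c\<in>UNIV. S (matrix_unit q b) $ k $ c * X $ c $ b))"
      unfolding sum_distrib_left by (simp only: mult_ac)
    finally show ?thesis .
  qed
  then show ?thesis by (simp add: vec_eq_iff choi_nth matrix_mult_nth)
qed

lemma choi_mult_right: "choi (\<lambda>Y. S Y ** A) X = choi S (A ** X)"
proof -
  have "(\<Sum>c\<in>UNIV. (\<Sum>k\<in>UNIV. S (matrix_unit q b) $ p $ k * A $ k $ c) * X $ c $ b)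
      = (\<Sum>k\<in>UNIV. S (matrix_unit q b) $ p $ k * (\<Sum>c\<in>UNIV. A $ k $ c * X $ c $ b))" for p q b
    unfolding sum_distrib_left sum_distrib_right by (subst sum.swap) (simp add: mult.assoc)
  then show ?thesis by (simp add: vec_eq_iff choi_nth matrix_mult_nth)
qed

lemma choi_arg_mult_left:
  assumes "cmat_linear S"
  shows "choi (\<lambda>Y. S (A ** Y)) X = choi S X ** A"
proof -
  have "(\<Sum>b\<in>UNIV. \<Sum>c\<in>UNIV. (\<Sum>r\<in>UNIV. A $ r $ q * S (matrix_unit r b) $ p $ c) * X $ c $ b)
     = (\<Sum>r\<in>UNIV. (\<Sum>b\<in>UNIV. \<Sum>c\<in>UNIV. S (matrix_unit r b) $ p $ c * X $ c $ b) * A $ r $ q)" for p q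
  proof -
    have "(\<Sum>b\<in>UNIV. \<Sum>c\<in>UNIV. (\<Sum>r\<in>UNIV. A $ r $ q * S (matrix_unit r b) $ p $ c) * X $ c $ b)
      = (\<Sum>b\<in>UNIV. \<Sum>r\<in>UNIV. \<Sum>c\<in>UNIV. A $ r $ q * S (matrix_unit r b) $ p $ c * X $ c $ b)"
      unfolding sum_distrib_right by (intro sum.cong refl sum.swap)
    also have "\<dots> = (\<Sum>r\<in>UNIV. \<Sum>b\<in>UNIV. \<Sum>c\<in>UNIV. A $ r $ q * S (matrix_unit r b) $ p $ c * X $ c $ b)"
      by (rule sum.swap)
    also have "\<dots> = (\<Sum>r\<in>UNIV. (\<Sum>b\<in>UNIV. \<Sum>c\<in>UNIV. S (matrix_unit r b) $ p $ c * X $ c $ b) * A $ r $ q)"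
      unfolding sum_distrib_right by (simp only: mult_ac)
    finally show ?thesis .
  qed
  then show ?thesis
    by (simp add: vec_eq_iff choi_nth matrix_mult_nth matrix_mult_unit cmat_linear_sum[OF assms] cmat_linear_scale[OF assms])
qed

lemma choi_arg_mult_right:
  assumes "cmat_linear S"
  shows "choi (\<lambda>Y. S (Y ** A)) X = choi S (X ** A)"
proof -
  have "(\<Sum>b\<in>UNIV. \<Sum>c\<in>UNIV. (\<Sum>r\<in>UNIV. A $ b $ r * S (matrix_unit q r) $ p $ c) * X $ c $ b)
     = (\<Sum>r\<in>UNIV. \<Sum>c\<in>UNIV. S (matrix_unit q r) $ p $ c * (\<Sum>b\<in>UNIV. X $ c $ b * A $ b $ r))" for p q
  proof -
    have "(\<Sum>b\<in>UNIV. \<Sum>c\<in>UNIV. (\<Sum>r\<in>UNIV. A $ b $ r * S (matrix_unit q r) $ p $ c) * X $ c $ b)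
      = (\<Sum>b\<in>UNIV. \<Sum>r\<in>UNIV. \<Sum>c\<in>UNIV. A $ b $ r * S (matrix_unit q r) $ p $ c * X $ c $ b)"
      unfolding sum_distrib_right by (intro sum.cong refl sum.swap)
    also have "\<dots> = (\<Sum>r\<in>UNIV. \<Sum>b\<in>UNIV. \<Sum>c\<in>UNIV. A $ b $ r * S (matrix_unit q r) $ p $ c * X $ c $ b)"
      by (rule sum.swap)
    also have "\<dots> = (\<Sum>r\<in>UNIV. \<Sum>c\<in>UNIV. \<Sum>b\<in>UNIV. A $ b $ r * S (matrix_unit q r) $ p $ c * X $ c $ b)"
      by (intro sum.cong refl sum.swap)
    also have "\<dots> = (\<Sum>r\<in>UNIV. \<Sum>c\<in>UNIV. S (matrix_unit q r) $ p $ c * (\<Sum>b\<in>UNIV. X $ c $ b * A $ b $ r))"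
      unfolding sum_distrib_left by (simp only: mult_ac)
    finally show ?thesis .
  qed
  then show ?thesis
    by (simp add: vec_eq_iff choi_nth matrix_mult_nth matrix_unit_mult cmat_linear_sum[OF assms] cmat_linear_scale[OF assms])
qed

text \<open>In S(A Y) - S(Y A) = A S(Y) - S(Y) A, realignment permutes the four terms so that, after
  rearrangement, the same identity results for \<open>choi S\<close>.\<close>

lemma choi_commutator:
  assumes S: "cmat_linear S" and comm: "\<And>Y. S (commutator A Y) = commutator A (S Y)"
  shows "choi S (commutator A X) = commutator A (choi S X)"
proof -
  have "choi (\<lambda>Y. S (A ** Y) - S (Y ** A)) X = choi (\<lambda>Y. A ** S Y - S Y ** A) X"
    using comm by (simp add: commutator_def cmat_linear_diff[OF S])
  then have "choi S X ** A - choi S (X ** A) = A ** choi S X - choi S (A ** X)"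
    by (simp only: choi_diff choi_mult_left choi_mult_right choi_arg_mult_left[OF S] choi_arg_mult_right[OF S])
  then show ?thesis
    by (simp add: commutator_def cmat_linear_diff[OF choi_linear] algebra_simps)
qed

lemma Pi_map_alt: "Pi_map B X = (\<Sum>E\<in>B. cscale (hs_inner E X) E)"
  by (simp add: Pi_map_def hs_inner_def)

lemma Pi_map_linear: "cmat_linear (Pi_map B)"
  by (rule cmat_linearI)
    (simp_all add: Pi_map_alt cmat.scale_left_distrib sum.distrib cmat.scale_sum_right)

lemma hs_inner_matrix_unit: "hs_inner E (matrix_unit q b) = cnj (E $ q $ b)"
proof -
  have "(\<Sum>i\<in>UNIV. \<Sum>k\<in>UNIV. cnj (E $ k $ i) * (if k = q \<and> i = b then 1 else 0))
    = (\<Sum>i\<in>UNIV. if i = b then cnj (E $ q $ i) else 0)"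
    by (intro sum.cong refl) (simp add: if_distrib cong: if_cong)
  then show ?thesis
    by (simp add: hs_inner_def trace_def matrix_mult_nth)
qed

lemma Phi_map_eq_choi: "Phi_map B X = choi (Pi_map B) X"
proof -
  have term_eq: "(\<Sum>b\<in>UNIV. \<Sum>c\<in>UNIV. cnj (E $ q $ b) * E $ p $ c * X $ c $ b) = (E ** X ** adj E) $ p $ q" for E p q
  proof -
    have "(E ** X ** adj E) $ p $ q = (\<Sum>b\<in>UNIV. (\<Sum>c\<in>UNIV. E $ p $ c * X $ c $ b) * cnj (E $ q $ b))"
      by (simp only: matrix_mult_nth adj_nth)
    also have "\<dots> = (\<Sum>b\<in>UNIV. \<Sum>c\<in>UNIV. cnj (E $ q $ b) * E $ p $ c * X $ c $ b)"
      unfolding sum_distrib_right by (simp only: mult_ac)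
    finally show ?thesis by simp
  qed
  have "choi (Pi_map B) X = (\<Sum>E\<in>B. choi (\<lambda>Y. cscale (hs_inner E Y) E) X)"
    by (simp add: Pi_map_alt[abs_def] choi_sum)
  also have "\<dots> = (\<Sum>E\<in>B. E ** X ** adj E)"
    by (intro sum.cong refl) (simp add: vec_eq_iff choi_nth hs_inner_matrix_unit term_eq)
  finally show ?thesis by (simp add: Phi_map_def)
qed

lemma Pi_map_span:
  assumes "hs_orthonormal_basis B V" "Y \<in> V"
  shows "Pi_map B Y = Y"
proof -
  have B: "finite B" "\<And>E F. E \<in> B \<Longrightarrow> F \<in> B \<Longrightarrow> hs_inner E F = (if E = F then 1 else 0)" "cmat.span B = V"
    using assms(1) by (auto simp: hs_orthonormal_basis_def)
  show ?thesis
  proof (rule cmat_linear_eq_on_span[where g = "\<lambda>X. X" and B = B])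
    show "cmat_linear (\<lambda>X. X)" by (rule cmat_linearI) auto
    fix F assume "F \<in> B"
    then have "(\<Sum>E\<in>B. cscale (hs_inner E F) E) = (\<Sum>E\<in>{F}. cscale (hs_inner E F) E)"
      using B by (intro sum.mono_neutral_right) auto
    then show "Pi_map B F = F" using B \<open>F \<in> B\<close> by (simp add: Pi_map_alt)
  qed (use assms B in \<open>auto simp: Pi_map_linear\<close>)
qed

context spin_rep
begin

subsection \<open>The adjoint representation on matrices\<close>

text \<open>The unnormalized weight basis of the component V_j: the highest weight vector Jp^j
  lowered \<open>k\<close> times, of weight j - k.\<close>

definition U :: "nat \<Rightarrow> nat \<Rightarrow> complex ^ 'd ^ 'd" where
  "U j k = (commutator Jm ^^ k) (mpow Jp j)"

lemma U_highest: "commutator Jz (mpow Jp j) = cscale (of_nat j) (mpow Jp j)" "commutator Jp (mpow Jp j) = 0"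
proof -
  show "commutator Jz (mpow Jp j) = cscale (of_nat j) (mpow Jp j)"
    by (induction j) (simp_all add: commutator_mult zp cmat.scale_left_distrib)
  have "commutator Jp Jp = 0" by (simp add: commutator_def)
  then show "commutator Jp (mpow Jp j) = 0"
    by (induction j) (simp_all add: commutator_mult)
qed

lemma U_0_0: "U 0 0 = mat 1"
  by (simp add: U_def)

lemma commutator_Jm_U: "commutator Jm (U j k) = U j (Suc k)"
  by (simp add: U_def)

lemma commutator_Jz_U: "commutator Jz (U j k) = cscale (of_nat j - of_nat k) (U j k)"
  unfolding U_def by (rule mats.weight_lowering[OF U_highest(1)])

lemma commutator_Jp_U_0: "commutator Jp (U j 0) = 0"
  by (simp add: U_def U_highest)

lemma commutator_Jp_U_Suc:
  "commutator Jp (U j (Suc k)) = cscale (of_nat (Suc k) * (2 * of_nat j - of_nat k)) (U j k)"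
  unfolding U_def by (rule mats.raising_lowering[OF U_highest])

lemma hs_inner_ad:
  "hs_inner X (commutator Jz Y) = hs_inner (commutator Jz X) Y"
  "hs_inner X (commutator Jp Y) = hs_inner (commutator Jm X) Y"
  "hs_inner X (commutator Jm Y) = hs_inner (commutator Jp X) Y"
  by (simp_all add: hs_inner_commutator adj_z adj_p adj_m)

lemma hs_inner_weights:
  assumes "commutator Jz X = cscale a X" "commutator Jz Y = cscale b Y" "cnj a \<noteq> b"
  shows "hs_inner X Y = 0"
  using hs_inner_ad(1)[of X Y] assms by auto

text \<open>Lowerings are moved across the inner product as raisings. In the end either the weights
  differ or \<open>Jp\<close> meets a highest weight vector.\<close>

lemma U_orthogonal: "j \<noteq> i \<Longrightarrow> hs_inner (U j k) (U i l) = 0"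
proof (induction k arbitrary: l)
  case 0
  show ?case
  proof (cases l)
    case 0
    then show ?thesis
      using \<open>j \<noteq> i\<close> by (intro hs_inner_weights[OF commutator_Jz_U commutator_Jz_U]) simp
  next
    case (Suc m)
    then show ?thesis
      by (simp add: hs_inner_ad commutator_Jp_U_0 flip: commutator_Jm_U)
  qed
next
  case (Suc k)
  have "hs_inner (U j (Suc k)) (U i l) = hs_inner (U j k) (commutator Jp (U i l))"
    by (simp add: hs_inner_ad commutator_Jm_U)
  also have "\<dots> = 0"
    using Suc by (cases l) (simp_all add: commutator_Jp_U_0 commutator_Jp_U_Suc)
  finally show ?case .
qed

lemma U_orthogonal': "k \<noteq> l \<Longrightarrow> hs_inner (U j k) (U j l) = 0"
  by (intro hs_inner_weights[OF commutator_Jz_U commutator_Jz_U]) simp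

text \<open>The factor 2 j - k is nonzero for k < 2 j and zero at k = 2 j, so each string has
  exactly 2 j + 1 nonzero members when j <= n.\<close>

lemma U_norm_Suc:
  "hs_inner (U j (Suc k)) (U j (Suc k)) = of_nat (Suc k) * (2 * of_nat j - of_nat k) * hs_inner (U j k) (U j k)"
proof -
  have "hs_inner (U j (Suc k)) (U j (Suc k)) = hs_inner (U j k) (commutator Jp (U j (Suc k)))"
    by (simp only: hs_inner_ad commutator_Jm_U)
  then show ?thesis by (simp only: commutator_Jp_U_Suc hs_inner_cscale_right)
qed

lemma U_nonzero:
  assumes "j \<le> n" "k \<le> 2 * j"
  shows "U j k \<noteq> 0"
  using assms(2)
proof (induction k)
  case 0
  then show ?case using assms mpow_Jp_nonzero by (simp add: U_def)
next
  case (Suc k)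
  have "of_nat (2 * j) - of_nat k \<noteq> (0 :: complex)"
    using Suc.prems by (simp del: of_nat_mult)
  with Suc have "hs_inner (U j (Suc k)) (U j (Suc k)) \<noteq> 0"
    unfolding U_norm_Suc by (simp add: hs_inner_self_eq_0 del: of_nat_Suc)
  then show ?case by (simp add: hs_inner_self_eq_0)
qed

lemma U_eq_0: "k > 2 * j \<Longrightarrow> U j k = 0"
proof (induction k)
  case (Suc k)
  show ?case
  proof (cases "k = 2 * j")
    case True
    have "hs_inner (U j (Suc k)) (U j (Suc k)) = 0"
      unfolding U_norm_Suc by (simp add: True)
    then show ?thesis by (simp add: hs_inner_self_eq_0)
  next
    case False
    with Suc have "U j k = 0" by simp
    then show ?thesis by (simp add: commutator_simps flip: commutator_Jm_U)
  qed
qed simp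

definition index_set :: "(nat \<times> nat) set" where
  "index_set = Sigma {..n} (\<lambda>j. {..2 * j})"

lemma U_orthogonal_pairs: "(j, k) \<noteq> (i, l) \<Longrightarrow> hs_inner (U j k) (U i l) = 0"
  by (cases "j = i") (simp_all add: U_orthogonal U_orthogonal')

lemma inj_on_U: "inj_on (\<lambda>(j, k). U j k) index_set"
proof (rule inj_onI, rule ccontr)
  fix x y assume *: "x \<in> index_set" "y \<in> index_set" "(case x of (j, k) \<Rightarrow> U j k) = (case y of (j, k) \<Rightarrow> U j k)" "x \<noteq> y"
  obtain j k i l where xy: "x = (j, k)" "y = (i, l)" by (cases x, cases y)
  have "hs_inner (U j k) (U i l) = 0"
    using * xy by (intro U_orthogonal_pairs) simp
  then have "U i l = 0"
    using * xy by (simp add: hs_inner_self_eq_0)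
  then show False
    using * xy U_nonzero[of i l] by (simp add: index_set_def)
qed

text \<open>Dimension count: 1 + 3 + ... + (2 n + 1) = (n + 1)^2. This is where the absence of
  multiplicities comes from.\<close>

lemma span_U: "cmat.span ((\<lambda>(j, k). U j k) ` index_set) = UNIV"
proof (rule independent_cmat_spans)
  let ?B = "(\<lambda>(j, k). U j k) ` index_set"
  have fin: "finite index_set" by (simp add: index_set_def)
  have orth: "hs_inner E F = 0" if "E \<in> ?B" "F \<in> ?B" "E \<noteq> F" for E F
  proof -
    from that(1,2) obtain j k i l where "E = U j k" "F = U i l" by auto
    with that(3) show ?thesis by (simp only:) (rule U_orthogonal_pairs, auto)
  qed
  show "cmat.independent ?B"
  proof (rule cmat.independent_if_scalars_zero)
    fix f E assume f: "(\<Sum>F\<in>?B. cscale (f F) F) = 0" and E: "E \<in> ?B"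
    have "0 = hs_inner E (\<Sum>F\<in>?B. cscale (f F) F)" by (simp add: f)
    also have "\<dots> = (\<Sum>F\<in>?B. f F * hs_inner E F)" by (simp add: hs_inner_sum_right)
    also have "\<dots> = (\<Sum>F\<in>{E}. f F * hs_inner E F)"
    proof (intro sum.mono_neutral_right ballI)
      fix F assume "F \<in> ?B - {E}"
      with orth[OF E, of F] show "f F * hs_inner E F = 0" by auto
    qed (use fin E in auto)
    finally have "f E * hs_inner E E = 0" by simp
    moreover have "E \<noteq> 0" using E U_nonzero by (auto simp: index_set_def)
    ultimately show "f E = 0" by (simp add: hs_inner_self_eq_0)
  qed (use fin in simp)
  have "card ?B = (\<Sum>j\<le>n. card {..2 * j})"
    by (subst card_image[OF inj_on_U]) (simp add: index_set_def)
  also have "(\<Sum>j\<le>m. card {..2 * j}) = (m + 1) * (m + 1)" for m :: nat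
    by (induction m) auto
  finally show "card ?B = CARD('d) * CARD('d)"
    by (simp add: card)
qed

lemma eq_0_if_orthogonal_U:
  assumes "\<And>j k. j \<le> n \<Longrightarrow> k \<le> 2 * j \<Longrightarrow> hs_inner (U j k) X = 0"
  shows "X = 0"
proof -
  have "hs_inner X X = 0"
  proof (rule hs_inner_span_eq_0)
    show "X \<in> cmat.span ((\<lambda>(j, k). U j k) ` index_set)" by (simp add: span_U)
  qed (use assms in \<open>auto simp: index_set_def\<close>)
  then show ?thesis by (simp add: hs_inner_self_eq_0)
qed

lemma linear_eq_if_eq_on_U:
  assumes "cmat_linear f" "cmat_linear g" "\<And>j k. j \<le> n \<Longrightarrow> k \<le> 2 * j \<Longrightarrow> f (U j k) = g (U j k)"
  shows "f X = g X"
proof (rule cmat_linear_eq_on_span[OF assms(1,2)])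
  show "X \<in> cmat.span ((\<lambda>(j, k). U j k) ` index_set)" by (simp add: span_U)
qed (use assms(3) in \<open>auto simp: index_set_def\<close>)

section \<open>Projections onto the components and Schur's lemma\<close>

definition proj :: "nat \<Rightarrow> complex ^ 'd ^ 'd \<Rightarrow> complex ^ 'd ^ 'd" where
  "proj t X = (\<Sum>k\<le>2 * t. cscale (hs_inner (U t k) X / hs_inner (U t k) (U t k)) (U t k))"

lemma proj_linear: "cmat_linear (proj t)"
  by (rule cmat_linearI)
    (simp_all add: proj_def cmat.scale_left_distrib sum.distrib cmat.scale_sum_right add_divide_distrib)

lemma proj_U:
  assumes "t \<le> n"
  shows "proj t (U j k) = (if j = t then U j k else 0)"
proof (cases "j = t \<and> k \<le> 2 * t")
  case True
  then have "proj t (U j k) = (\<Sum>l\<in>{k}. cscale (hs_inner (U t l) (U t k) / hs_inner (U t l) (U t l)) (U t l))"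
    unfolding proj_def by (simp only:) (intro sum.mono_neutral_right, auto simp: U_orthogonal')
  then show ?thesis
    using True U_nonzero[OF assms, of k] by (simp add: hs_inner_self_eq_0)
next
  case False
  then show ?thesis
    by (auto simp: proj_def U_orthogonal U_eq_0)
qed

lemma proj_commutator:
  assumes "t \<le> n"
  shows "proj t (commutator Jz X) = commutator Jz (proj t X)"
    and "proj t (commutator Jp X) = commutator Jp (proj t X)"
    and "proj t (commutator Jm X) = commutator Jm (proj t X)"
proof -
  note lin = cmat_linear_compose[OF proj_linear commutator_linear] cmat_linear_compose[OF commutator_linear proj_linear]
  note U_simps = proj_U[OF assms] cmat_linear_scale[OF proj_linear] cmat_linear_zero[OF proj_linear] commutator_simps
    commutator_Jz_U commutator_Jp_U_0 commutator_Jp_U_Suc commutator_Jm_U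
  show "proj t (commutator Jz X) = commutator Jz (proj t X)"
    by (rule linear_eq_if_eq_on_U[OF lin]) (simp add: U_simps)
  show "proj t (commutator Jm X) = commutator Jm (proj t X)"
    by (rule linear_eq_if_eq_on_U[OF lin]) (simp add: U_simps)
  show "proj t (commutator Jp X) = commutator Jp (proj t X)"
  proof (rule linear_eq_if_eq_on_U[OF lin])
    fix j k
    show "proj t (commutator Jp (U j k)) = commutator Jp (proj t (U j k))"
      by (cases k) (simp_all add: U_simps)
  qed
qed

lemma sum_proj: "(\<Sum>t\<le>n. proj t X) = X"
proof (rule linear_eq_if_eq_on_U)
  show "cmat_linear (\<lambda>X. \<Sum>t\<le>n. proj t X)"
    by (rule cmat_linearI)
      (simp_all add: cmat_linear_add[OF proj_linear] cmat_linear_scale[OF proj_linear] sum.distrib cmat.scale_sum_right)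
  show "cmat_linear (\<lambda>X. X)" by (rule cmat_linearI) auto
  fix j k assume "j \<le> n"
  have "(\<Sum>t\<le>n. proj t (U j k)) = (\<Sum>t\<le>n. if j = t then U j k else 0)"
    by (intro sum.cong) (auto simp: proj_U)
  with \<open>j \<le> n\<close> show "(\<Sum>t\<le>n. proj t (U j k)) = U j k" by simp
qed

definition eigen_coeff :: "(complex ^ 'd ^ 'd \<Rightarrow> complex ^ 'd ^ 'd) \<Rightarrow> nat \<Rightarrow> complex" where
  "eigen_coeff f j = hs_inner (U j 0) (f (U j 0)) / hs_inner (U j 0) (U j 0)"

lemma eigen_coeff_eq:
  assumes "j \<le> n" "f (U j 0) = cscale c (U j 0)"
  shows "eigen_coeff f j = c"
  using assms U_nonzero[of j 0] by (simp add: eigen_coeff_def hs_inner_self_eq_0)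

text \<open>
  Schur's lemma: \<open>f (U j 0)\<close> is again annihilated by \<open>Jp\<close> and of weight \<open>j\<close>, and the
  decomposition is multiplicity-free.
\<close>

lemma equivariant_on_U:
  assumes f: "cmat_linear f"
    and comm: "\<And>X. f (commutator Jz X) = commutator Jz (f X)" "\<And>X. f (commutator Jp X) = commutator Jp (f X)"
      "\<And>X. f (commutator Jm X) = commutator Jm (f X)"
    and j: "j \<le> n"
  shows "f (U j k) = cscale (eigen_coeff f j) (U j k)"
proof (induction k)
  case 0
  define Y where "Y = f (U j 0) - cscale (eigen_coeff f j) (U j 0)"
  have YP: "commutator Jp Y = 0"
    by (simp add: Y_def commutator_simps commutator_Jp_U_0 cmat_linear_zero[OF f] flip: comm)
  have YZ: "commutator Jz Y = cscale (of_nat j) Y"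
    by (simp add: Y_def commutator_simps commutator_Jz_U cmat_linear_scale[OF f] cmat.scale_right_diff_distrib
        mult.commute flip: comm)
  have "Y = 0"
  proof (rule eq_0_if_orthogonal_U)
    fix i l
    show "hs_inner (U i l) Y = 0"
    proof (cases l)
      case 0
      show ?thesis
      proof (cases "i = j")
        case True
        then show ?thesis
          using U_nonzero[OF j, of 0] 0 by (simp add: Y_def eigen_coeff_def hs_inner_self_eq_0)
      next
        case False
        then show ?thesis
          using 0 by (intro hs_inner_weights[OF commutator_Jz_U YZ]) simp
      qed
    next
      case (Suc m)
      then have "hs_inner (U i l) Y = hs_inner (U i m) (commutator Jp Y)"
        by (simp add: hs_inner_ad commutator_Jm_U)
      then show ?thesis by (simp add: YP)
    qed
  qed
  then show ?case by (simp add: Y_def)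
next
  case (Suc k)
  then show ?case by (simp add: comm commutator_simps flip: commutator_Jm_U)
qed

lemma equivariant_eq_sum_proj:
  assumes f: "cmat_linear f"
    and comm: "\<And>X. f (commutator Jz X) = commutator Jz (f X)" "\<And>X. f (commutator Jp X) = commutator Jp (f X)"
      "\<And>X. f (commutator Jm X) = commutator Jm (f X)"
  shows "f X = (\<Sum>t\<le>n. cscale (eigen_coeff f t) (proj t X))"
proof (rule linear_eq_if_eq_on_U[OF f])
  show "cmat_linear (\<lambda>X. \<Sum>t\<le>n. cscale (eigen_coeff f t) (proj t X))"
    by (rule cmat_linearI)
      (simp_all add: cmat_linear_add[OF proj_linear] cmat_linear_scale[OF proj_linear] sum.distrib
        cmat.scale_sum_right cmat.scale_right_distrib mult.commute)
  fix j k assume "j \<le> n"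
  have "(\<Sum>t\<le>n. cscale (eigen_coeff f t) (proj t (U j k))) = (\<Sum>t\<le>n. if j = t then cscale (eigen_coeff f t) (U j k) else 0)"
    by (intro sum.cong) (auto simp: proj_U)
  with \<open>j \<le> n\<close> show "f (U j k) = (\<Sum>t\<le>n. cscale (eigen_coeff f t) (proj t (U j k)))"
    using equivariant_on_U[OF assms \<open>j \<le> n\<close>] by simp
qed

end

lemma mat_products_0: "mat_products S 0 = {mat 1}"
  by (auto simp: mat_products_def)

lemma mat_products_Suc: "mat_products S (Suc k) = {A ** B |A B. A \<in> S \<and> B \<in> mat_products S k}"
proof (intro equalityI subsetI)
  fix X assume "X \<in> mat_products S (Suc k)"
  then obtain As where "X = foldr (**) As (mat 1)" "length As = Suc k" "set As \<subseteq> S"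
    by (auto simp: mat_products_def)
  then show "X \<in> {A ** B |A B. A \<in> S \<and> B \<in> mat_products S k}"
    by (cases As) (auto simp: mat_products_def)
next
  fix X assume "X \<in> {A ** B |A B. A \<in> S \<and> B \<in> mat_products S k}"
  then obtain A Bs where "X = A ** foldr (**) Bs (mat 1)" "A \<in> S" "length Bs = k" "set Bs \<subseteq> S"
    by (auto simp: mat_products_def)
  then show "X \<in> mat_products S (Suc k)"
    unfolding mat_products_def by (intro CollectI exI[of _ "A # Bs"]) auto
qed

context spin_rep
begin

subsection \<open>The error spaces\<close>

definition errors :: "(complex ^ 'd ^ 'd) set" where
  "errors = cmat.span {mat 1, Jz, Jp, Jm}"

definition error_space :: "nat \<Rightarrow> (complex ^ 'd ^ 'd) set" where
  "error_space k = cmat.span (mat_products errors k)"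

lemma generators_in_errors: "mat 1 \<in> errors" "Jz \<in> errors" "Jp \<in> errors" "Jm \<in> errors"
  by (auto simp: errors_def intro: cmat.span_base)

lemma subspace_error_space: "cmat.subspace (error_space k)"
  by (simp add: error_space_def)

lemma error_space_mult:
  assumes "A \<in> errors" "Y \<in> error_space k"
  shows "A ** Y \<in> error_space (Suc k)"
  using assms(2) unfolding error_space_def
proof (induction rule: cmat.span_induct_alt)
  case base
  then show ?case by (simp add: cmat.span_zero)
next
  case (step c X Y)
  have "A ** X \<in> cmat.span (mat_products errors (Suc k))"
    using step assms(1) by (intro cmat.span_base) (auto simp: mat_products_Suc)
  with step show ?case
    by (simp add: matrix_add_ldistrib cmat.span_add cmat.span_scale)
qed

text \<open>Induction principle for the filtration: it is contained in every increasing family of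
  subspaces that starts with the identity and whose index grows by one under left multiplication by
  a generator.\<close>

lemma error_space_least:
  assumes Q: "\<And>k. cmat.subspace (Q k)" and one: "mat 1 \<in> Q 0"
    and mult: "\<And>k Y. Y \<in> Q k \<Longrightarrow> Y \<in> Q (Suc k) \<and> Jz ** Y \<in> Q (Suc k) \<and> Jp ** Y \<in> Q (Suc k) \<and> Jm ** Y \<in> Q (Suc k)"
  shows "error_space k \<subseteq> Q k"
  unfolding error_space_def
proof (rule cmat.span_minimal[OF _ Q])
  show "mat_products errors k \<subseteq> Q k"
  proof (induction k)
    case 0
    then show ?case using one by (simp add: mat_products_0)
  next
    case (Suc k)
    have "A ** B \<in> Q (Suc k)" if "A \<in> errors" "B \<in> Q k" for A B
      using that(1) unfolding errors_def
    proof (induction rule: cmat.span_induct_alt)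
      case base
      then show ?case by (simp add: cmat.subspace_0[OF Q])
    next
      case (step c X Y)
      then have "X ** B \<in> Q (Suc k)" using mult[OF that(2)] by auto
      with step show ?case
        by (simp add: matrix_mult_add_left cmat.subspace_add[OF Q] cmat.subspace_scale[OF Q])
    qed
    with Suc show ?case by (auto simp: mat_products_Suc)
  qed
qed

lemma error_space_mono: "j \<le> k \<Longrightarrow> error_space j \<subseteq> error_space k"
proof (induction k rule: dec_induct)
  case (step k)
  have "error_space k \<subseteq> error_space (Suc k)"
    using error_space_mult[OF generators_in_errors(1)] by auto
  with step show ?case by blast
qed simp

lemma commutators:
  "commutator Jp Jz = - Jp" "commutator Jm Jz = Jm" "commutator Jm Jp = cscale (- 2) Jz"
proof -
  have "commutator A B = - commutator B A" for A B :: "complex ^ 'd ^ 'd"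
    by (simp add: commutator_def)
  from this[of Jp Jz] this[of Jm Jz] this[of Jm Jp]
  show "commutator Jp Jz = - Jp" "commutator Jm Jz = Jm" "commutator Jm Jp = cscale (- 2) Jz"
    by (simp_all add: zp zm pm)
qed

lemma commutator_errors:
  assumes "A \<in> {Jz, Jp, Jm}" "G \<in> errors"
  shows "commutator A G \<in> errors"
  using assms(2) unfolding errors_def
proof (induction rule: cmat.span_induct_alt)
  case base
  then show ?case by (simp add: commutator_simps cmat.span_zero)
next
  case (step c X Y)
  have "commutator A X \<in> errors"
    using step(1) assms(1) generators_in_errors cmat.span_zero
    by (auto simp: commutators zp zm pm errors_def intro!: cmat.span_scale cmat.span_neg cmat.span_zero)
  with step show ?case
    by (simp add: commutator_simps cmat.span_add cmat.span_scale errors_def)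
qed

lemma commutator_error_space:
  assumes "A \<in> {Jz, Jp, Jm}" "Y \<in> error_space k"
  shows "commutator A Y \<in> error_space k"
proof -
  define Q where "Q k = {Y \<in> error_space k. commutator A Y \<in> error_space k}" for k
  have step: "G ** Y \<in> Q (Suc k)" if "G \<in> errors" "Y \<in> Q k" for G Y k
    using that unfolding Q_def commutator_mult
    by (auto intro!: cmat.subspace_add[OF subspace_error_space] error_space_mult commutator_errors assms(1) simp: commutator_mult)
  have "error_space k \<subseteq> Q k"
  proof (rule error_space_least)
    show "cmat.subspace (Q k)" for k
      using subspace_error_space[of k] by (auto simp: Q_def cmat.subspace_def commutator_simps)
    show "mat 1 \<in> Q 0"
      by (simp add: Q_def error_space_def mat_products_0 cmat.span_base cmat.span_zero)
    show "Y \<in> Q (Suc k) \<and> Jz ** Y \<in> Q (Suc k) \<and> Jp ** Y \<in> Q (Suc k) \<and> Jm ** Y \<in> Q (Suc k)" if "Y \<in> Q k" for Y k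
      using step[OF _ that] generators_in_errors step[OF generators_in_errors(1) that] by simp
  qed
  with assms(2) show ?thesis by (auto simp: Q_def)
qed

lemma U_in_error_space: "U j k \<in> error_space j"
proof (induction k)
  case 0
  have "mpow Jp j \<in> error_space j"
  proof (induction j)
    case (Suc j)
    then show ?case using error_space_mult[OF generators_in_errors(3)] by simp
  qed (simp add: error_space_def mat_products_0 cmat.span_base)
  then show ?case by (simp add: U_def)
next
  case (Suc k)
  then show ?case by (simp add: commutator_error_space flip: commutator_Jm_U)
qed

text \<open>Moving a left factor across the inner product multiplies \<open>X\<close> by its
  adjoint, which changes the weight by at most one. A product of \<open>t\<close> factors therefore
  never brings a weight m > t down to 0, the weight of the identity.\<close>

lemma error_space_weight:
  assumes "Y \<in> error_space t" "commutator Jz X = cscale (of_nat m) X" "t < m"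
  shows "hs_inner X Y = 0"
proof -
  define Q where "Q t = {Y. \<forall>X m. t < m \<longrightarrow> commutator Jz X = cscale (of_nat m) X \<longrightarrow> hs_inner X Y = 0}" for t :: nat
  have "error_space t \<subseteq> Q t"
  proof (rule error_space_least)
    show "cmat.subspace (Q k)" for k
      by (auto simp: Q_def cmat.subspace_def)
    show "mat 1 \<in> Q 0"
      unfolding Q_def
    proof (intro CollectI allI impI)
      fix X m assume "0 < m" "commutator Jz X = cscale (of_nat m) X"
      then show "hs_inner X (mat 1) = 0"
        by (intro hs_inner_weights[of X "of_nat m" "mat 1" 0]) simp_all
    qed
    fix k Y assume Y: "Y \<in> Q k"
    have Q: "hs_inner X Y = 0" if "k < m" "commutator Jz X = cscale (of_nat m) X" for X m
      using Y that unfolding Q_def by blast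
    show "Y \<in> Q (Suc k) \<and> Jz ** Y \<in> Q (Suc k) \<and> Jp ** Y \<in> Q (Suc k) \<and> Jm ** Y \<in> Q (Suc k)"
    proof (intro conjI; unfold Q_def; intro CollectI allI impI)
      fix X m assume m: "Suc k < m" and X: "commutator Jz X = cscale (of_nat m) X"
      show "hs_inner X Y = 0" using m X by (intro Q[of m]) auto
      show "hs_inner X (Jz ** Y) = 0"
        unfolding hs_inner_mult_right adj_z
        using m X by (intro Q[of m]) (auto simp: commutator_mult)
      have "of_nat (m - 1) = (of_nat m - 1 :: complex)" using m by (simp add: of_nat_diff)
      then show "hs_inner X (Jp ** Y) = 0"
        unfolding hs_inner_mult_right adj_p
        using m X by (intro Q[of "m - 1"]) (auto simp: commutator_mult zm cmat.scale_left_diff_distrib matrix_mult_minus_left)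
      show "hs_inner X (Jm ** Y) = 0"
        unfolding hs_inner_mult_right adj_m
        using m X by (intro Q[of "m + 1"]) (auto simp: commutator_mult zp cmat.scale_left_distrib)
    qed
  qed
  with assms show ?thesis unfolding Q_def by blast
qed

text \<open>The highest weight vector has weight j > t; lowerings are moved to the other side, where
  the error space is stable under commutators.\<close>

lemma U_orthogonal_error_space:
  assumes "t < j" "Y \<in> error_space t"
  shows "hs_inner (U j k) Y = 0"
  using assms(2)
proof (induction k arbitrary: Y)
  case 0
  then show ?case
    using commutator_Jz_U[of j 0] assms(1) by (intro error_space_weight[of Y t _ j]) auto
next
  case (Suc k)
  have "hs_inner (U j (Suc k)) Y = hs_inner (U j k) (commutator Jp Y)"
    by (simp only: hs_inner_ad commutator_Jm_U)
  also have "\<dots> = 0"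
    using Suc by (simp add: commutator_error_space)
  finally show ?case .
qed

text \<open>For r < n the nonzero matrix Jp^n is orthogonal to the error space; for r >= n all
  \<open>U j k\<close> belong to it.\<close>

lemma error_space_eq_UNIV_iff: "error_space r = UNIV \<longleftrightarrow> n \<le> r"
proof
  assume UNIV: "error_space r = UNIV"
  show "n \<le> r"
  proof (rule ccontr)
    assume "\<not> n \<le> r"
    then have "hs_inner (U n 0) (U n 0) = 0"
      by (intro U_orthogonal_error_space[of r]) (auto simp: UNIV)
    then show False using U_nonzero[of n 0] by (simp add: hs_inner_self_eq_0)
  qed
next
  assume "n \<le> r"
  have "U j k \<in> error_space r" if "j \<le> n" for j k
  proof -
    have "j \<le> r" using that \<open>n \<le> r\<close> by simp
    from error_space_mono[OF this] U_in_error_space show ?thesis by (rule subsetD)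
  qed
  then have "(\<lambda>(j, k). U j k) ` index_set \<subseteq> error_space r"
    by (auto simp: index_set_def)
  then have "cmat.span ((\<lambda>(j, k). U j k) ` index_set) \<subseteq> error_space r"
    by (rule cmat.span_minimal[OF _ subspace_error_space])
  then show "error_space r = UNIV" by (auto simp: span_U)
qed

definition level :: "nat \<Rightarrow> (complex ^ 'd ^ 'd) set" where
  "level t = cmat.span (U t ` {..2 * t})"

lemma U_in_level: "k \<le> 2 * t \<Longrightarrow> U t k \<in> level t"
  by (auto simp: level_def intro: cmat.span_base)

lemma level_subset_error_space: "level t \<subseteq> error_space t"
  unfolding level_def by (rule cmat.span_minimal[OF _ subspace_error_space]) (auto intro: U_in_error_space)

lemma proj_in_level: "proj t X \<in> level t"
  unfolding proj_def level_def by (intro cmat.span_sum cmat.span_scale cmat.span_base) auto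

lemma level_0: "level 0 = cmat.span {mat 1}"
  by (simp add: level_def U_0_0)

lemma level_altdef:
  assumes "0 < t" "t \<le> n"
  shows "level t = {F \<in> error_space t. \<forall>G\<in>error_space (t - 1). hs_inner G F = 0}"
proof (intro equalityI subsetI)
  fix F assume F: "F \<in> level t"
  have "hs_inner G F = 0" if "G \<in> error_space (t - 1)" for G
  proof -
    have "hs_inner F G = 0"
      using F unfolding level_def
      by (rule hs_inner_span_eq_0[rotated]) (use assms that U_orthogonal_error_space[of "t - 1" t G] in auto)
    then show ?thesis by (subst hs_inner_commute) simp
  qed
  with F level_subset_error_space show "F \<in> {F \<in> error_space t. \<forall>G\<in>error_space (t - 1). hs_inner G F = 0}"
    by auto
next
  fix F assume "F \<in> {F \<in> error_space t. \<forall>G\<in>error_space (t - 1). hs_inner G F = 0}"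
  then have F: "F \<in> error_space t" "\<And>G. G \<in> error_space (t - 1) \<Longrightarrow> hs_inner G F = 0" by auto
  have "F - proj t F = 0"
  \<comment> \<open>The difference is tested on each component: for j < t the hypothesis on
    \<open>F\<close> applies, for j > t its membership in the error space of index
    \<open>t\<close>.\<close>
  proof (rule eq_0_if_orthogonal_U)
    fix j k assume jk: "j \<le> n" "k \<le> 2 * j"
    have "hs_inner (U j k) (proj t F) = (\<Sum>l\<le>2 * t. hs_inner (U t l) F / hs_inner (U t l) (U t l) * hs_inner (U j k) (U t l))"
      by (simp add: proj_def hs_inner_sum_right)
    also have "\<dots> = hs_inner (U j k) F"
    proof (cases "j = t")
      case True
      then have "(\<Sum>l\<le>2 * t. hs_inner (U t l) F / hs_inner (U t l) (U t l) * hs_inner (U j k) (U t l))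
        = (\<Sum>l\<in>{k}. hs_inner (U t l) F / hs_inner (U t l) (U t l) * hs_inner (U j k) (U t l))"
        using jk by (intro sum.mono_neutral_right) (auto simp: U_orthogonal')
      also have "\<dots> = hs_inner (U j k) F"
        using True U_nonzero[OF jk] by (simp add: hs_inner_self_eq_0)
      finally show ?thesis .
    next
      case False
      have "hs_inner (U j k) F = 0"
      proof (cases "j < t")
        case True
        then have "j \<le> t - 1" by simp
        then have "U j k \<in> error_space (t - 1)"
          using error_space_mono U_in_error_space by blast
        then show ?thesis by (rule F(2))
      next
        case False
        with \<open>j \<noteq> t\<close> F(1) show ?thesis by (intro U_orthogonal_error_space[of t]) auto
      qed
      with False show ?thesis by (simp add: U_orthogonal)
    qed
    finally show "hs_inner (U j k) (F - proj t F) = 0" by simp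
  qed
  then show "F \<in> level t" using proj_in_level[of t F] by simp
qed

text \<open>The cardinality enters the traces over a component. Existence also guards the definition
  of the coefficients, which quantifies over all bases, against being vacuous.\<close>

lemma exists_orthonormal_basis:
  assumes "t \<le> n"
  shows "\<exists>B. hs_orthonormal_basis B (level t) \<and> card B = 2 * t + 1"
proof -
  define c where "c k = 1 / complex_of_real (sqrt (Re (hs_inner (U t k) (U t k))))" for k
  define E where "E k = cscale (c k) (U t k)" for k
  have c: "c k \<noteq> 0 \<and> cnj (c k) * c k * hs_inner (U t k) (U t k) = 1" if "k \<le> 2 * t" for k
  proof -
    obtain r where r: "r \<ge> 0" "hs_inner (U t k) (U t k) = of_real r"
      using hs_inner_self_real by blast
    moreover have "r \<noteq> 0"
      using r U_nonzero[OF assms that] hs_inner_self_eq_0[of "U t k"] by auto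
    ultimately show ?thesis
      by (simp add: c_def field_simps flip: of_real_mult)
  qed
  have orth: "hs_inner (E k) (E l) = (if k = l then 1 else 0)" if "k \<le> 2 * t" for k l
    using c[OF that] by (auto simp: E_def U_orthogonal' mult_ac)
  have inj: "inj_on E {..2 * t}"
    by (rule inj_onI) (metis atMost_iff orth zero_neq_one)
  have "cmat.span (E ` {..2 * t}) = level t"
  proof
    show "cmat.span (E ` {..2 * t}) \<subseteq> level t"
      by (rule cmat.span_minimal) (auto simp: E_def level_def intro: cmat.span_scale cmat.span_base)
    have "U t k \<in> cmat.span (E ` {..2 * t})" if "k \<le> 2 * t" for k
    proof -
      have "U t k = cscale (1 / c k) (E k)" using c[OF that] by (simp add: E_def)
      also have "\<dots> \<in> cmat.span (E ` {..2 * t})"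
        using that by (intro cmat.span_scale cmat.span_base) auto
      finally show ?thesis .
    qed
    then show "level t \<subseteq> cmat.span (E ` {..2 * t})"
      unfolding level_def by (intro cmat.span_minimal) auto
  qed
  moreover have "hs_inner F G = (if F = G then 1 else 0)" if "F \<in> E ` {..2 * t}" "G \<in> E ` {..2 * t}" for F G
    using that orth inj by (auto simp: inj_on_eq_iff)
  ultimately have "hs_orthonormal_basis (E ` {..2 * t}) (level t)"
    by (simp add: hs_orthonormal_basis_def)
  moreover have "card (E ` {..2 * t}) = 2 * t + 1"
    by (simp add: card_image[OF inj])
  ultimately show ?thesis by blast
qed

lemma Pi_map_eq_proj:
  assumes "t \<le> n" "hs_orthonormal_basis B (level t)"
  shows "Pi_map B X = proj t X"
proof (rule linear_eq_if_eq_on_U[OF Pi_map_linear proj_linear])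
  fix j k assume jk: "j \<le> n" "k \<le> 2 * j"
  show "Pi_map B (U j k) = proj t (U j k)"
  proof (cases "j = t")
    case True
    then show ?thesis
      using Pi_map_span[OF assms(2) U_in_level] jk by (simp add: proj_U[OF assms(1)])
  next
    case False
    have "hs_inner E (U j k) = 0" if "E \<in> B" for E
    proof (rule hs_inner_span_eq_0)
      show "E \<in> cmat.span (U t ` {..2 * t})"
        using that assms(2) cmat.span_base unfolding hs_orthonormal_basis_def level_def by blast
    qed (use False in \<open>auto simp: U_orthogonal\<close>)
    with False show ?thesis by (simp add: Pi_map_alt proj_U[OF assms(1)])
  qed
qed

lemma Phi_map_eq_choi_proj:
  assumes "t \<le> n" "hs_orthonormal_basis B (level t)"
  shows "Phi_map B X = choi (proj t) X"
proof -
  have "Pi_map B = proj t" using Pi_map_eq_proj[OF assms] by auto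
  then show ?thesis by (simp add: Phi_map_eq_choi)
qed

subsection \<open>The eigenvalues of the quantum channels\<close>

text \<open>Defined through the realigned projection instead of \<open>Phi_map\<close>, so that no
  basis has to be chosen.\<close>

definition channel_eigenvalue :: "nat \<Rightarrow> nat \<Rightarrow> complex" where
  "channel_eigenvalue t j = eigen_coeff (choi (proj t)) j"

lemma choi_proj_equivariant:
  assumes "t \<le> n"
  shows "choi (proj t) (commutator Jz X) = commutator Jz (choi (proj t) X)"
    "choi (proj t) (commutator Jp X) = commutator Jp (choi (proj t) X)"
    "choi (proj t) (commutator Jm X) = commutator Jm (choi (proj t) X)"
  by (simp_all add: choi_commutator proj_linear proj_commutator assms)

lemma choi_proj_U:
  assumes "t \<le> n" "j \<le> n"
  shows "choi (proj t) (U j k) = cscale (channel_eigenvalue t j) (U j k)"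
  unfolding channel_eigenvalue_def
  by (rule equivariant_on_U[OF choi_linear choi_proj_equivariant[OF assms(1)] assms(2)])

lemma choi_proj_eq_sum_proj:
  assumes "t \<le> n"
  shows "choi (proj t) X = (\<Sum>j\<le>n. cscale (channel_eigenvalue t j) (proj j X))"
  unfolding channel_eigenvalue_def
  by (rule equivariant_eq_sum_proj[OF choi_linear choi_proj_equivariant[OF assms]])

lemma channel_eigenvalue_trace:
  assumes "t \<le> n" "j \<le> n" "hs_orthonormal_basis B (level j)" "card B = 2 * j + 1"
  shows "(\<Sum>F\<in>B. hs_inner F (choi (proj t) F)) = of_nat (2 * j + 1) * channel_eigenvalue t j"
proof -
  have "hs_inner F (choi (proj t) F) = channel_eigenvalue t j" if "F \<in> B" for F
  proof -
    have "F \<in> cmat.span (U j ` {..2 * j})"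
      using that assms(3) cmat.span_base unfolding hs_orthonormal_basis_def level_def by blast
    then have "choi (proj t) F = cscale (channel_eigenvalue t j) F"
      by (rule cmat_linear_eq_on_span[OF choi_linear, rotated -1])
        (auto simp: choi_proj_U assms cmat.scale_right_distrib mult.commute intro!: cmat_linearI)
    moreover have "hs_inner F F = 1"
      using that assms(3) by (simp add: hs_orthonormal_basis_def)
    ultimately show ?thesis by simp
  qed
  then show ?thesis using assms(4) by simp
qed

text \<open>Up to conjugation, both sides are the same double sum over orthonormal bases of the two
  components, read through \<open>hs_inner_sandwich\<close>. The conjugation stays because the
  eigenvalues are not yet known to be real.\<close>

lemma channel_eigenvalue_hermitian:
  assumes "t \<le> n" "j \<le> n"
  shows "cnj (of_nat (2 * j + 1) * channel_eigenvalue t j) = of_nat (2 * t + 1) * channel_eigenvalue j t"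
proof -
  obtain B where B: "hs_orthonormal_basis B (level t)" "card B = 2 * t + 1"
    using exists_orthonormal_basis[OF assms(1)] by blast
  obtain C where C: "hs_orthonormal_basis C (level j)" "card C = 2 * j + 1"
    using exists_orthonormal_basis[OF assms(2)] by blast
  have "of_nat (2 * j + 1) * channel_eigenvalue t j = (\<Sum>F\<in>C. \<Sum>E\<in>B. hs_inner F (E ** F ** adj E))"
    unfolding channel_eigenvalue_trace[OF assms C, symmetric] Phi_map_eq_choi_proj[OF assms(1) B(1), symmetric]
    by (simp add: Phi_map_def hs_inner_sum_right)
  then have "cnj (of_nat (2 * j + 1) * channel_eigenvalue t j) = (\<Sum>F\<in>C. \<Sum>E\<in>B. hs_inner (E ** F ** adj E) F)"
    by (simp only: cnj_sum hs_inner_commute[symmetric])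
  also have "\<dots> = (\<Sum>E\<in>B. \<Sum>F\<in>C. hs_inner E (F ** E ** adj F))"
    unfolding hs_inner_sandwich by (rule sum.swap)
  also have "\<dots> = of_nat (2 * t + 1) * channel_eigenvalue j t"
    unfolding channel_eigenvalue_trace[OF assms(2,1) B, symmetric] Phi_map_eq_choi_proj[OF assms(2) C(1), symmetric]
    by (simp add: Phi_map_def hs_inner_sum_right)
  finally show ?thesis .
qed

text \<open>The projections sum to the identity, whose realignment is the trace; Jp^j is traceless
  for j > 0, being orthogonal to the identity matrix.\<close>

lemma sum_channel_eigenvalue:
  assumes "j \<le> n"
  shows "(\<Sum>t\<le>n. channel_eigenvalue t j) = (if j = 0 then of_nat (n + 1) else 0)"
proof -
  have "choi (\<lambda>Y. \<Sum>t\<le>n. proj t Y) (U j 0) = cscale (trace (U j 0)) (mat 1)"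
    by (simp only: sum_proj choi_id)
  moreover have "choi (\<lambda>Y. \<Sum>t\<le>n. proj t Y) (U j 0) = cscale (\<Sum>t\<le>n. channel_eigenvalue t j) (U j 0)"
    unfolding choi_sum cmat.scale_sum_left by (intro sum.cong refl choi_proj_U) (use assms in auto)
  ultimately have eq: "cscale (\<Sum>t\<le>n. channel_eigenvalue t j) (U j 0) = cscale (trace (U j 0)) (U 0 0)"
    by (simp add: U_0_0)
  have "trace (U j 0) = hs_inner (U 0 0) (U j 0)"
    by (simp add: hs_inner_def U_0_0)
  then have "trace (U j 0) = (if j = 0 then of_nat (n + 1) else 0)"
    using card U_orthogonal[of 0 j 0 0] by (cases "j = 0") (simp_all add: U_0_0 trace_I)
  with eq U_nonzero[OF assms, of 0] show ?thesis
    by (auto split: if_splits)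
qed

section \<open>Recurrence in the Casimir eigenvalue\<close>

text \<open>This is \<open>X \<mapsto> \<Sum>\<^sub>i J\<^sub>i X J\<^sub>i\<close> for the Hermitian generators with \<open>J\<^sub>\<plusminus> = J\<^sub>1 \<plusminus> \<i> J\<^sub>2\<close>.\<close>

definition sandwich :: "complex ^ 'd ^ 'd \<Rightarrow> complex ^ 'd ^ 'd" where
  "sandwich X = Jz ** X ** Jz + cscale (1 / 2) (Jp ** X ** Jm + Jm ** X ** Jp)"

text \<open>Expanding the double commutators gives C X + X C - 2 sum J_i X J_i with the Casimir
  matrix C, which is scalar.\<close>

lemma sandwich_casimir: "cscale 2 (sandwich X) = cscale (2 * casimir_const) X - mats.casimir X"
proof -
  define C where "C = Jz ** Jz + Jz + Jm ** Jp"
  have "mats.casimir X = C ** X + X ** C - cscale 2 (sandwich X)"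
  proof -
    have "X ** (Jp ** Jm) = X ** (Jm ** Jp) + X ** Jz + X ** Jz"
      using cmat.scale_left_distrib[of 1 1 "X ** Jz"] by (simp add: matrix_relations matrix_ring_simps)
    moreover have "cscale 2 (sandwich X) = Jz ** X ** Jz + Jz ** X ** Jz + (Jp ** X ** Jm + Jm ** X ** Jp)"
      using cmat.scale_left_distrib[of 1 1 "Jz ** X ** Jz"]
      by (simp add: sandwich_def cmat.scale_right_distrib)
    ultimately show ?thesis
      unfolding mats.casimir_def commutator_def C_def
      by (simp add: matrix_ring_simps)
  qed
  moreover have "C ** X + X ** C = cscale (2 * casimir_const) X"
    using cmat.scale_left_distrib[of casimir_const casimir_const X]
    by (simp add: C_def casimir_scalar)
  ultimately show ?thesis by simp
qed

lemma sandwich_U: "sandwich (U j k) = cscale (casimir_const - of_nat (j * (j + 1)) / 2) (U j k)"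
proof -
  have "mats.casimir (U j k) = cscale (of_nat j * (of_nat j + 1)) (U j k)"
    unfolding U_def by (rule mats.casimir_lowering[OF U_highest])
  then have "cscale 2 (sandwich (U j k)) = cscale (2 * casimir_const - of_nat j * (of_nat j + 1)) (U j k)"
    unfolding sandwich_casimir by (simp add: cmat.scale_left_diff_distrib)
  then have "cscale (1 / 2) (cscale 2 (sandwich (U j k))) = cscale (1 / 2) (cscale (2 * casimir_const - of_nat j * (of_nat j + 1)) (U j k))"
    by simp
  moreover have "casimir_const - of_nat (j * (j + 1)) / 2 = 1 / 2 * (2 * casimir_const - of_nat j * (of_nat j + 1))"
    by (simp add: field_simps)
  ultimately show ?thesis by (simp only: cmat.scale_scale) simp
qed

text \<open>The map Y -> sum J_a Pi_i(J_a Y) over the Hermitian generators, written with J_z and the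
  ladder operators; its realignment is the sandwich applied to Phi_i.\<close>

definition shift :: "nat \<Rightarrow> complex ^ 'd ^ 'd \<Rightarrow> complex ^ 'd ^ 'd" where
  "shift i Y = Jz ** proj i (Jz ** Y) + cscale (1 / 2) (Jp ** proj i (Jm ** Y) + Jm ** proj i (Jp ** Y))"

lemma choi_shift: "choi (shift i) X = sandwich (choi (proj i) X)"
  unfolding shift_def[abs_def] choi_add choi_cscale choi_mult_left choi_arg_mult_left[OF proj_linear]
  by (simp add: sandwich_def matrix_mul_assoc)

lemma shift_linear: "cmat_linear (shift i)"
  by (rule cmat_linearI)
    (simp_all add: shift_def matrix_add_ldistrib cmat_linear_add[OF proj_linear] cmat_linear_scale[OF proj_linear]
      cmat.scale_right_distrib algebra_simps)

text \<open>A commutator acts as a derivation; its effects on the outer and on the inner generator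
  cancel in the sum over all generators.\<close>

lemma shift_equivariant:
  assumes "i \<le> n"
  shows "shift i (commutator Jz X) = commutator Jz (shift i X)"
    "shift i (commutator Jp X) = commutator Jp (shift i X)"
    "shift i (commutator Jm X) = commutator Jm (shift i X)"
proof -
  have neg: "proj i (- Y) = - proj i Y" for Y
    using cmat_linear_scale[OF proj_linear, of i "- 1" Y] by (simp flip: uminus_conv_cscale)
  note eqs = shift_def commutator_simps commutator_mult commutators zp zm pm neg proj_commutator[OF assms, symmetric]
    cmat_linear_add[OF proj_linear] cmat_linear_scale[OF proj_linear] cmat_linear_zero[OF proj_linear]
    matrix_add_ldistrib matrix_mult_add_left matrix_mult_minus_left matrix_mult_minus_right cmat.scale_right_distrib
    cmat_linear_diff[OF proj_linear] matrix_mult_diff_left matrix_mult_diff_right cmat.scale_right_diff_distrib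
  show "shift i (commutator Jz X) = commutator Jz (shift i X)"
    "shift i (commutator Jp X) = commutator Jp (shift i X)"
    "shift i (commutator Jm X) = commutator Jm (shift i X)"
    by (simp_all add: eqs)
qed

lemma shift_in_error_space: "shift i Y \<in> error_space (Suc i)"
proof -
  have "G ** proj i Z \<in> error_space (Suc i)" if "G \<in> errors" for G Z
    using proj_in_level level_subset_error_space by (intro error_space_mult that) blast
  then show ?thesis
    unfolding shift_def using generators_in_errors
    by (intro cmat.subspace_add[OF subspace_error_space] cmat.subspace_scale[OF subspace_error_space]) auto
qed

text \<open>By Schur's lemma \<open>shift i\<close> is a combination of projections, and only
  indices up to i + 1 occur because its values lie in the error space of index i + 1. Realigning and
  evaluating at Jp^j gives the recurrence.\<close>

lemma channel_eigenvalue_recurrence: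
  assumes "i \<le> n"
  shows "\<exists>b. (\<forall>m>Suc i. b m = 0) \<and>
    (\<forall>j\<le>n. of_nat (j * (j + 1)) * channel_eigenvalue i j = (\<Sum>m\<le>n. b m * channel_eigenvalue m j))"
proof -
  define e where "e = eigen_coeff (shift i)"
  have e0: "e m = 0" if "m > Suc i" for m
    unfolding e_def eigen_coeff_def using U_orthogonal_error_space[OF that shift_in_error_space] by simp
  have "shift i = (\<lambda>Y. \<Sum>m\<le>n. cscale (e m) (proj m Y))"
    using equivariant_eq_sum_proj[OF shift_linear shift_equivariant[OF assms]] unfolding e_def by auto
  then have choi: "sandwich (choi (proj i) X) = (\<Sum>m\<le>n. cscale (e m) (choi (proj m) X))" for X
    by (simp add: choi_sum choi_cscale flip: choi_shift)
  have sandwich_scale: "sandwich (cscale c X) = cscale c (sandwich X)" for c X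
    by (simp add: sandwich_def cmat.scale_right_distrib mult.commute)
  have h: "channel_eigenvalue i j * (casimir_const - of_nat (j * (j + 1)) / 2) = (\<Sum>m\<le>n. e m * channel_eigenvalue m j)"
    if j: "j \<le> n" for j
  proof -
    have "cscale (channel_eigenvalue i j * (casimir_const - of_nat (j * (j + 1)) / 2)) (U j 0)
        = sandwich (choi (proj i) (U j 0))"
      unfolding choi_proj_U[OF assms j] sandwich_scale sandwich_U cmat.scale_scale ..
    also have "\<dots> = (\<Sum>m\<le>n. cscale (e m * channel_eigenvalue m j) (U j 0))"
      unfolding choi by (intro sum.cong refl) (simp add: choi_proj_U j)
    also have "\<dots> = cscale (\<Sum>m\<le>n. e m * channel_eigenvalue m j) (U j 0)"
      by (simp add: cmat.scale_sum_left)
    finally show ?thesis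
      using U_nonzero[OF j, of 0] by (simp only: cmat.scale_cancel_right) simp
  qed
  have eq: "of_nat (j * (j + 1)) * channel_eigenvalue i j
      = 2 * casimir_const * channel_eigenvalue i j - 2 * (\<Sum>m\<le>n. e m * channel_eigenvalue m j)" if "j \<le> n" for j
    unfolding h[OF that, symmetric] by (simp add: algebra_simps)
  show ?thesis
  \<comment> \<open>The coefficients arise from solving \<open>h\<close> for the term with j (j +
    1).\<close>
  proof (intro exI[of _ "\<lambda>m. (if m = i then 2 * casimir_const else 0) - 2 * e m"] conjI allI impI)
    fix j assume j: "j \<le> n"
    have "(\<Sum>m\<le>n. (if m = i then 2 * casimir_const else 0) * channel_eigenvalue m j)
        = (\<Sum>m\<le>n. if m = i then 2 * casimir_const * channel_eigenvalue i j else 0)"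
      by (intro sum.cong) auto
    then show "of_nat (j * (j + 1)) * channel_eigenvalue i j
        = (\<Sum>m\<le>n. ((if m = i then 2 * casimir_const else 0) - 2 * e m) * channel_eigenvalue m j)"
      unfolding eq[OF j] using assms
      by (simp add: left_diff_distrib sum_subtractf sum_distrib_left mult.assoc)
  qed (use e0 in auto)
qed

lemma channel_eigenvalue_0:
  assumes "j \<le> n"
  shows "channel_eigenvalue 0 j = 1 / of_nat (n + 1)"
proof -
  have "proj 0 = (\<lambda>Y. cscale (1 / of_nat (n + 1)) (cscale (trace Y) (mat 1)))"
    using card by (simp add: proj_def U_0_0 hs_inner_def trace_I fun_eq_iff)
  then have "choi (proj 0) X = cscale (1 / of_nat (n + 1)) (choi (\<lambda>Y. cscale (trace Y) (mat 1)) X)" for X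
    by (simp only: choi_cscale)
  then show ?thesis
    unfolding channel_eigenvalue_def choi_trace by (intro eigen_coeff_eq assms)
qed

text \<open>Each Newton factor j (j + 1) - k (k + 1) raises the largest index by at most one through
  the recurrence.\<close>

lemma casimir_poly_in_span:
  assumes "k \<le> n"
  shows "\<exists>b. (\<forall>i>k. b i = 0) \<and>
    (\<forall>j\<le>n. of_real (casimir_poly k (real j)) = (\<Sum>i\<le>n. b i * channel_eigenvalue i j))"
  using assms
proof (induction k)
  case 0
  show ?case
  proof (intro exI[of _ "\<lambda>i. if i = 0 then of_nat (n + 1) else 0"] conjI allI impI)
    fix j assume "j \<le> n"
    then have "(\<Sum>i\<le>n. (if i = 0 then of_nat (n + 1) else 0) * channel_eigenvalue i j) = (\<Sum>i\<le>n. if i = 0 then 1 else 0)"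
      by (intro sum.cong refl) (simp add: channel_eigenvalue_0 del: of_nat_add of_nat_Suc)
    then show "complex_of_real (casimir_poly 0 (real j)) = (\<Sum>i\<le>n. (if i = 0 then of_nat (n + 1) else 0) * channel_eigenvalue i j)"
      by simp
  qed auto
next
  case (Suc k)
  then obtain b where b0: "\<And>i. i > k \<Longrightarrow> b i = 0"
    and b: "\<And>j. j \<le> n \<Longrightarrow> of_real (casimir_poly k (real j)) = (\<Sum>i\<le>n. b i * channel_eigenvalue i j)"
    by auto
  obtain c where c0: "\<And>i m. i \<le> n \<Longrightarrow> m > Suc i \<Longrightarrow> c i m = 0"
    and c: "\<And>i j. i \<le> n \<Longrightarrow> j \<le> n \<Longrightarrow> of_nat (j * (j + 1)) * channel_eigenvalue i j = (\<Sum>m\<le>n. c i m * channel_eigenvalue m j)"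
    using channel_eigenvalue_recurrence by metis
  show ?case
  proof (intro exI[of _ "\<lambda>m. (\<Sum>i\<le>n. b i * c i m) - of_nat (k * (k + 1)) * b m"] conjI allI impI)
    fix m assume m: "m > Suc k"
    have "b i * c i m = 0" if "i \<le> n" for i
      using that m b0[of i] c0[of i m] by (cases "i > k") auto
    then have "(\<Sum>i\<le>n. b i * c i m) = 0"
      by (intro sum.neutral) auto
    then show "(\<Sum>i\<le>n. b i * c i m) - of_nat (k * (k + 1)) * b m = 0"
      using m b0[of m] by simp
  next
    fix j assume j: "j \<le> n"
    have "complex_of_real (casimir_poly (Suc k) (real j))
        = (of_nat (j * (j + 1)) - of_nat (k * (k + 1))) * of_real (casimir_poly k (real j))"
    proof -
      have "complex_of_nat (m * (m + 1)) = of_real (real m * (real m + 1))" for m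
        by simp (simp add: algebra_simps)
      moreover have "casimir_poly (Suc k) (real j) = (real j * (real j + 1) - real k * (real k + 1)) * casimir_poly k (real j)"
        by (simp add: casimir_poly_def)
      ultimately show ?thesis by (simp only: of_real_mult of_real_diff)
    qed
    also have "\<dots> = (\<Sum>i\<le>n. b i * (of_nat (j * (j + 1)) * channel_eigenvalue i j))
        - of_nat (k * (k + 1)) * (\<Sum>i\<le>n. b i * channel_eigenvalue i j)"
      unfolding b[OF j] by (simp only: left_diff_distrib right_diff_distrib sum_subtractf sum_distrib_left mult.left_commute)
    also have "(\<Sum>i\<le>n. b i * (of_nat (j * (j + 1)) * channel_eigenvalue i j))
        = (\<Sum>i\<le>n. \<Sum>m\<le>n. b i * c i m * channel_eigenvalue m j)"
      using c[OF _ j] by (intro sum.cong) (auto simp: sum_distrib_left mult.assoc)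
    also have "\<dots> = (\<Sum>m\<le>n. (\<Sum>i\<le>n. b i * c i m) * channel_eigenvalue m j)"
      by (subst sum.swap) (simp add: sum_distrib_right)
    finally show "complex_of_real (casimir_poly (Suc k) (real j))
        = (\<Sum>m\<le>n. ((\<Sum>i\<le>n. b i * c i m) - of_nat (k * (k + 1)) * b m) * channel_eigenvalue m j)"
      by (simp add: left_diff_distrib sum_subtractf sum_distrib_left mult.assoc)
  qed
qed

lemma channel_eigenvalue_eq_racah:
  assumes "t \<le> n" "j \<le> n"
  shows "channel_eigenvalue t j = of_real ((2 * real t + 1) * racah_formula n t j)"
proof -
  define w where "w t j = channel_eigenvalue t j / of_nat (2 * t + 1)" for t j
  have nz: "of_nat (2 * t + 1) \<noteq> (0 :: complex)" for t
    by (simp only: of_nat_eq_0_iff)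
  have w: "channel_eigenvalue t j = of_nat (2 * t + 1) * w t j" for t j
    using nz[of t] by (simp add: w_def del: of_nat_add of_nat_Suc)
  have "w t j = of_real (racah_coeff n t j)"
  proof (rule racah_coeff_unique[OF _ _ _ assms])
    fix t j assume tj: "t \<le> n" "j \<le> n"
    have "of_nat (2 * t + 1) * of_nat (2 * j + 1) * cnj (w t j) = of_nat (2 * t + 1) * of_nat (2 * j + 1) * w j t"
      using channel_eigenvalue_hermitian[OF tj]
      by (simp only: w complex_cnj_mult complex_cnj_of_nat mult_ac)
    then show "cnj (w t j) = w j t"
      using nz[of t] nz[of j] by (simp only: mult_cancel_left mult_eq_0_iff) simp
  next
    fix k assume k: "k \<le> n"
    obtain b where b0: "\<And>i. i > k \<Longrightarrow> b i = 0"
      and b: "\<And>j. j \<le> n \<Longrightarrow> of_real (casimir_poly k (real j)) = (\<Sum>i\<le>n. b i * channel_eigenvalue i j)"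
      using casimir_poly_in_span[OF k] by auto
    show "\<exists>b. \<forall>j\<le>n. of_real (casimir_poly k (real j)) = (\<Sum>i\<le>k. b i * w i j)"
    proof (intro exI[of _ "\<lambda>i. b i * of_nat (2 * i + 1)"] allI impI)
      fix j assume "j \<le> n"
      from b[OF this] have "of_real (casimir_poly k (real j)) = (\<Sum>i\<le>n. b i * channel_eigenvalue i j)" .
      also have "\<dots> = (\<Sum>i\<le>k. b i * channel_eigenvalue i j)"
        using k b0 by (intro sum.mono_neutral_right) auto
      finally show "of_real (casimir_poly k (real j)) = (\<Sum>i\<le>k. b i * of_nat (2 * i + 1) * w i j)"
        by (simp only: w mult.assoc)
    qed
  next
    fix j assume "j \<le> n"
    from sum_channel_eigenvalue[OF this]
    show "(\<Sum>t\<le>n. of_nat (2 * t + 1) * w t j) = (if j = 0 then of_nat (n + 1) else 0)"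
      by (simp only: w)
  qed
  then show ?thesis
    by (simp add: w racah_coeff_eq_formula[OF assms])
qed

end

section \<open>The su(2) quantum metric\<close>

text \<open>The basis \<open>X\<^sub>k = - (\<i> / 2) \<sigma>\<^sub>k\<close> of \<^const>\<open>su2\<close>, where \<open>\<sigma>\<^sub>k\<close> are the Pauli matrices.\<close>

definition su2_x :: "complex ^ 2 ^ 2" where
  "su2_x = vector [vector [0, - \<i> / 2], vector [- \<i> / 2, 0]]"

definition su2_y :: "complex ^ 2 ^ 2" where
  "su2_y = vector [vector [0, - 1 / 2], vector [1 / 2, 0]]"

definition su2_z :: "complex ^ 2 ^ 2" where
  "su2_z = vector [vector [- \<i> / 2, 0], vector [0, \<i> / 2]]"

lemma su2_basis_in_su2: "su2_x \<in> su2" "su2_y \<in> su2" "su2_z \<in> su2"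
  by (simp_all add: su2_def su2_x_def su2_y_def su2_z_def trace_def sum_2 vec_eq_iff forall_2)

lemma su2_commutators:
  "commutator su2_x su2_y = su2_z" "commutator su2_y su2_z = su2_x" "commutator su2_z su2_x = su2_y"
  by (simp_all add: commutator_def su2_x_def su2_y_def su2_z_def matrix_mult_nth sum_2 vec_eq_iff forall_2)

lemma su2_expand:
  assumes "X \<in> su2"
  obtains a b c :: real where "X = a *\<^sub>R su2_x + b *\<^sub>R su2_y + c *\<^sub>R su2_z"
proof
  have skew: "cnj (X $ j $ i) = - X $ i $ j" for i j
    using assms by (simp add: su2_def vec_eq_iff)
  have tr: "X $ 1 $ 1 + X $ 2 $ 2 = 0"
    using assms by (simp add: su2_def trace_def sum_2)
  show "X = (- 2 * Im (X $ 1 $ 2)) *\<^sub>R su2_x + (- 2 * Re (X $ 1 $ 2)) *\<^sub>R su2_y + (- 2 * Im (X $ 1 $ 1)) *\<^sub>R su2_z"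
    using skew[of 1 1] skew[of 1 2] skew[of 2 2] tr
    by (simp add: vec_eq_iff forall_2 su2_x_def su2_y_def su2_z_def complex_eq_iff)
qed

lemma su2_closed: "X \<in> su2 \<Longrightarrow> Y \<in> su2 \<Longrightarrow> X + Y \<in> su2" "X \<in> su2 \<Longrightarrow> a *\<^sub>R X \<in> su2"
proof -
  show "X + Y \<in> su2" if "X \<in> su2" "Y \<in> su2"
    using that by (simp add: su2_def trace_add)
  show "a *\<^sub>R X \<in> su2" if "X \<in> su2"
  proof -
    have "- cscale c X = cscale c (- X)" for c
      by (simp add: vec_eq_iff)
    with that show ?thesis by (simp add: su2_def scaleR_conv_cscale trace_cscale)
  qed
qed

lemma su2_rep_span:
  assumes "su2_unitary_rep \<phi>" "X \<in> su2"
  obtains a b c :: real where "\<phi> X = a *\<^sub>R \<phi> su2_x + b *\<^sub>R \<phi> su2_y + c *\<^sub>R \<phi> su2_z"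
proof -
  obtain a b c where X: "X = a *\<^sub>R su2_x + b *\<^sub>R su2_y + c *\<^sub>R su2_z"
    using su2_expand[OF assms(2)] .
  have "\<phi> X = a *\<^sub>R \<phi> su2_x + b *\<^sub>R \<phi> su2_y + c *\<^sub>R \<phi> su2_z"
    using assms(1) su2_basis_in_su2 su2_closed unfolding X su2_unitary_rep_def by simp
  then show thesis by (rule that)
qed

text \<open>The Hermitian generators are J_k = i phi(X_k), and J_1 + i J_2, J_1 - i J_2 give
  \<open>Jp\<close>, \<open>Jm\<close>; since i times i is -1, phi(X_2) enters with a real
  sign.\<close>

lemma spin_rep_of_su2_rep:
  fixes \<phi> :: "complex ^ 2 ^ 2 \<Rightarrow> complex ^ 'd ^ 'd"
  assumes "su2_unitary_rep \<phi>" "su2_irreducible \<phi>" "CARD('d) = n + 1"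
  defines "Jz \<equiv> cscale \<i> (\<phi> su2_z)"
    and "Jp \<equiv> cscale \<i> (\<phi> su2_x) - \<phi> su2_y"
    and "Jm \<equiv> cscale \<i> (\<phi> su2_x) + \<phi> su2_y"
  shows "spin_rep Jz Jp Jm n"
    and "su2_errors \<phi> = cmat.span {mat 1, Jz, Jp, Jm}"
proof -
  define A B C where "A = \<phi> su2_x" and "B = \<phi> su2_y" and "C = \<phi> su2_z"
  have adj: "adj A = - A" "adj B = - B" "adj C = - C"
    using assms(1) su2_basis_in_su2 by (auto simp: su2_unitary_rep_def A_def B_def C_def)
  have "commutator (\<phi> X) (\<phi> Y) = \<phi> (commutator X Y)" if "X \<in> su2" "Y \<in> su2" for X Y
    using assms(1) that by (simp add: su2_unitary_rep_def)
  then have comm: "commutator A B = C" "commutator B C = A" "commutator C A = B"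
    by (simp_all add: A_def B_def C_def su2_basis_in_su2 su2_commutators)
  have flip: "commutator Y X = - commutator X Y" for X Y :: "complex ^ 'd ^ 'd"
    by (simp add: commutator_def)
  have comm': "commutator B A = - C" "commutator C B = - A" "commutator A C = - B"
    using flip[of B A] flip[of C B] flip[of A C] by (simp_all add: comm)
  have J: "Jz = cscale \<i> C" "Jp = cscale \<i> A - B" "Jm = cscale \<i> A + B"
    by (simp_all add: Jz_def Jp_def Jm_def A_def B_def C_def)
  \<comment> \<open>The inverse relations transfer invariant subspaces and spans back to the
    original action.\<close>
  have ABC: "A = cscale (- \<i> / 2) (Jp + Jm)" "B = cscale (1 / 2) (Jm - Jp)" "C = cscale (- \<i>) Jz"
    by (simp_all add: J vec_eq_iff algebra_simps)
  show "spin_rep Jz Jp Jm n"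
  proof unfold_locales
    have diff: "commutator (X - Y) Z = commutator X Z - commutator Y Z" for X Y Z :: "complex ^ 'd ^ 'd"
      by (simp add: commutator_def matrix_ring_simps)
    show "commutator Jz Jp = Jp" "commutator Jz Jm = - Jm" "commutator Jp Jm = cscale 2 Jz"
      unfolding J commutator_simps diff comm comm' commutator_self by (simp_all add: vec_eq_iff)
    show "adj Jz = Jz" "adj Jp = Jm" "adj Jm = Jp"
      unfolding J adj_simps adj by (simp_all add: vec_eq_iff)
    fix S :: "(complex ^ 'd) set"
    assume S: "vec.subspace S" and inv: "\<And>v. v \<in> S \<Longrightarrow> Jz *v v \<in> S \<and> Jp *v v \<in> S \<and> Jm *v v \<in> S"
    have "A *v v \<in> S" "B *v v \<in> S" "C *v v \<in> S" if "v \<in> S" for v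
      unfolding ABC cscale_mult_vec matrix_vector_mult_add_rdistrib matrix_vector_mult_diff_rdistrib
      using inv[OF that] S by (simp_all only: vec.subspace_scale vec.subspace_add vec.subspace_diff)
    then have "\<phi> X *v v \<in> S" if "X \<in> su2" "v \<in> S" for X v
      using that S by (elim su2_rep_span[OF assms(1)])
        (auto simp: A_def B_def C_def scaleR_conv_cscale cscale_mult_vec matrix_vector_mult_add_rdistrib
          intro!: vec.subspace_scale vec.subspace_add)
    with S assms(2) show "S = {0} \<or> S = UNIV"
      unfolding su2_irreducible_def by blast
  qed (rule assms)
  show "su2_errors \<phi> = cmat.span {mat 1, Jz, Jp, Jm}" (is "_ = ?E")
    unfolding su2_errors_def
  proof
    have E: "mat 1 \<in> ?E" "Jz \<in> ?E" "Jp \<in> ?E" "Jm \<in> ?E"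
      by (auto intro: cmat.span_base)
    then have "A \<in> ?E" "B \<in> ?E" "C \<in> ?E"
      unfolding ABC by (intro cmat.span_scale cmat.span_add cmat.span_diff; simp)+
    then have "\<phi> X \<in> ?E" if "X \<in> su2" for X
      using that by (elim su2_rep_span[OF assms(1)])
        (auto simp: A_def B_def C_def scaleR_conv_cscale intro!: cmat.span_scale cmat.span_add)
    with E show "cmat.span (insert (mat 1) (\<phi> ` su2)) \<subseteq> ?E"
      by (intro cmat.span_minimal) auto
    have "A \<in> cmat.span (insert (mat 1) (\<phi> ` su2))" "B \<in> cmat.span (insert (mat 1) (\<phi> ` su2))"
      "C \<in> cmat.span (insert (mat 1) (\<phi> ` su2))"
      using su2_basis_in_su2 by (auto simp: A_def B_def C_def intro: cmat.span_base)
    then show "?E \<subseteq> cmat.span (insert (mat 1) (\<phi> ` su2))"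
      by (intro cmat.span_minimal)
        (auto simp: J intro: cmat.span_scale cmat.span_add cmat.span_diff cmat.span_base)
  qed
qed

context spin_rep
begin

lemma W_coefficients_iff:
  assumes metric: "\<And>k. \<E> (real k) = error_space k"
  shows "W_coefficients \<E> W \<longleftrightarrow> (\<forall>t\<le>n. \<forall>j\<le>n. W t j = (2 * real t + 1) * racah_formula n t j)"
proof -
  have diameter: "diameter_qm \<E> = n"
    unfolding diameter_qm_def metric error_space_eq_UNIV_iff by (rule Least_equality) auto
  have V: "V_space \<E> t = level t" if "t \<le> n" for t
  proof (cases "t = 0")
    case False
    then have "real t - 1 = real (t - 1)" by (simp add: of_nat_diff)
    with False that show ?thesis
      by (simp only: V_space_def metric level_altdef[of t] if_False)
  qed (simp add: V_space_def level_0)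
  have bases: "(\<forall>t\<le>n. hs_orthonormal_basis (B t) (V_space \<E> t)) \<longleftrightarrow> (\<forall>t\<le>n. hs_orthonormal_basis (B t) (level t))" for B
    by (simp add: V)
  have Phi: "Phi_map (B t) X - (\<Sum>j\<le>n. W t j *\<^sub>R Pi_map (B j) X)
      = (\<Sum>j\<le>n. cscale (channel_eigenvalue t j - of_real (W t j)) (proj j X))"
    if "\<forall>t\<le>n. hs_orthonormal_basis (B t) (level t)" "t \<le> n" for B t X
  proof -
    have "(\<Sum>j\<le>n. W t j *\<^sub>R Pi_map (B j) X) = (\<Sum>j\<le>n. cscale (of_real (W t j)) (proj j X))"
      using that by (intro sum.cong) (auto simp: scaleR_conv_cscale Pi_map_eq_proj)
    moreover have "Phi_map (B t) X = (\<Sum>j\<le>n. cscale (channel_eigenvalue t j) (proj j X))"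
      using that by (simp add: Phi_map_eq_choi_proj choi_proj_eq_sum_proj)
    ultimately show ?thesis
      by (simp add: cmat.scale_left_diff_distrib sum_subtractf)
  qed
  have "W_coefficients \<E> W \<longleftrightarrow> (\<forall>t\<le>n. \<forall>j\<le>n. of_real (W t j) = channel_eigenvalue t j)"
  proof
    assume W: "W_coefficients \<E> W"
    \<comment> \<open>The assumption is a statement about all choices of bases, so one choice is
      needed to extract information from it.\<close>
    obtain B where B: "\<forall>t\<le>n. hs_orthonormal_basis (B t) (level t)"
      using exists_orthonormal_basis by metis
    show "\<forall>t\<le>n. \<forall>j\<le>n. of_real (W t j) = channel_eigenvalue t j"
    proof (intro allI impI)
      fix t j assume tj: "t \<le> n" "j \<le> n"
      define g where "g X = (\<Sum>j\<le>n. cscale (channel_eigenvalue t j - of_real (W t j)) (proj j X))" for X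
      have g_linear: "cmat_linear g"
        by (rule cmat_linearI)
          (simp_all add: g_def cmat_linear_add[OF proj_linear] cmat_linear_scale[OF proj_linear] sum.distrib
            cmat.scale_sum_right cmat.scale_right_distrib mult.commute)
      have g_herm: "g X = 0" if "adj X = X" for X
        unfolding g_def Phi[OF B tj(1), symmetric]
        using W B tj(1) that unfolding W_coefficients_def diameter bases by simp
      \<comment> \<open>The coefficients are tested on self-adjoint operators only, whereas Jp^j is
        not self-adjoint for j > 0; splitting into self-adjoint parts extends the identity.\<close>
      have "g X = 0" for X
      proof -
        have "X = cscale (1 / 2) (X + adj X) + cscale (- \<i> / 2) (cscale \<i> (X - adj X))"
          by (simp add: vec_eq_iff field_simps)
        moreover have "g (X + adj X) = 0" "g (cscale \<i> (X - adj X)) = 0"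
          by (intro g_herm; simp add: vec_eq_iff algebra_simps)+
        ultimately show ?thesis
          by (metis cmat_linear_add[OF g_linear] cmat_linear_scale[OF g_linear] cmat.scale_zero_right add_0)
      qed
      then have "0 = g (U j 0)" by simp
      also have "g (U j 0) = (\<Sum>i\<le>n. if i = j then cscale (channel_eigenvalue t j - of_real (W t j)) (U j 0) else 0)"
        unfolding g_def by (intro sum.cong) (auto simp: proj_U)
      finally show "of_real (W t j) = channel_eigenvalue t j"
        using U_nonzero[OF tj(2), of 0] tj(2) by simp
    qed
  next
    assume W: "\<forall>t\<le>n. \<forall>j\<le>n. of_real (W t j) = channel_eigenvalue t j"
    show "W_coefficients \<E> W"
      unfolding W_coefficients_def diameter bases
    proof (intro allI impI)
      fix B t X assume B: "\<forall>t\<le>n. hs_orthonormal_basis (B t) (level t)" and t: "t \<le> n"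
      have "Phi_map (B t) X - (\<Sum>j\<le>n. W t j *\<^sub>R Pi_map (B j) X) = 0"
        unfolding Phi[OF B t] using W t by (intro sum.neutral) simp
      then show "Phi_map (B t) X = (\<Sum>j\<le>n. W t j *\<^sub>R Pi_map (B j) X)" by simp
    qed
  qed
  also have "\<dots> \<longleftrightarrow> (\<forall>t\<le>n. \<forall>j\<le>n. W t j = (2 * real t + 1) * racah_formula n t j)"
    by (simp only: channel_eigenvalue_eq_racah of_real_eq_iff cong: imp_cong)
  finally show ?thesis .
qed

end

theorem proposition3p6p2:
  fixes n :: nat
    and \<phi> :: "complex ^ 2 ^ 2 \<Rightarrow> complex ^ 'd ^ 'd"
    and W :: "nat \<Rightarrow> nat \<Rightarrow> real"
  assumes "n \<ge> 1"
    and "CARD('d) = n + 1"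
    and "su2_unitary_rep \<phi>"
    and "su2_irreducible \<phi>"
  shows "W_coefficients (su2_metric \<phi>) W \<longleftrightarrow>
    (\<forall>t\<le>n. \<forall>j\<le>n. W t j =
       (-1) ^ (t + j) * (2 * real t + 1) * (fact t)\<^sup>2 * (fact j)\<^sup>2 * fact (n - t) * fact (n - j)
         / (fact (n + t + 1) * fact (n + j + 1))
       * (\<Sum>s = max t j..min (t + j) n.
            (-1) ^ s * fact (n + s + 1)
              / ((fact (s - t))\<^sup>2 * (fact (s - j))\<^sup>2 * (fact (t + j - s))\<^sup>2 * fact (n - s))))"
proof -
  define Jz Jp Jm where "Jz = cscale \<i> (\<phi> su2_z)" and "Jp = cscale \<i> (\<phi> su2_x) - \<phi> su2_y"
    and "Jm = cscale \<i> (\<phi> su2_x) + \<phi> su2_y"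
  note rep = spin_rep_of_su2_rep[OF assms(3,4,2), folded Jz_def Jp_def Jm_def]
  interpret spin_rep Jz Jp Jm n by (rule rep)
  have "su2_metric \<phi> (real k) = error_space k" for k
  proof (cases "k = 0")
    case True
    then show ?thesis by (simp add: su2_metric_def error_space_def mat_products_0)
  next
    case False
    then have "\<not> real k < 1" "nat \<lfloor>real k\<rfloor> = k" by simp_all
    then show ?thesis
      by (simp only: su2_metric_def error_space_def errors_def rep(2) if_False)
  qed
  from W_coefficients_iff[OF this] show ?thesis
    by (simp only: racah_formula_def times_divide_eq_left times_divide_eq_right mult_ac)
qed

end
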